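(* Let $p$ be an odd prime, let $F/\mathbb{Q}$ be a cyclic extension of degree $p$, let $K=\mathbb{Q}(\zeta_p)$ and $L=FK$, with $\Phi$ and $I_i(x)$ as defined in the context. Let $x\in L^{*}$ with $\mathrm{N}_{L/\mathbb{Q}}(x)=\pm q_1^{l_1}\cdots q_n^{l_n}$, where $n\ge 1$, $l_i\in\mathbb{Z}\setminus\{0\}$ and the $q_i$ are distinct rational primes. Suppose that there exists an $i$ such that $q_i$ splits completely in $L$ and $I_i(x)=P^{l_i}$, where $P$ is a prime ideal of $\mathcal{O}_K$ and $p$ does not divide $l_i$. Then $\Phi(\mathrm{N}_{L/K}(x))\notin (L^{*})^{p}$ and $\Phi(\zeta_p\mathrm{N}_{L/K}(x))\notin (L^{*})^{p}$.
   Context: $\zeta_p$ is a fixed primitive $p$-th root of unity and all fields lie in a fixed algebraic closure of $\mathbb{Q}$. $\mathcal{O}_N$ denotes the ring of integers of a number field $N$, and $(L^* )^p$ is the group of $p$-th powers of elements of $L^*$. Let $\bar\tau$ be a fixed generator of $\mathrm{Gal}(L/F)$ (cyclic of order $p-1$) and let $e$ be a primitive root modulo $p$. The homomorphism $\Phi:L^*\to L^*$ is $$\Phi(y)=\prod_{j=0}^{p-2}\bar\tau^{j}(y)^{e^{p-2-j}}=y^{e^{p-2}}\,\bar\tau(y)^{e^{p-3}}\cdots\bar\tau^{p-2}(y).$$ For $x$ as in the claim, $J_i(x)$ denotes the part of the fractional ideal $\mathcal{O}_Lx$ composed of the prime ideals of $\mathcal{O}_L$ lying above $q_i$; then $\mathrm{N}_{L/\mathbb{Q}}(J_i(x))=\mathbb{Z}q_i^{l_i}$.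 Put $I_i(x)=\mathrm{N}_{L/K}(J_i(x))$ (ideal norm), a fractional ideal of $K$ with $\mathrm{N}_{K/\mathbb{Q}}(I_i(x))=\mathbb{Z}q_i^{l_i}$. *)

theory Defs
  imports
    "HOL-Algebra.Algebra"
    "HOL-Algebra.Algebraic_Closure_Type"
    "HOL-Number_Theory.Number_Theory"
begin

text \<open>
  All fields are subfields of the complex numbers, which contain an algebraic closure of the
  rationals. The library set \<open>\<rat> :: complex set\<close> is the field of rational numbers.
\<close>

abbreviation CC :: "complex ring" where
  "CC \<equiv> ring_of_type_algebra"

abbreviation on_carrier :: "complex set \<Rightarrow> complex ring" where
  "on_carrier N \<equiv> CC\<lparr>carrier := N\<rparr>"


subsection \<open>Field extensions\<close>

text \<open>Automorphisms are extensional, so that they are determined by their values on the field.\<close>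

definition Gal :: "complex set \<Rightarrow> complex set \<Rightarrow> (complex \<Rightarrow> complex) monoid" where
  "Gal E F = (BijGroup E)\<lparr>carrier :=
     {\<sigma> \<in> Bij E. \<sigma> \<in> ring_hom (on_carrier E) (on_carrier E) \<and> (\<forall>a\<in>F. \<sigma> a = a)}\<rparr>"

definition galois_extension :: "complex set \<Rightarrow> complex set \<Rightarrow> bool" where
  "galois_extension E F \<longleftrightarrow>
     subfield E CC \<and> subfield F CC \<and> F \<subseteq> E \<and> (\<exists>d. ring.dimension CC d F E) \<and>
     {a \<in> E. \<forall>\<sigma>\<in>carrier (Gal E F). \<sigma> a = a} = F"

definition cyclic_extension :: "complex set \<Rightarrow> complex set \<Rightarrow> bool" where
  "cyclic_extension E F \<longleftrightarrow> galois_extension E F \<and> cyclic_group (Gal E F)"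

definition embeddings :: "complex set \<Rightarrow> complex set \<Rightarrow> (complex \<Rightarrow> complex) set" where
  "embeddings E F =
     {\<sigma> \<in> extensional E. \<sigma> \<in> ring_hom (on_carrier E) CC \<and> (\<forall>a\<in>F. \<sigma> a = a)}"

text \<open>
  The norm \<open>N\<^bsub>E/F\<^esub>\<close> of a finite extension in characteristic 0, as the product
  over the \<open>F\<close>-embeddings of \<open>E\<close>.
\<close>

definition field_norm :: "complex set \<Rightarrow> complex set \<Rightarrow> complex \<Rightarrow> complex" where
  "field_norm E F x = (\<Prod>\<sigma>\<in>embeddings E F. \<sigma> x)"

definition primitive_root_of_unity :: "nat \<Rightarrow> complex \<Rightarrow> bool" where
  "primitive_root_of_unity m \<zeta> \<longleftrightarrow> \<zeta> ^ m = 1 \<and> (\<forall>k. 0 < k \<and> k < m \<longrightarrow> \<zeta> ^ k \<noteq> 1)"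


subsection \<open>Integers and fractional ideals of a number field\<close>

definition int_ring :: "complex set \<Rightarrow> complex set" (\<open>\<O>\<close>) where
  "\<O> N = {a \<in> N. algebraic_int a}"

abbreviation principal :: "complex set \<Rightarrow> complex \<Rightarrow> complex set" where
  "principal N x \<equiv> (\<lambda>a. a * x) ` \<O> N"

text \<open>As usual for Dedekind domains, the zero ideal does not count as a prime ideal.\<close>

definition prime_ideal :: "complex set \<Rightarrow> complex set \<Rightarrow> bool" where
  "prime_ideal N P \<longleftrightarrow> primeideal P (on_carrier (\<O> N)) \<and> P \<noteq> {0}"

text \<open>
  The group of nonzero fractional ideals. Although \<^const>\<open>ideal_prod\<close> is introduced for ideals
  of a ring, it is the set of finite sums of products for any two subsets. Integer powers
  \<open>[^]\<close>, inverses and finite products below are those of this group.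
\<close>

definition frac_ideals :: "complex set \<Rightarrow> complex set monoid" where
  "frac_ideals N =
     \<lparr>carrier = {(\<lambda>a. a / d) ` I | I d.
        ideal I (on_carrier (\<O> N)) \<and> I \<noteq> {0} \<and> d \<in> \<O> N \<and> d \<noteq> 0},
      monoid.mult = ideal_prod CC,
      one = \<O> N\<rparr>"

text \<open>
  The exponent of \<open>P\<close> in the factorisation of \<open>J\<close>: the \<open>k\<close> with
  \<open>J = P\<^sup>k A B\<^sup>-\<^sup>1\<close> for integral ideals \<open>A\<close>, \<open>B\<close> not divisible by (that is, not contained
  in) \<open>P\<close>.
\<close>

definition ideal_exponent :: "complex set \<Rightarrow> complex set \<Rightarrow> complex set \<Rightarrow> int" where
  "ideal_exponent N P J = (THE k. \<exists>A B.
     ideal A (on_carrier (\<O> N)) \<and> \<not> A \<subseteq> P \<and>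
     ideal B (on_carrier (\<O> N)) \<and> \<not> B \<subseteq> P \<and>
     J \<otimes>\<^bsub>frac_ideals N\<^esub> B = (P [^]\<^bsub>frac_ideals N\<^esub> k) \<otimes>\<^bsub>frac_ideals N\<^esub> A)"

definition primes_above :: "complex set \<Rightarrow> nat \<Rightarrow> complex set set" where
  "primes_above N q = {P. prime_ideal N P \<and> of_nat q \<in> P}"

definition splits_completely :: "nat \<Rightarrow> complex set \<Rightarrow> bool" where
  "splits_completely q N \<longleftrightarrow> (\<exists>S. finite S \<and> (\<forall>P\<in>S. prime_ideal N P) \<and>
     ring.dimension CC (card S) \<rat> N \<and>
     principal N (of_nat q) = (\<Otimes>\<^bsub>frac_ideals N\<^esub>P\<in>S. P))"

text \<open>
  The ideal norm, as the fractional ideal of \<open>F\<close> generated by the norms of the elements of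
  \<open>J\<close>. It is the multiplicative map sending a prime \<open>P\<close> of \<open>E\<close> with residue degree \<open>f\<close> to
  the \<open>f\<close>-th power of the prime below \<open>P\<close>.
\<close>

definition ideal_norm :: "complex set \<Rightarrow> complex set \<Rightarrow> complex set \<Rightarrow> complex set" where
  "ideal_norm E F J = ideal_prod CC (\<O> F) (field_norm E F ` J)"

text \<open>The part \<open>J\<^sub>q(x)\<close> of \<open>\<O> L x\<close> above \<open>q\<close>, and its norm \<open>I\<^sub>q(x)\<close> to \<open>K\<close>.\<close>

definition J_part :: "complex set \<Rightarrow> nat \<Rightarrow> complex \<Rightarrow> complex set" where
  "J_part L q x = (\<Otimes>\<^bsub>frac_ideals L\<^esub>P\<in>primes_above L q.
     P [^]\<^bsub>frac_ideals L\<^esub> ideal_exponent L P (principal L x))"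

definition I_part :: "complex set \<Rightarrow> complex set \<Rightarrow> nat \<Rightarrow> complex \<Rightarrow> complex set" where
  "I_part L K q x = ideal_norm L K (J_part L q x)"


subsection \<open>The homomorphism \<open>\<Phi>\<close>\<close>

definition Phi :: "nat \<Rightarrow> nat \<Rightarrow> (complex \<Rightarrow> complex) \<Rightarrow> complex \<Rightarrow> complex" (\<open>\<Phi>\<close>) where
  "\<Phi> p e \<tau> y = (\<Prod>j=0..p - 2. ((\<tau> ^^ j) y) ^ (e ^ (p - 2 - j)))"

definition pth_powers :: "nat \<Rightarrow> complex set \<Rightarrow> complex set" where
  "pth_powers p L = {y ^ p | y. y \<in> L \<and> y \<noteq> 0}"

end

(* The prime q = q_i is unramified in L, so it is itself a uniformizer at every prime Q of L above q
   and defines a valuation v_Q there. Put y = N_{L/K}(x). The least value w_Q of v_Q on a fractional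
   ideal is multiplicative, and w_Q(I_i(x)) = v_Q(y), so I_i(x) = P^l gives v_Q(y) = l w_Q(P); if l < 0
   this uses that P is invertible. The norm of x is the product of the tau^j(y) for 0 <= j <= p - 2, and
   v_Q(tau^j(y)) = l w_{Q_j}(P) for some prime Q_j above q. Comparing values at Q, the non-negative
   integers w_{Q_j}(P) sum to 1, so exactly one of them is nonzero and v_Q(Phi(y)) = e^(p-2-j) l for
   the corresponding j. This is prime to p, so Phi(y) is not a p-th power, and the unit zeta_p does not
   change the valuation.

   That tau has order p - 1 amounts to the irreducibility of the p-th cyclotomic polynomial over F: a
   factor of degree m has value f(1) at 1 with f(1)^(p-1) = t p^m, t a unit, and taking the norm from
   F to Q shows that p - 1 divides m p. *)

theory Submission
  imports Defs "Jordan_Normal_Form.Char_Poly"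
begin

section \<open>Algebraic integers\<close>

text \<open>Ideals are sets of complex numbers, and an ideal is measured at \<open>Q\<close> by the
  least value of \<open>val Q\<close> on its elements. This makes sense for any subset of
  \<open>L\<close>, so a prime of \<open>\<O> K\<close>, a set of norms and an ideal of
  \<open>\<O> L\<close> are compared directly, without unique factorisation. The definitions
  nevertheless use powers and inverses in the monoid \<open>frac_ideals\<close>, where the inverse
  of a non-unit has no meaning; hence invertibility is shown for every prime of every number field.
  In place of an integral basis and of finite generation there is a relation with coprime integer
  coefficients between any \<open>d + 1\<close> elements: it stays nontrivial modulo every prime.

  The product formula for the norm of \<open>x\<close> holds because every element of
  \<open>Gal L \<rat>\<close> is a power of \<open>\<tau>\<close> times an automorphism fixing
  \<open>K\<close>. The power is read off from the image of \<open>\<zeta>\<close>, so all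
  \<open>p - 1\<close> primitive roots must be reached by \<open>\<tau>\<close>. There it is
  decisive that p and p - 1 are coprime: if p - 1 divides m p, it divides m, and 0 < m <= p - 1
  leaves only m = p - 1.\<close>

lemma algebraic_int_of_finite_module:
  fixes u :: "'i \<Rightarrow> complex" and A :: "'i \<Rightarrow> 'i \<Rightarrow> int"
  assumes I: "finite I" "k \<in> I" "u k \<noteq> 0"
    and A: "\<And>i. i \<in> I \<Longrightarrow> \<alpha> * u i = (\<Sum>j\<in>I. of_int (A i j) * u j)"
  shows "algebraic_int \<alpha>"
proof -
  define n where "n = card I"
  obtain f where f: "bij_betw f {..<n} I"
    using I(1) ex_bij_betw_nat_finite[of I] by (auto simp: n_def atLeast0LessThan)
  define M where "M = mat n n (\<lambda>(i, j). A (f i) (f j))"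
  define M' where "M' = (map_mat of_int M :: complex mat)"
  have M: "M \<in> carrier_mat n n" and M': "M' \<in> carrier_mat n n" by (auto simp: M_def M'_def)
  define v where "v = vec n (\<lambda>i. u (f i))"
  obtain k' where k': "k' < n" "f k' = k" using f I(2) by (auto simp: bij_betw_def image_iff)
  have "v \<noteq> 0\<^sub>v n"
  proof
    assume "v = 0\<^sub>v n"
    then have "v $ k' = 0" using k' by simp
    then show False using k' I(3) by (simp add: v_def)
  qed
  moreover have "M' *\<^sub>v v = \<alpha> \<cdot>\<^sub>v v"
  proof (rule eq_vecI)
    show "dim_vec (M' *\<^sub>v v) = dim_vec (\<alpha> \<cdot>\<^sub>v v)" by (simp add: M'_def M_def v_def)
    fix i assume "i < dim_vec (\<alpha> \<cdot>\<^sub>v v)"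
    then have i: "i < n" by (simp add: v_def)
    have "(M' *\<^sub>v v) $ i = (\<Sum>j<n. of_int (A (f i) (f j)) * u (f j))"
      using i by (simp add: M'_def M_def v_def scalar_prod_def atLeast0LessThan)
    also have "\<dots> = (\<Sum>j\<in>I. of_int (A (f i) j) * u j)"
      using sum.reindex_bij_betw[OF f, of "\<lambda>j. of_int (A (f i) j) * u j"] by simp
    also have "\<dots> = \<alpha> * u (f i)" using A[of "f i"] f i by (auto simp: bij_betw_def)
    finally show "(M' *\<^sub>v v) $ i = (\<alpha> \<cdot>\<^sub>v v) $ i" using i by (simp add: v_def)
  qed
  \<comment> \<open>The relations say that \<open>u\<close>, listed as a vector, is an eigenvector
    of the integer matrix \<open>A\<close>, so \<open>\<alpha>\<close> is a root of its monic
    characteristic polynomial. The entries of \<open>u\<close> may be dependent; one nonzero entry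
    makes the vector nonzero.\<close>
  ultimately have "eigenvalue M' \<alpha>"
    unfolding eigenvalue_def eigenvector_def using M' by (intro exI[of _ v]) (auto simp: v_def)
  then have "poly (char_poly M') \<alpha> = 0" using eigenvalue_root_char_poly[OF M'] by simp
  moreover have "char_poly M' = map_poly of_int (char_poly M)"
    unfolding M'_def by (rule of_int_hom.char_poly_hom[OF M])
  moreover have "lead_coeff (char_poly M) = 1" using degree_monic_char_poly[OF M] by simp
  ultimately show ?thesis unfolding algebraic_int_altdef_ipoly by auto
qed

text \<open>Multiplication by \<open>a\<close> on the powers below the degree of a monic equation,
  given by the rows of a companion matrix.\<close>

lemma algebraic_int_power_basis:
  fixes a :: complex
  assumes "algebraic_int a"
  obtains m C where "m > 0"
    "\<And>i. i < m \<Longrightarrow> a * a ^ i = (\<Sum>k<m. of_int (C i k) * a ^ k)"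
proof -
  obtain p :: "int poly" where p: "poly (map_poly of_int p) a = 0" "lead_coeff p = 1"
    using assms unfolding algebraic_int_altdef_ipoly by blast
  define m where "m = degree p"
  have sum: "(\<Sum>k<m. of_int (coeff p k) * a ^ k) + a ^ m = 0"
  proof -
    have "(\<Sum>k\<le>m. of_int (coeff p k) * a ^ k) = 0"
      using p by (simp add: poly_altdef m_def degree_map_poly coeff_map_poly)
    then show ?thesis using p by (simp add: m_def lessThan_Suc_atMost[symmetric])
  qed
  have "m > 0" using sum by (cases m) auto
  \<comment> \<open>Each row shifts to the next power, except the last one, where the equation
    expresses \<open>a ^ m\<close> by lower powers.\<close>
  define C where "C i k = (if Suc i < m then of_bool (k = Suc i) else - coeff p k)" for i k
  have "a * a ^ i = (\<Sum>k<m. of_int (C i k) * a ^ k)" if "i < m" for i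
  proof (cases "Suc i < m")
    case True
    then show ?thesis by (simp add: C_def if_distrib cong: if_cong)
  next
    case False
    with that have "Suc i = m" by simp
    then have "a * a ^ i = a ^ m" by auto
    also have "\<dots> = - (\<Sum>k<m. of_int (coeff p k) * a ^ k)"
      using sum by (simp add: eq_neg_iff_add_eq_0 add.commute)
    finally show ?thesis using False by (simp add: C_def sum_negf)
  qed
  with \<open>m > 0\<close> show ?thesis by (rule that)
qed

text \<open>The monomials \<open>a ^ i * b ^ j\<close> below the two degrees span a module stable
  under both numbers. The coefficient matrices are the Kronecker product and the Kronecker sum of
  the companion matrices.\<close>

lemma
  fixes a b :: complex
  assumes a: "algebraic_int a" and b: "algebraic_int b"
  shows algebraic_int_add: "algebraic_int (a + b)"
    and algebraic_int_mult: "algebraic_int (a * b)"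
proof -
  obtain m C where m: "m > 0" and C: "\<And>i. i < m \<Longrightarrow> a * a ^ i = (\<Sum>k<m. of_int (C i k) * a ^ k)"
    using algebraic_int_power_basis[OF a] by metis
  obtain n D where n: "n > 0" and D: "\<And>i. i < n \<Longrightarrow> b * b ^ i = (\<Sum>k<n. of_int (D i k) * b ^ k)"
    using algebraic_int_power_basis[OF b] by metis
  define I where "I = {..<m} \<times> {..<n}"
  define u where "u = (\<lambda>(i, j). a ^ i * b ^ j)"
  have I: "finite I" "(0, 0) \<in> I" "u (0, 0) \<noteq> 0" using m n by (auto simp: I_def u_def)
  show "algebraic_int (a * b)"
  proof (rule algebraic_int_of_finite_module[of I "(0, 0)" u _ "\<lambda>(i, j) (k, l). C i k * D j l", OF I])
    fix ij assume "ij \<in> I"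
    then obtain i j where ij: "ij = (i, j)" "i < m" "j < n" by (auto simp: I_def)
    have "a * b * u ij = (a * a ^ i) * (b * b ^ j)" by (simp add: u_def ij)
    also have "\<dots> = (\<Sum>kl\<in>I. of_int (C i (fst kl)) * a ^ fst kl * (of_int (D j (snd kl)) * b ^ snd kl))"
      unfolding C[OF ij(2)] D[OF ij(3)] I_def by (simp add: sum_product sum.cartesian_product case_prod_unfold)
    finally show "a * b * u ij = (\<Sum>kl\<in>I. of_int ((case ij of (i, j) \<Rightarrow> \<lambda>(k, l). C i k * D j l) kl) * u kl)"
      by (simp add: ij u_def case_prod_unfold mult_ac)
  qed
  show "algebraic_int (a + b)"
  proof (rule algebraic_int_of_finite_module[of I "(0, 0)" u _
        "\<lambda>(i, j) (k, l). C i k * of_bool (l = j) + of_bool (k = i) * D j l", OF I])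
    fix ij assume "ij \<in> I"
    then obtain i j where ij: "ij = (i, j)" "i < m" "j < n" by (auto simp: I_def)
    have "(a + b) * u ij = (a * a ^ i) * b ^ j + a ^ i * (b * b ^ j)" by (simp add: u_def ij algebra_simps)
    also have "(a * a ^ i) * b ^ j = (\<Sum>k<m. \<Sum>l<n. of_int (C i k * of_bool (l = j)) * a ^ k * b ^ l)"
      unfolding C[OF ij(2)] using ij(3) by (simp add: sum_distrib_right if_distrib if_distribR of_bool_def cong: if_cong)
    also have "a ^ i * (b * b ^ j) = (\<Sum>k<m. \<Sum>l<n. of_int (of_bool (k = i) * D j l) * a ^ k * b ^ l)"
      unfolding D[OF ij(3)] using ij(2)
      by (subst sum.swap) (simp add: sum_distrib_left if_distrib if_distribR of_bool_def mult_ac cong: if_cong)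
    finally show "(a + b) * u ij = (\<Sum>kl\<in>I. of_int ((case ij of (i, j) \<Rightarrow> \<lambda>(k, l). C i k * of_bool (l = j) + of_bool (k = i) * D j l) kl) * u kl)"
      by (simp add: ij u_def I_def sum.distrib[symmetric] sum.cartesian_product case_prod_unfold algebra_simps)
  qed
qed

lemma algebraic_int_sum:
  "(\<And>i. i \<in> I \<Longrightarrow> algebraic_int (f i :: complex)) \<Longrightarrow> algebraic_int (sum f I)"
  by (induction I rule: infinite_finite_induct) (auto intro: algebraic_int_add)

lemma algebraic_int_prod:
  "(\<And>i. i \<in> I \<Longrightarrow> algebraic_int (f i :: complex)) \<Longrightarrow> algebraic_int (prod f I)"
  by (induction I rule: infinite_finite_induct) (auto intro: algebraic_int_mult)

lemma algebraic_int_power: "algebraic_int (a :: complex) \<Longrightarrow> algebraic_int (a ^ n)"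
  using algebraic_int_prod[of "{..<n}" "\<lambda>_. a"] by simp

section \<open>Subfields of the complex numbers\<close>

lemma CC_simps [simp]:
  "carrier CC = UNIV" "x \<otimes>\<^bsub>CC\<^esub> y = x * y" "x \<oplus>\<^bsub>CC\<^esub> y = x + y" "\<one>\<^bsub>CC\<^esub> = 1" "\<zero>\<^bsub>CC\<^esub> = 0"
  by (simp_all add: ring_of_type_algebra_def)

lemma field_CC: "Ring.field CC" by (rule field_from_type_algebra)

lemma ring_CC: "ring CC" by (rule ring_from_type_algebra)

lemma a_inv_CC [simp]: "\<ominus>\<^bsub>CC\<^esub> x = - x"
proof -
  interpret ring CC by (rule ring_CC)
  show ?thesis using minus_equality[of "- x" x] by simp
qed

lemma m_inv_CC [simp]: "x \<noteq> 0 \<Longrightarrow> inv\<^bsub>CC\<^esub> x = inverse x"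
proof -
  interpret Ring.field CC by (rule field_CC)
  assume "x \<noteq> 0"
  then show ?thesis using comm_inv_char[of x "inverse x"] by simp
qed

lemma
  assumes "subfield E CC"
  shows subfield_0: "0 \<in> E" and subfield_1: "1 \<in> E"
    and subfield_add: "x \<in> E \<Longrightarrow> y \<in> E \<Longrightarrow> x + y \<in> E"
    and subfield_minus: "x \<in> E \<Longrightarrow> - x \<in> E"
    and subfield_diff: "x \<in> E \<Longrightarrow> y \<in> E \<Longrightarrow> x - y \<in> E"
    and subfield_mult: "x \<in> E \<Longrightarrow> y \<in> E \<Longrightarrow> x * y \<in> E"
    and subfield_inverse: "x \<in> E \<Longrightarrow> inverse x \<in> E"
    and subfield_divide: "x \<in> E \<Longrightarrow> y \<in> E \<Longrightarrow> x / y \<in> E"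
proof -
  interpret R: ring CC by (rule ring_CC)
  note E = subringE[OF subfieldE(1)[OF assms], simplified]
  show "0 \<in> E" "1 \<in> E" using E by auto
  show add: "x + y \<in> E" if "x \<in> E" "y \<in> E" for x y using E that by auto
  show minus: "- x \<in> E" if "x \<in> E" for x using E that by auto
  show "x - y \<in> E" if "x \<in> E" "y \<in> E" for x y using add[OF that(1) minus[OF that(2)]] by simp
  show mult: "x * y \<in> E" if "x \<in> E" "y \<in> E" for x y using E that by auto
  show inv: "inverse x \<in> E" if "x \<in> E" for x
  proof (cases "x = 0")
    case False
    then show ?thesis using R.subfield_m_inv(1)[OF assms, of x] that by simp
  qed (use \<open>0 \<in> E\<close> in auto)
  show "x / y \<in> E" if "x \<in> E" "y \<in> E" for x y
    unfolding divide_inverse using that by (intro mult inv)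
qed

lemmas subfield_closed = subfield_0 subfield_1 subfield_add subfield_minus subfield_diff
  subfield_mult subfield_inverse subfield_divide

lemma subfield_CC_I:
  assumes "1 \<in> E" "\<And>x. x \<in> E \<Longrightarrow> - x \<in> E"
    "\<And>x y. x \<in> E \<Longrightarrow> y \<in> E \<Longrightarrow> x + y \<in> E" "\<And>x y. x \<in> E \<Longrightarrow> y \<in> E \<Longrightarrow> x * y \<in> E"
    "\<And>x. x \<in> E \<Longrightarrow> x \<noteq> 0 \<Longrightarrow> inverse x \<in> E"
  shows "subfield E CC"
proof -
  interpret R: Ring.field CC by (rule field_CC)
  show ?thesis by (rule R.subfieldI') (use assms in \<open>auto intro!: R.subringI\<close>)
qed

lemma subfield_sum: "subfield E CC \<Longrightarrow> (\<And>i. i \<in> I \<Longrightarrow> f i \<in> E) \<Longrightarrow> sum f I \<in> E"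
  by (induction I rule: infinite_finite_induct) (auto intro: subfield_closed)

lemma subfield_prod: "subfield E CC \<Longrightarrow> (\<And>i. i \<in> I \<Longrightarrow> f i \<in> E) \<Longrightarrow> prod f I \<in> E"
  by (induction I rule: infinite_finite_induct) (auto intro: subfield_closed)

lemma subfield_power: "subfield E CC \<Longrightarrow> x \<in> E \<Longrightarrow> x ^ n \<in> E"
  by (induction n) (auto intro: subfield_closed)

lemma subfield_of_nat: "subfield E CC \<Longrightarrow> of_nat n \<in> E" by (induction n) (auto intro: subfield_closed)

lemma subfield_of_int: "subfield E CC \<Longrightarrow> of_int n \<in> E"
  by (cases n) (auto intro!: subfield_closed(4) subfield_diff subfield_of_nat subfield_1)

lemma Rats_subset_subfield: "subfield E CC \<Longrightarrow> \<rat> \<subseteq> E"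
  by (auto elim!: Rats_cases' intro!: subfield_divide subfield_of_int)

lemma subfield_Rats: "subfield \<rat> CC" by (rule subfield_CC_I) auto

lemma subfield_UNIV: "subfield (UNIV :: complex set) CC" by (rule subfield_CC_I) auto

lemma subfield_generate_field: "subfield (generate_field CC H) CC"
  using field.generate_field_is_subfield[OF field_CC, of H] by simp

lemma generate_field_least: "subfield E CC \<Longrightarrow> H \<subseteq> E \<Longrightarrow> generate_field CC H \<subseteq> E"
  using field.generate_field_min_subfield1[OF field_CC, of H E] by simp

lemma generate_field_superset: "H \<subseteq> generate_field CC H" by (auto intro: generate_field.incl)

text \<open>Nothing is asked outside \<open>E\<close> and no codomain is fixed, so that embeddings,
  automorphisms and the iterates \<open>\<tau> ^^ j\<close>, which need not be extensional, are all
  covered.\<close>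

definition subfield_hom :: "complex set \<Rightarrow> (complex \<Rightarrow> complex) \<Rightarrow> bool" where
  "subfield_hom E \<sigma> \<longleftrightarrow> \<sigma> 1 = 1 \<and> (\<forall>x\<in>E. \<forall>y\<in>E. \<sigma> (x + y) = \<sigma> x + \<sigma> y \<and> \<sigma> (x * y) = \<sigma> x * \<sigma> y)"

lemma subfield_hom_iff:
  "\<sigma> \<in> Ring.ring_hom (on_carrier E) CC \<longleftrightarrow> subfield_hom E \<sigma>"
  "\<sigma> \<in> Ring.ring_hom (on_carrier E) (on_carrier E) \<longleftrightarrow> subfield_hom E \<sigma> \<and> \<sigma> ` E \<subseteq> E"
  unfolding Ring.ring_hom_def subfield_hom_def by (auto simp: Pi_iff)

context
  fixes E \<sigma>
  assumes E: "subfield E CC" and \<sigma>: "subfield_hom E \<sigma>"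
begin

lemma subfield_hom_1: "\<sigma> 1 = 1"
  and subfield_hom_add: "x \<in> E \<Longrightarrow> y \<in> E \<Longrightarrow> \<sigma> (x + y) = \<sigma> x + \<sigma> y"
  and subfield_hom_mult: "x \<in> E \<Longrightarrow> y \<in> E \<Longrightarrow> \<sigma> (x * y) = \<sigma> x * \<sigma> y"
  using \<sigma> unfolding subfield_hom_def by auto

lemma subfield_hom_0: "\<sigma> 0 = 0" using subfield_hom_add[of 0 0] subfield_0[OF E] by simp

lemma subfield_hom_minus: "x \<in> E \<Longrightarrow> \<sigma> (- x) = - \<sigma> x"
  using subfield_hom_add[of x "- x"] subfield_minus[OF E, of x] by (simp add: subfield_hom_0 eq_neg_iff_add_eq_0 add.commute)

lemma subfield_hom_diff: "x \<in> E \<Longrightarrow> y \<in> E \<Longrightarrow> \<sigma> (x - y) = \<sigma> x - \<sigma> y"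
  using subfield_hom_add[of x "- y"] subfield_minus[OF E, of y] by (simp add: subfield_hom_minus)

lemma subfield_hom_eq_0_iff: "x \<in> E \<Longrightarrow> \<sigma> x = 0 \<longleftrightarrow> x = 0"
proof
  assume x: "x \<in> E" "\<sigma> x = 0"
  show "x = 0"
  proof (rule ccontr)
    assume "x \<noteq> 0"
    then show False
      using subfield_hom_mult[of x "inverse x"] x subfield_inverse[OF E, of x] subfield_hom_1 by simp
  qed
qed (simp add: subfield_hom_0)

lemma subfield_hom_inverse: "x \<in> E \<Longrightarrow> \<sigma> (inverse x) = inverse (\<sigma> x)"
  using subfield_hom_mult[of x "inverse x"] subfield_inverse[OF E, of x]
  by (cases "x = 0") (auto simp: subfield_hom_0 subfield_hom_1 subfield_hom_eq_0_iff field_simps)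

lemma subfield_hom_divide: "x \<in> E \<Longrightarrow> y \<in> E \<Longrightarrow> \<sigma> (x / y) = \<sigma> x / \<sigma> y"
  unfolding divide_inverse by (simp add: subfield_hom_mult subfield_hom_inverse subfield_inverse[OF E])

lemma subfield_hom_sum: "(\<And>i. i \<in> I \<Longrightarrow> f i \<in> E) \<Longrightarrow> \<sigma> (sum f I) = (\<Sum>i\<in>I. \<sigma> (f i))"
  by (induction I rule: infinite_finite_induct)
    (auto simp: subfield_hom_0 subfield_hom_add subfield_sum[OF E])

lemma subfield_hom_prod: "(\<And>i. i \<in> I \<Longrightarrow> f i \<in> E) \<Longrightarrow> \<sigma> (prod f I) = (\<Prod>i\<in>I. \<sigma> (f i))"
  by (induction I rule: infinite_finite_induct)
    (auto simp: subfield_hom_1 subfield_hom_mult subfield_prod[OF E])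

lemma subfield_hom_power: "x \<in> E \<Longrightarrow> \<sigma> (x ^ n) = \<sigma> x ^ n"
  by (induction n) (auto simp: subfield_hom_1 subfield_hom_mult subfield_power[OF E])

lemma subfield_hom_of_nat: "\<sigma> (of_nat n) = of_nat n"
  by (induction n) (auto simp: subfield_hom_0 subfield_hom_1 subfield_hom_add subfield_of_nat[OF E] subfield_1[OF E])

lemma subfield_hom_of_int: "\<sigma> (of_int n) = of_int n"
  by (cases n) (auto simp: subfield_hom_of_nat subfield_hom_minus subfield_hom_diff subfield_hom_1
      subfield_of_nat[OF E] subfield_add[OF E] subfield_1[OF E] simp flip: of_nat_Suc)

lemma subfield_hom_Rats: "r \<in> \<rat> \<Longrightarrow> \<sigma> r = r"
  by (auto elim!: Rats_cases' simp: subfield_hom_divide subfield_hom_of_int subfield_of_int[OF E])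

lemma subfield_hom_inj: "inj_on \<sigma> E"
proof (rule inj_onI)
  fix x y assume "x \<in> E" "y \<in> E" "\<sigma> x = \<sigma> y"
  then show "x = y"
    using subfield_hom_eq_0_iff[of "x - y"] by (simp add: subfield_hom_diff subfield_diff[OF E])
qed

text \<open>\<open>K\<close> and \<open>L\<close> are least subfields, so inclusions are checked on
  generators. Images, preimages and equalizers of homomorphisms are the subfields to which this is
  applied.\<close>

lemma subfield_hom_image: "subfield (\<sigma> ` E) CC"
proof (rule subfield_CC_I)
  show "1 \<in> \<sigma> ` E" using subfield_hom_1 subfield_1[OF E] by (metis imageI)
qed (auto simp flip: subfield_hom_add subfield_hom_mult subfield_hom_minus subfield_hom_inverse
    intro!: imageI subfield_closed[OF E])

lemma subfield_hom_vimage: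
  assumes "subfield D CC"
  shows "subfield {x \<in> E. \<sigma> x \<in> D} CC" by (rule subfield_CC_I)
    (auto simp: subfield_hom_1 subfield_hom_add subfield_hom_mult subfield_hom_minus subfield_hom_inverse
      intro!: subfield_closed[OF E] subfield_closed[OF assms])

lemma subfield_hom_algebraic_int: "x \<in> E \<Longrightarrow> algebraic_int x \<Longrightarrow> algebraic_int (\<sigma> x)"
proof -
  assume x: "x \<in> E" "algebraic_int x"
  then obtain p :: "int poly" where p: "poly (map_poly of_int p) x = 0" "lead_coeff p = 1"
    unfolding algebraic_int_altdef_ipoly by blast
  have "poly (map_poly of_int p) (\<sigma> x) = \<sigma> (poly (map_poly of_int p) x)"
    using x(1) by (simp add: poly_altdef degree_map_poly coeff_map_poly subfield_hom_sum subfield_hom_mult subfield_hom_power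
        subfield_hom_of_int subfield_mult[OF E] subfield_power[OF E] subfield_of_int[OF E])
  then show ?thesis using p subfield_hom_0 unfolding algebraic_int_altdef_ipoly by metis
qed

end

lemma subfield_hom_equalizer:
  assumes "subfield E CC" "subfield_hom E \<sigma>" "subfield_hom E \<tau>"
  shows "subfield {x \<in> E. \<sigma> x = \<tau> x} CC"
proof (rule subfield_CC_I)
  note hom = subfield_hom_1 subfield_hom_minus subfield_hom_add subfield_hom_mult subfield_hom_inverse
  note \<sigma> = hom[OF assms(1,2)] and \<tau> = hom[OF assms(1,3)]
  show "1 \<in> {x \<in> E. \<sigma> x = \<tau> x}" using \<sigma>(1) \<tau>(1) subfield_1[OF assms(1)] by simp
  fix x assume x: "x \<in> {x \<in> E. \<sigma> x = \<tau> x}"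
  show "- x \<in> {x \<in> E. \<sigma> x = \<tau> x}"
    using x \<sigma>(2)[of x] \<tau>(2)[of x] subfield_minus[OF assms(1), of x] by simp
  show "inverse x \<in> {x \<in> E. \<sigma> x = \<tau> x}"
    using x \<sigma>(5)[of x] \<tau>(5)[of x] subfield_inverse[OF assms(1), of x] by simp
  fix y assume y: "y \<in> {x \<in> E. \<sigma> x = \<tau> x}"
  show "x + y \<in> {x \<in> E. \<sigma> x = \<tau> x}"
    using x y \<sigma>(3)[of x y] \<tau>(3)[of x y] subfield_add[OF assms(1), of x y] by simp
  show "x * y \<in> {x \<in> E. \<sigma> x = \<tau> x}"
    using x y \<sigma>(4)[of x y] \<tau>(4)[of x y] subfield_mult[OF assms(1), of x y] by simp
qed

section \<open>Linear algebra over a subfield\<close>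

text \<open>Gaussian elimination, one equation at a time, carried out inside \<open>E\<close> so
  that the solution lies in \<open>E\<close>.\<close>

lemma homogeneous_system_solution:
  fixes A :: "'i \<Rightarrow> 'j \<Rightarrow> complex"
  assumes E: "subfield E CC" and "finite I" "finite J" "card I < card J"
    and "\<And>i j. i \<in> I \<Longrightarrow> j \<in> J \<Longrightarrow> A i j \<in> E"
  shows "\<exists>c. (\<forall>j\<in>J. c j \<in> E) \<and> (\<exists>j\<in>J. c j \<noteq> 0) \<and> (\<forall>i\<in>I. (\<Sum>j\<in>J. A i j * c j) = 0)" using assms(2-)
proof (induction I arbitrary: J A rule: finite_induct)
  case empty
  then have "J \<noteq> {}" by auto
  then show ?case by (intro exI[of _ "\<lambda>_. 1"]) (auto simp: subfield_1[OF E])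
next
  case (insert i I)
  show ?case
  proof (cases "\<forall>j\<in>J. A i j = 0")
    case True
    have "\<exists>c. (\<forall>j\<in>J. c j \<in> E) \<and> (\<exists>j\<in>J. c j \<noteq> 0) \<and> (\<forall>i\<in>I. (\<Sum>j\<in>J. A i j * c j) = 0)"
      using insert.prems insert.hyps by (intro insert.IH) auto
    then show ?thesis using True by auto
  next
    case False
    then obtain k where k: "k \<in> J" "A i k \<noteq> 0" by blast
    define J' where "J' = J - {k}"
    have J: "J = insert k J'" "k \<notin> J'" "finite J'" using k insert.prems by (auto simp: J'_def)
    \<comment> \<open>The other equations after the unknown \<open>k\<close> has been eliminated
      with the pivot \<open>A i k\<close>; further below, the entry at \<open>k\<close> is chosen to
      solve equation \<open>i\<close>.\<close>
    define B where "B = (\<lambda>h j. A h j - A h k * A i j / A i k)"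
    have "\<exists>c. (\<forall>j\<in>J'. c j \<in> E) \<and> (\<exists>j\<in>J'. c j \<noteq> 0) \<and> (\<forall>h\<in>I. (\<Sum>j\<in>J'. B h j * c j) = 0)"
    proof (rule insert.IH)
      show "card I < card J'" using insert.prems insert.hyps J by simp
      show "B h j \<in> E" if "h \<in> I" "j \<in> J'" for h j
        using that insert.prems J k unfolding B_def by (intro subfield_closed[OF E]) auto
    qed (use J in auto)
    then obtain c where c: "\<forall>j\<in>J'. c j \<in> E" "\<exists>j\<in>J'. c j \<noteq> 0"
      "\<And>h. h \<in> I \<Longrightarrow> (\<Sum>j\<in>J'. B h j * c j) = 0" by blast
    define s where "s = (\<Sum>j\<in>J'. A i j * c j)"
    define c' where "c' = c(k := - s / A i k)"
    have c'J: "(\<Sum>j\<in>J. A h j * c' j) = A h k * (- s / A i k) + (\<Sum>j\<in>J'. A h j * c j)" for h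
    proof -
      have "(\<Sum>j\<in>J'. A h j * c' j) = (\<Sum>j\<in>J'. A h j * c j)"
        using J by (intro sum.cong) (auto simp: c'_def)
      then show ?thesis unfolding J(1) using J(2,3) by (simp add: c'_def)
    qed
    show ?thesis
    proof (intro exI[of _ c'] conjI ballI)
      have "s \<in> E" unfolding s_def
        using c(1) J insert.prems by (intro subfield_sum[OF E] subfield_mult[OF E]) auto
      then show "c' j \<in> E" if "j \<in> J" for j using that c(1) J(1) k insert.prems unfolding c'_def
        by (auto intro!: subfield_divide[OF E] subfield_minus[OF E])
      show "\<exists>j\<in>J. c' j \<noteq> 0" using c(2) J by (auto simp: c'_def)
      fix h assume h: "h \<in> insert i I"
      show "(\<Sum>j\<in>J. A h j * c' j) = 0"
      proof (cases "h = i")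
        case True
        then show ?thesis using k by (simp add: c'J s_def)
      next
        case False
        then have "h \<in> I" using h by simp
        have "(\<Sum>j\<in>J'. B h j * c j) = (\<Sum>j\<in>J'. A h j * c j) - A h k / A i k * s"
          unfolding B_def s_def by (simp add: algebra_simps sum_subtractf sum_distrib_left)
        then show ?thesis using c(3)[OF \<open>h \<in> I\<close>] by (simp add: c'J)
      qed
    qed
  qed
qed

text \<open>Passage from a basis as a list to indexed sums, with spanning and independence as
  separate facts.\<close>

lemma dimension_basis:
  assumes E: "subfield E CC" and dim: "ring.dimension CC d E V"
  obtains u where "\<And>i. i < d \<Longrightarrow> u i \<in> V"
    "\<And>x. x \<in> V \<Longrightarrow> \<exists>c. (\<forall>i<d. c i \<in> E) \<and> x = (\<Sum>i<d. c i * u i)"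
    "\<And>c. \<forall>i<d. c i \<in> E \<Longrightarrow> (\<Sum>i<d. c i * u i) = 0 \<Longrightarrow> \<forall>i<d. c i = 0"
proof -
  interpret R: ring CC by (rule ring_CC)
  obtain Us where Us: "R.independent E Us" "length Us = d" "R.Span E Us = V"
    using R.exists_base[OF E dim] by blast
  have combine: "R.combine Ks Us' = (\<Sum>i<length Us'. Ks ! i * Us' ! i)" if "length Ks = length Us'" for Ks Us'
    using that
  proof (induction Ks Us' rule: list_induct2)
    case (Cons k Ks v Vs)
    then show ?case unfolding length_Cons sum.lessThan_Suc_shift by simp
  qed simp
  have V: "V = {R.combine Ks Us | Ks. length Ks = length Us \<and> set Ks \<subseteq> E}"
    using R.Span_eq_combine_set_length_version[OF E, of Us] Us(3) by simp
  show ?thesis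
  proof
    show "Us ! i \<in> V" if "i < d" for i
    proof -
      define Ks where "Ks = map (\<lambda>j. if j = i then 1 else 0 :: complex) [0..<d]"
      have "Us ! i = R.combine Ks Us"
        using that Us(2) by (subst combine) (auto simp: Ks_def if_distribR if_distrib cong: if_cong)
      then show ?thesis unfolding V using Us(2) subfield_0[OF E] subfield_1[OF E]
        by (auto simp: Ks_def intro!: exI[of _ Ks])
    qed
    show "\<exists>c. (\<forall>i<d. c i \<in> E) \<and> x = (\<Sum>i<d. c i * Us ! i)" if x: "x \<in> V" for x
    proof -
      obtain Ks where "x = R.combine Ks Us" "length Ks = length Us" "set Ks \<subseteq> E"
        using x unfolding V by blast
      then show ?thesis using Us(2) combine by (intro exI[of _ "\<lambda>i. Ks ! i"]) (auto simp: subset_iff)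
    qed
    show "\<forall>i<d. c i = 0" if c: "\<forall>i<d. c i \<in> E" "(\<Sum>i<d. c i * Us ! i) = 0" for c
    proof -
      define Ks where "Ks = map c [0..<d]"
      have "set Ks \<subseteq> E" using c(1) by (auto simp: Ks_def)
      moreover have "R.combine Ks Us = 0" using c(2) Us(2) by (subst combine) (auto simp: Ks_def)
      ultimately have "set (take (length Us) Ks) \<subseteq> {0}"
        using R.independent_imp_trivial_combine[OF E Us(1)] by simp
      then show ?thesis using Us(2) by (auto simp: Ks_def image_subset_iff)
    qed
  qed
qed

text \<open>This bounds the dimension of \<open>V\<close> over \<open>E\<close> by \<open>d\<close>, in a form that is inherited by subsets.\<close>

definition dim_le :: "nat \<Rightarrow> complex set \<Rightarrow> complex set \<Rightarrow> bool" where
  "dim_le d E V \<longleftrightarrow> (\<forall>v. (\<forall>j\<le>d. v j \<in> V) \<longrightarrow>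
     (\<exists>c. (\<forall>j\<le>d. c j \<in> E) \<and> (\<exists>j\<le>d. c j \<noteq> 0) \<and> (\<Sum>j\<le>d. c j * v j) = 0))"

lemma dim_le_subset: "dim_le d E V \<Longrightarrow> W \<subseteq> V \<Longrightarrow> dim_le d E W" by (simp add: dim_le_def subset_iff)

text \<open>Expressing \<open>d + 1\<close> vectors by \<open>d\<close> spanning ones leaves
  \<open>d\<close> equations for \<open>d + 1\<close> coefficients.\<close>

lemma dim_le_of_span:
  assumes E: "subfield E CC"
    and u: "\<And>x. x \<in> V \<Longrightarrow> \<exists>c. (\<forall>i<d. c i \<in> E) \<and> x = (\<Sum>i<d. c i * u i)"
  shows "dim_le d E V" unfolding dim_le_def
proof (intro allI impI)
  fix v :: "nat \<Rightarrow> complex" assume "\<forall>j\<le>d. v j \<in> V"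
  then have "\<forall>j. \<exists>c. j \<le> d \<longrightarrow> (\<forall>i<d. c i \<in> E) \<and> v j = (\<Sum>i<d. c i * u i)" using u by auto
  from choice[OF this] obtain a where a: "\<And>j i. j \<le> d \<Longrightarrow> i < d \<Longrightarrow> a j i \<in> E"
    "\<And>j. j \<le> d \<Longrightarrow> v j = (\<Sum>i<d. a j i * u i)" by auto
  obtain c where c: "\<forall>j\<in>{..d}. c j \<in> E" "\<exists>j\<in>{..d}. c j \<noteq> 0" "\<forall>i\<in>{..<d}. (\<Sum>j\<in>{..d}. a j i * c j) = 0"
    using homogeneous_system_solution[OF E, of "{..<d}" "{..d}" "\<lambda>i j. a j i"] a(1) by auto
  have "(\<Sum>j\<le>d. c j * v j) = (\<Sum>j\<le>d. \<Sum>i<d. a j i * c j * u i)"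
    using a(2) by (simp add: sum_distrib_left mult_ac)
  also have "\<dots> = (\<Sum>i<d. (\<Sum>j\<le>d. a j i * c j) * u i)"
    by (subst sum.swap) (simp add: sum_distrib_right)
  also have "\<dots> = 0" using c(3) by simp
  finally show "\<exists>c. (\<forall>j\<le>d. c j \<in> E) \<and> (\<exists>j\<le>d. c j \<noteq> 0) \<and> (\<Sum>j\<le>d. c j * v j) = 0" using c by auto
qed

lemma dimension_imp_dim_le: "subfield E CC \<Longrightarrow> ring.dimension CC d E V \<Longrightarrow> dim_le d E V"
proof -
  assume E: "subfield E CC" and dim: "ring.dimension CC d E V"
  show ?thesis by (rule dimension_basis[OF E dim]) (rule dim_le_of_span[OF E])
qed

text \<open>Denominators are cleared with the product \<open>B\<close>, and the common divisor
  \<open>g\<close> is removed. Coprime coefficients cannot all vanish modulo a prime.\<close>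

lemma dim_le_Rats_primitive:
  assumes "dim_le d \<rat> V" "\<And>j. j \<le> d \<Longrightarrow> v j \<in> V"
  obtains z :: "nat \<Rightarrow> int" where "(\<Sum>j\<le>d. of_int (z j) * v j) = 0" "Gcd (z ` {..d}) = 1"
proof -
  obtain c where c: "\<forall>j\<le>d. c j \<in> \<rat>" "\<exists>j\<le>d. c j \<noteq> 0" "(\<Sum>j\<le>d. c j * v j) = 0"
    using assms(1)[unfolded dim_le_def, rule_format, of v] assms(2) by auto
  have "\<exists>ab. snd ab > (0::int) \<and> c j = of_int (fst ab) / of_int (snd ab)" if "j \<le> d" for j
  proof -
    have "c j \<in> \<rat>" using c(1) that by blast
    then show ?thesis by (rule Rats_cases') auto
  qed
  then have "\<forall>j. \<exists>ab. j \<le> d \<longrightarrow> snd ab > (0::int) \<and> c j = of_int (fst ab) / of_int (snd ab)" by auto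
  then obtain ab where ab': "\<And>j. j \<le> d \<Longrightarrow> snd (ab j) > (0::int) \<and> c j = of_int (fst (ab j)) / of_int (snd (ab j))"
    using choice[of "\<lambda>j ab. j \<le> d \<longrightarrow> snd ab > (0::int) \<and> c j = of_int (fst ab) / of_int (snd ab)"] by blast
  define a b where "a = (\<lambda>j. fst (ab j))" and "b = (\<lambda>j. snd (ab j))"
  have ab: "\<And>j. j \<le> d \<Longrightarrow> b j > (0::int)" "\<And>j. j \<le> d \<Longrightarrow> c j = of_int (a j) / of_int (b j)"
    using ab' by (auto simp: a_def b_def)
  define B where "B = (\<Prod>j\<le>d. b j)"
  have "B > 0" unfolding B_def using ab(1) by (intro prod_pos) auto
  define w where "w = (\<lambda>j. a j * (B div b j))"
  have w: "of_int (w j) = of_int B * c j" if "j \<le> d" for j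
  proof -
    have "b j dvd B" unfolding B_def using that by (intro dvd_prodI) auto
    then obtain t where t: "B = b j * t" by blast
    have "b j > 0" using ab(1)[OF that] .
    then have "w j = a j * t" unfolding w_def t by simp
    then show ?thesis unfolding ab(2)[OF that] t using \<open>b j > 0\<close> by simp
  qed
  define g where "g = Gcd (w ` {..d})"
  have "g \<noteq> 0"
  proof
    assume "g = 0"
    then have w0: "w j = 0" if "j \<le> d" for j using that unfolding g_def by (auto simp: Gcd_0_iff)
    have "c j = 0" if "j \<le> d" for j using w[OF that] w0[OF that] \<open>B > 0\<close> by simp
    with c(2) show False by blast
  qed
  define z where "z = (\<lambda>j. w j div g)"
  have gz: "g * z j = w j" if "j \<le> d" for j
  proof -
    have "g dvd w j" unfolding g_def using that by (intro Gcd_dvd) auto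
    then show ?thesis by (simp add: z_def)
  qed
  show ?thesis
  proof
    have "of_int g * (\<Sum>j\<le>d. of_int (z j) * v j) = (\<Sum>j\<le>d. of_int (w j) * v j)"
      unfolding sum_distrib_left by (intro sum.cong) (auto simp flip: gz)
    also have "\<dots> = of_int B * (\<Sum>j\<le>d. c j * v j)"
      unfolding sum_distrib_left by (intro sum.cong) (auto simp: w)
    finally show "(\<Sum>j\<le>d. of_int (z j) * v j) = 0" using c(3) \<open>g \<noteq> 0\<close> by simp
    have "w ` {..d} = (*) g ` (z ` {..d})"
      unfolding image_image by (intro image_cong) (auto simp: gz)
    from arg_cong[OF this, of Gcd] have "normalize (g * Gcd (z ` {..d})) = g"
      unfolding Gcd_mult g_def[symmetric] by (rule sym)
    moreover have "g \<ge> 0" "Gcd (z ` {..d}) \<ge> 0" unfolding g_def by (rule Gcd_int_greater_eq_0)+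
    ultimately have "g * Gcd (z ` {..d}) = g * 1" by (simp add: abs_mult)
    then show "Gcd (z ` {..d}) = 1" using \<open>g \<noteq> 0\<close> by (subst (asm) mult_left_cancel) auto
  qed
qed

section \<open>Rings of integers\<close>

text \<open>The relation reads h(y) = b with h monic over the integers. If g is a monic equation of
  b, then y is a root of the composite g(h), which is monic because \<open>n > 0\<close>.\<close>

lemma algebraic_int_monic_relation:
  fixes y b :: complex
  assumes n: "n > 0" and b: "algebraic_int b" and y: "y ^ n = (\<Sum>j<n. of_int (c j) * y ^ j) + b"
  shows "algebraic_int y"
proof -
  obtain g :: "int poly" where g: "poly (map_poly of_int g) b = 0" "lead_coeff g = 1"
    using b unfolding algebraic_int_altdef_ipoly by blast
  define h where "h = monom 1 n - (\<Sum>j<n. monom (c j) j)"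
  have coeff: "coeff h i = (if i = n then 1 else if i < n then - c i else 0)" for i
    by (auto simp: h_def coeff_sum)
  then have "degree h = n" by (intro antisym degree_le le_degree) auto
  then have h: "degree h = n" "lead_coeff h = 1" by (simp_all add: coeff)
  have "poly (map_poly of_int h) y = y ^ n - (\<Sum>j<n. of_int (c j) * y ^ j)"
    by (simp add: poly_altdef degree_map_poly coeff_map_poly h(1) coeff lessThan_Suc_atMost[symmetric] sum_negf)
  then have "poly (map_poly of_int (pcompose g h)) y = 0"
    using g(1) y by (simp add: of_int_hom.map_poly_pcompose poly_pcompose)
  moreover have "lead_coeff (pcompose g h) = 1"
    using lead_coeff_comp[of h g] g(2) h n by (simp only: power_one mult_1_right)
  ultimately show ?thesis unfolding algebraic_int_altdef_ipoly by blast
qed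

lemma prime_inverse_mod:
  assumes "Factorial_Ring.prime r" "\<not> int r dvd c"
  obtains v w :: int where "of_int w * of_int c = 1 - (of_int v * of_nat r :: complex)"
proof -
  have "Rings.coprime (int r) c" using assms by (intro prime_imp_coprime) auto
  then obtain v w where "v * int r + w * c = 1" using bezout_int[of "int r" c] by auto
  then have "of_int (v * int r + w * c) = (1 :: complex)" by simp
  then show ?thesis using that[of w v] by (simp add: algebra_simps)
qed

text \<open>The condition on \<open>r\<close> admits primes and also \<open>r = 0\<close>. For a
  prime, \<open>n\<close> is the last index with a coefficient that is nonzero modulo
  \<open>r\<close>; for \<open>r = 0\<close> it is the last nonzero coefficient.\<close>

lemma primitive_last_index:
  fixes z :: "nat \<Rightarrow> int"
  assumes z: "Gcd (z ` {..d}) = 1" and r: "\<not> r dvd 1"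
  obtains n where "n \<le> d" "\<not> r dvd z n" "\<And>j. j \<le> d \<Longrightarrow> \<not> r dvd z j \<Longrightarrow> j \<le> n"
proof -
  define R where "R j \<longleftrightarrow> j \<le> d \<and> \<not> r dvd z j" for j
  have "\<exists>j. R j"
  proof (rule ccontr)
    assume "\<not> ?thesis"
    then have "r dvd Gcd (z ` {..d})" by (intro Gcd_greatest) (auto simp: R_def)
    then show False using z r by simp
  qed
  then obtain j where "R j" by blast
  then have "R (Greatest R)" "\<And>j. R j \<Longrightarrow> j \<le> Greatest R"
    using GreatestI_nat[of R j d] Greatest_le_nat[of R _ d] by (auto simp: R_def)
  then show ?thesis using that[of "Greatest R"] unfolding R_def by blast
qed

text \<open>Only an upper bound on the degree is recorded, so that the subfield \<open>K\<close> of
  \<open>L\<close> is a number field with the same \<open>d\<close>.\<close>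

locale number_field =
  fixes N :: "complex set" and d :: nat
  assumes subfield: "subfield N CC" and dim: "dim_le d \<rat> N"
begin

lemma int_ring_subset: "\<O> N \<subseteq> N"
  and int_ring_algebraic_int: "x \<in> \<O> N \<Longrightarrow> algebraic_int x" by (auto simp: int_ring_def)

lemma int_ring_0: "0 \<in> \<O> N" and int_ring_1: "1 \<in> \<O> N"
  and int_ring_add: "x \<in> \<O> N \<Longrightarrow> y \<in> \<O> N \<Longrightarrow> x + y \<in> \<O> N"
  and int_ring_minus: "x \<in> \<O> N \<Longrightarrow> - x \<in> \<O> N"
  and int_ring_diff: "x \<in> \<O> N \<Longrightarrow> y \<in> \<O> N \<Longrightarrow> x - y \<in> \<O> N"
  and int_ring_mult: "x \<in> \<O> N \<Longrightarrow> y \<in> \<O> N \<Longrightarrow> x * y \<in> \<O> N"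
  and int_ring_of_int: "of_int m \<in> \<O> N"
  and int_ring_of_nat: "of_nat k \<in> \<O> N" using algebraic_int_add[of x "- y"]
  by (auto simp: int_ring_def algebraic_int_add algebraic_int_mult int_imp_algebraic_int
      subfield_closed[OF subfield] subfield_of_int[OF subfield] subfield_of_nat[OF subfield])

lemma int_ring_sum: "(\<And>i. i \<in> I \<Longrightarrow> f i \<in> \<O> N) \<Longrightarrow> sum f I \<in> \<O> N"
  by (induction I rule: infinite_finite_induct) (auto intro: int_ring_add int_ring_0)

lemma int_ring_prod: "(\<And>i. i \<in> I \<Longrightarrow> f i \<in> \<O> N) \<Longrightarrow> prod f I \<in> \<O> N"
  by (induction I rule: infinite_finite_induct) (auto intro: int_ring_mult int_ring_1)

lemma int_ring_power: "x \<in> \<O> N \<Longrightarrow> x ^ n \<in> \<O> N"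
  by (induction n) (auto intro: int_ring_mult int_ring_1)

lemmas int_ring_closed = int_ring_0 int_ring_1 int_ring_add int_ring_minus int_ring_diff int_ring_mult
  int_ring_of_int int_ring_of_nat int_ring_sum int_ring_prod int_ring_power

text \<open>The powers of \<open>x\<close> up to \<open>d\<close> satisfy an integral relation.
  Multiplying it by the power n - 1 of its leading coefficient z(n) gives a monic equation for z(n)
  x.\<close>

lemma common_denominator:
  assumes "x \<in> N"
  obtains m :: int where "m \<noteq> 0" "of_int m * x \<in> \<O> N"
proof -
  obtain z where z: "(\<Sum>j\<le>d. of_int (z j) * x ^ j) = 0" "Gcd (z ` {..d}) = 1"
    using dim_le_Rats_primitive[OF dim, of "\<lambda>j. x ^ j"] subfield_power[OF subfield assms] by metis
  have "\<not> (0 :: int) dvd 1" by simp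
  then obtain n where n: "n \<le> d" "\<not> 0 dvd z n" and n_max: "\<And>j. j \<le> d \<Longrightarrow> \<not> 0 dvd z j \<Longrightarrow> j \<le> n"
    by (rule primitive_last_index[OF z(2)]) (rule that)
  have "(\<Sum>j\<le>n. of_int (z j) * x ^ j) = (\<Sum>j\<le>d. of_int (z j) * x ^ j)"
    using n n_max by (intro sum.mono_neutral_left) fastforce+
  then have rel: "of_int (z n) * x ^ n = - (\<Sum>j<n. of_int (z j) * x ^ j)"
    using z(1) by (simp add: lessThan_Suc_atMost[symmetric] eq_neg_iff_add_eq_0 add.commute)
  then have n0: "n > 0" using n(2) by (cases n) auto
  define y where "y = of_int (z n) * x"
  have "y ^ n = of_int (z n) ^ (n - 1) * (of_int (z n) * x ^ n)"
    using n0 unfolding y_def power_mult_distrib by (cases n) auto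
  also have "\<dots> = (\<Sum>j<n. of_int (- z j * z n ^ (n - 1 - j)) * y ^ j)"
    unfolding rel mult_minus_right sum_distrib_left sum_negf[symmetric]
  proof (rule sum.cong[OF refl])
    fix j assume "j \<in> {..<n}"
    then have "n - 1 = (n - 1 - j) + j" by auto
    then have "(of_int (z n) :: complex) ^ (n - 1) = of_int (z n) ^ (n - 1 - j) * of_int (z n) ^ j"
      by (metis power_add)
    then show "- (of_int (z n) ^ (n - 1) * (of_int (z j) * x ^ j)) = of_int (- z j * z n ^ (n - 1 - j)) * y ^ j"
      by (simp add: y_def power_mult_distrib)
  qed
  finally have "algebraic_int y"
    using algebraic_int_monic_relation[OF n0 algebraic_int_0, of y "\<lambda>j. - z j * z n ^ (n - 1 - j)"] by simp
  then have "of_int (z n) * x \<in> \<O> N"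
    using assms unfolding int_ring_def y_def by (auto intro: subfield_mult[OF subfield] subfield_of_int[OF subfield])
  then show ?thesis using n(2) by (intro that[of "z n"]) auto
qed

text \<open>Splits an integral equation of \<open>a\<close> at its lowest coefficient not divisible by \<open>r\<close>;
  the cases of interest are \<open>r\<close> prime and \<open>r = 0\<close>.\<close>

lemma integral_equation_split:
  assumes a: "a \<in> \<O> N" and r: "\<not> r dvd (1 :: int)"
  obtains k c t u n z where "\<not> r dvd c" "t \<in> \<O> N" "u \<in> \<O> N" "a ^ k * (of_int c + a * t) = of_int r * u"
    "t = (\<Sum>j<n. of_int (z j) * a ^ j)"
proof -
  obtain p :: "int poly" where p: "poly (map_poly of_int p) a = 0" "lead_coeff p = 1"
    using int_ring_algebraic_int[OF a] unfolding algebraic_int_altdef_ipoly by blast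
  define n where "n = degree p"
  define k where "k = (LEAST k. \<not> r dvd coeff p k)"
  have "\<not> r dvd coeff p n" using p r by (simp add: n_def)
  then have k: "\<not> r dvd coeff p k" "k \<le> n" unfolding k_def by (rule LeastI, rule Least_le)
  have k_least: "r dvd coeff p i" if "i < k" for i
    using not_less_Least[of i "\<lambda>k. \<not> r dvd coeff p k"] that unfolding k_def by blast
  define t where "t = (\<Sum>j<n - k. of_int (coeff p (k + Suc j)) * a ^ j)"
  \<comment> \<open>Below \<open>k\<close> every coefficient is divisible by \<open>r\<close>, and
    these terms move to the other side. The part above \<open>k\<close> is kept in \<open>t\<close>,
    as an explicit polynomial in \<open>a\<close>.\<close>
  define u where "u = - (\<Sum>i<k. of_int (coeff p i div r) * a ^ i)"
  have "0 = (\<Sum>i<Suc n. of_int (coeff p i) * a ^ i)"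
    using p by (simp add: poly_altdef n_def degree_map_poly coeff_map_poly lessThan_Suc_atMost del: sum.lessThan_Suc)
  also have "\<dots> = (\<Sum>i<k. of_int (coeff p i) * a ^ i) + (\<Sum>i\<in>{k..<Suc n}. of_int (coeff p i) * a ^ i)"
    using k(2) by (simp only: atLeast0LessThan[symmetric]) (intro sum.atLeastLessThan_concat[symmetric], auto)
  also have "(\<Sum>i\<in>{k..<Suc n}. of_int (coeff p i) * a ^ i) = (\<Sum>j<Suc (n - k). of_int (coeff p (k + j)) * a ^ (k + j))"
    using k(2) sum.shift_bounds_nat_ivl[of "\<lambda>i. of_int (coeff p i) * a ^ i" 0 k "Suc (n - k)"]
    by (simp add: atLeast0LessThan add.commute Suc_diff_le)
  also have "\<dots> = a ^ k * (of_int (coeff p k) + a * t)" unfolding sum.lessThan_Suc_shift t_def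
    by (simp add: power_add sum_distrib_left algebra_simps)
  also have "(\<Sum>i<k. of_int (coeff p i) * a ^ i) = - (of_int r * u)"
    unfolding u_def mult_minus_right minus_minus sum_distrib_left
  proof (rule sum.cong[OF refl])
    fix i assume "i \<in> {..<k}"
    then have "coeff p i = r * (coeff p i div r)" using k_least by simp
    then have "(of_int (coeff p i) :: complex) = of_int r * of_int (coeff p i div r)" by (metis of_int_mult)
    then show "of_int (coeff p i) * a ^ i = of_int r * (of_int (coeff p i div r) * a ^ i)" by simp
  qed
  finally have "a ^ k * (of_int (coeff p k) + a * t) = of_int r * u" by simp
  moreover have "t \<in> \<O> N" "u \<in> \<O> N" unfolding t_def u_def using a by (intro int_ring_closed; simp)+
  ultimately show ?thesis using that[OF k(1) _ _ _ t_def] by blast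
qed

text \<open>In the splitting with \<open>r = 0\<close> the right-hand side vanishes and the power of
  \<open>a\<close> cancels. The cofactor is recorded as a polynomial in \<open>a\<close> because
  this later shows that inverses stay inside F[\<zeta>].\<close>

lemma divides_nonzero_int:
  assumes a: "a \<in> \<O> N" "a \<noteq> 0"
  obtains m :: int and a' n z where "m \<noteq> 0" "a' \<in> \<O> N" "a * a' = of_int m" "a' = (\<Sum>j<n. of_int (z j) * a ^ j)"
proof -
  have "\<not> (0 :: int) dvd 1" by simp
  then obtain k c t u n z where *: "\<not> 0 dvd (c :: int)" "t \<in> \<O> N" "u \<in> \<O> N"
    "a ^ k * (of_int c + a * t) = of_int 0 * u" "t = (\<Sum>j<n. of_int (z j) * a ^ j)"
    by (rule integral_equation_split[OF a(1)])
  then have "a * (- t) = of_int c" using a(2) by (auto simp: add_eq_0_iff)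
  with * show ?thesis
    by (intro that[of c "- t" "\<lambda>j. - z j" n]) (auto intro: int_ring_minus simp: sum_negf)
qed

section \<open>Ideals and fractional ideals\<close>

abbreviation integral_ideal :: "complex set \<Rightarrow> bool" where
  "integral_ideal I \<equiv> ideal I (on_carrier (\<O> N))"

lemma ring_int_ring: "ring (on_carrier (\<O> N))"
proof -
  interpret R: ring CC by (rule ring_CC)
  have "subring (\<O> N) CC" by (rule R.subringI) (auto intro: int_ring_closed)
  then show ?thesis by (rule R.subring_is_ring)
qed

lemma cring_int_ring: "cring (on_carrier (\<O> N))"
proof -
  interpret ring "on_carrier (\<O> N)" by (rule ring_int_ring)
  show ?thesis by unfold_locales auto
qed

lemma ideal_iff:
  "integral_ideal I \<longleftrightarrow>
     I \<subseteq> \<O> N \<and> 0 \<in> I \<and> (\<forall>x\<in>I. \<forall>y\<in>I. x + y \<in> I) \<and> (\<forall>a\<in>\<O> N. \<forall>x\<in>I. a * x \<in> I)"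
  (is "_ \<longleftrightarrow> ?R")
proof
  assume "integral_ideal I"
  then interpret ideal I "on_carrier (\<O> N)" .
  note I = additive_subgroup.a_subset additive_subgroup.zero_closed additive_subgroup.a_closed
  show ?R using I[OF is_additive_subgroup] I_l_closed by auto
next
  assume R: ?R
  interpret R: ring "on_carrier (\<O> N)" by (rule ring_int_ring)
  have inv: "\<ominus>\<^bsub>on_carrier (\<O> N)\<^esub> x = - x" if "x \<in> \<O> N" for x
    using R.minus_equality[of "- x" x] that by (simp add: int_ring_minus)
  show "integral_ideal I"
  proof (rule idealI[OF ring_int_ring])
    show "subgroup I (add_monoid (on_carrier (\<O> N)))"
    proof
      fix x assume x: "x \<in> I"
      then have "(- 1) * x \<in> I" using R int_ring_of_int[of "-1"] by auto
      then show "inv\<^bsub>add_monoid (on_carrier (\<O> N))\<^esub> x \<in> I"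
        using x R inv[of x] unfolding a_inv_def by auto
    qed (use R in auto)
  next
    fix a x assume "a \<in> I" "x \<in> carrier (on_carrier (\<O> N))"
    then show "x \<otimes>\<^bsub>on_carrier (\<O> N)\<^esub> a \<in> I" "a \<otimes>\<^bsub>on_carrier (\<O> N)\<^esub> x \<in> I"
      using R by (auto simp: mult.commute[of a x])
  qed
qed

lemma prime_ideal_iff:
  "prime_ideal N P \<longleftrightarrow> integral_ideal P \<and> P \<noteq> {0} \<and> 1 \<notin> P \<and>
     (\<forall>a\<in>\<O> N. \<forall>b\<in>\<O> N. a * b \<in> P \<longrightarrow> a \<in> P \<or> b \<in> P)"
proof -
  have "\<O> N \<noteq> P \<longleftrightarrow> 1 \<notin> P" if "integral_ideal P"
  proof -
    have "P = \<O> N" if "1 \<in> P"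
    proof -
      note P = \<open>integral_ideal P\<close>[unfolded ideal_iff]
      have "x \<in> P" if "x \<in> \<O> N" for x
        using P[THEN conjunct2, THEN conjunct2, THEN conjunct2, rule_format, OF that \<open>1 \<in> P\<close>] by simp
      then show ?thesis using P by blast
    qed
    then show ?thesis using int_ring_1 by blast
  qed
  then show ?thesis
    unfolding prime_ideal_def primeideal_def primeideal_axioms_def using cring_int_ring by simp blast
qed

lemma
  assumes "prime_ideal N P"
  shows prime_ideal_subset: "P \<subseteq> \<O> N" and prime_ideal_0: "0 \<in> P"
    and prime_ideal_add: "x \<in> P \<Longrightarrow> y \<in> P \<Longrightarrow> x + y \<in> P"
    and prime_ideal_mult: "a \<in> \<O> N \<Longrightarrow> x \<in> P \<Longrightarrow> a * x \<in> P"
    and prime_ideal_1: "1 \<notin> P"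
    and prime_ideal_prime: "a \<in> \<O> N \<Longrightarrow> b \<in> \<O> N \<Longrightarrow> a * b \<in> P \<Longrightarrow> a \<in> P \<or> b \<in> P"
  using assms unfolding prime_ideal_iff ideal_iff by auto

lemma prime_ideal_mult2: "prime_ideal N P \<Longrightarrow> x \<in> P \<Longrightarrow> a \<in> \<O> N \<Longrightarrow> x * a \<in> P"
  using prime_ideal_mult[of P a x] by (simp add: mult.commute)

lemma prime_ideal_minus: "prime_ideal N P \<Longrightarrow> x \<in> P \<Longrightarrow> - x \<in> P"
  using prime_ideal_mult[of P "-1" x] int_ring_of_int[of "-1"] by simp

lemma prime_ideal_diff: "prime_ideal N P \<Longrightarrow> x \<in> P \<Longrightarrow> y \<in> P \<Longrightarrow> x - y \<in> P"
  using prime_ideal_add[of P x "- y"] prime_ideal_minus[of P y] by simp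

lemma prime_ideal_sum: "prime_ideal N P \<Longrightarrow> (\<And>i. i \<in> I \<Longrightarrow> f i \<in> P) \<Longrightarrow> sum f I \<in> P"
  by (induction I rule: infinite_finite_induct) (auto intro: prime_ideal_add prime_ideal_0)

lemma prime_ideal_prod:
  assumes P: "prime_ideal N P"
  shows "(\<And>i. i \<in> I \<Longrightarrow> f i \<in> \<O> N - P) \<Longrightarrow> prod f I \<in> \<O> N - P"
proof (induction I rule: infinite_finite_induct)
  case (insert i I)
  then show ?case using prime_ideal_prime[OF P, of "f i" "prod f I"] by (auto intro: int_ring_mult)
qed (use prime_ideal_1[OF P] int_ring_1 in auto)

lemma prime_ideal_power: "prime_ideal N P \<Longrightarrow> a \<in> \<O> N - P \<Longrightarrow> a ^ k \<in> \<O> N - P"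
  using prime_ideal_prod[of P "{..<k}" "\<lambda>_. a"] by simp

text \<open>A nonzero element of \<open>P\<close> divides a nonzero integer, so \<open>P\<close>
  contains positive integers; since \<open>P\<close> is prime, the least of them is a prime
  number.\<close>

lemma prime_ideal_contains_prime:
  assumes P: "prime_ideal N P"
  obtains r :: nat where "Factorial_Ring.prime r" "of_nat r \<in> P"
proof -
  obtain a where a: "a \<in> P" "a \<noteq> 0" using P prime_ideal_0[OF P] unfolding prime_ideal_iff by blast
  then obtain m a' where m: "m \<noteq> (0::int)" "a' \<in> \<O> N" "a * a' = of_int m"
    using divides_nonzero_int[of a] prime_ideal_subset[OF P] by blast
  have mP: "of_int m \<in> P" using prime_ideal_mult2[OF P a(1) m(2)] m(3) by simp
  then have "(of_nat (nat \<bar>m\<bar>) :: complex) \<in> P"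
    using prime_ideal_minus[OF P mP] by (cases "m \<ge> 0") (auto simp: of_nat_nat)
  then have ex: "\<exists>r. r > 0 \<and> (of_nat r :: complex) \<in> P"
    using m(1) by (intro exI[of _ "nat \<bar>m\<bar>"]) auto
  define r where "r = (LEAST r. r > 0 \<and> (of_nat r :: complex) \<in> P)"
  have r: "r > 0" "of_nat r \<in> P" using LeastI_ex[OF ex] unfolding r_def by auto
  have r_least: "r \<le> s" if "s > 0" "of_nat s \<in> P" for s
    using that unfolding r_def by (intro Least_le) auto
  have "Factorial_Ring.prime r" unfolding prime_nat_iff
  proof (intro conjI allI impI)
    show "r > 1" using r prime_ideal_1[OF P] by (cases "r = 1") auto
    fix a assume "a dvd r"
    then obtain b where ab: "r = a * b" by blast
    then have "a > 0" "b > 0" using r(1) by auto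
    have "(of_nat a :: complex) * of_nat b \<in> P" using r(2) ab by simp
    then have "(of_nat a :: complex) \<in> P \<or> (of_nat b :: complex) \<in> P"
      using prime_ideal_prime[OF P int_ring_of_nat int_ring_of_nat] by blast
    then have "r \<le> a \<or> r \<le> b" using r_least \<open>a > 0\<close> \<open>b > 0\<close> by blast
    then show "a = 1 \<or> a = r" using ab \<open>a > 0\<close> \<open>b > 0\<close> by auto
  qed
  with r show ?thesis using that by blast
qed

lemma prime_ideal_of_int_iff:
  assumes P: "prime_ideal N P" and r: "Factorial_Ring.prime r" "of_nat r \<in> P"
  shows "of_int c \<in> P \<longleftrightarrow> int r dvd c"
proof
  assume c: "of_int c \<in> P"
  show "int r dvd c"
  proof (rule ccontr)
    assume "\<not> int r dvd c"
    then obtain x y where "of_int y * of_int c = 1 - (of_int x * of_nat r :: complex)"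
      by (rule prime_inverse_mod[OF r(1)])
    then have "(of_int x :: complex) * of_nat r + of_int y * of_int c = 1" by simp
    moreover have "(of_int x :: complex) * of_nat r + of_int y * of_int c \<in> P"
      by (intro prime_ideal_add[OF P] prime_ideal_mult[OF P] int_ring_of_int r c)
    ultimately show False using prime_ideal_1[OF P] by simp
  qed
next
  assume "int r dvd c"
  then obtain k where "c = int r * k" by blast
  then show "of_int c \<in> P" using prime_ideal_mult2[OF P r(2) int_ring_of_int[of k]] by simp
qed

text \<open>An integral equation of \<open>a\<close> is split at \<open>r\<close>. Its right-hand
  side lies in \<open>P\<close> and \<open>a ^ k\<close> does not, so
  \<open>of_int c + a * t\<close> lies in \<open>P\<close>. As \<open>c\<close> is invertible modulo
  \<open>r\<close>, \<open>a\<close> is invertible modulo \<open>P\<close>.\<close>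

lemma prime_ideal_maximal:
  assumes P: "prime_ideal N P" and a: "a \<in> \<O> N" "a \<notin> P"
  obtains b y where "b \<in> \<O> N" "y \<in> P" "a * b + y = 1"
proof -
  obtain r where r: "Factorial_Ring.prime r" "of_nat r \<in> P" using prime_ideal_contains_prime[OF P] .
  have "\<not> int r dvd 1" using r(1) by auto
  then obtain k c t u n z where *: "\<not> int r dvd c" "t \<in> \<O> N" "u \<in> \<O> N"
    "a ^ k * (of_int c + a * t) = of_int (int r) * u" "t = (\<Sum>j<n. of_int (z j) * a ^ j)"
    by (rule integral_equation_split[OF a(1)])
  have "of_int (int r) * u \<in> P" using prime_ideal_mult2[OF P r(2) *(3)] by simp
  then have "a ^ k * (of_int c + a * t) \<in> P" using *(4) by simp
  moreover have "a ^ k \<notin> P" using prime_ideal_power[OF P, of a k] a by simp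
  ultimately have ct: "of_int c + a * t \<in> P"
    using prime_ideal_prime[OF P, of "a ^ k" "of_int c + a * t"] a(1) *(2) by (auto intro: int_ring_closed)
  obtain x y where "of_int y * of_int c = 1 - (of_int x * of_nat r :: complex)"
    by (rule prime_inverse_mod[OF r(1) *(1)])
  then have "a * (- (of_int y * t)) + (of_int y * (of_int c + a * t) + of_int x * of_nat r) = 1"
    by (simp add: algebra_simps)
  moreover have "of_int y * (of_int c + a * t) + of_int x * of_nat r \<in> P"
    by (intro prime_ideal_add[OF P] prime_ideal_mult[OF P] int_ring_of_int r ct)
  moreover have "- (of_int y * t) \<in> \<O> N" using *(2) by (intro int_ring_closed)
  ultimately show ?thesis using that by blast
qed

lemma prime_ideal_subset_eq:
  assumes "prime_ideal N P" "prime_ideal N Q" "P \<subseteq> Q"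
  shows "P = Q"
proof (rule ccontr)
  assume "P \<noteq> Q"
  then obtain a where a: "a \<in> Q" "a \<notin> P" using assms(3) by blast
  then obtain b y where "b \<in> \<O> N" "y \<in> P" "a * b + y = 1"
    using prime_ideal_maximal[OF assms(1), of a] prime_ideal_subset[OF assms(2)] by blast
  then have "1 \<in> Q"
    using prime_ideal_add[OF assms(2), of "a * b" y] prime_ideal_mult2[OF assms(2) a(1)] assms(3) by auto
  then show False using prime_ideal_1[OF assms(2)] by simp
qed

end

section \<open>Sums of products of two sets of complex numbers\<close>

lemma ideal_prod_CC_mem: "i \<in> I \<Longrightarrow> j \<in> J \<Longrightarrow> i * j \<in> ideal_prod CC I J"
  using ideal_prod.prod[of i I j J CC] by simp

lemma ideal_prod_CC_add: "x \<in> ideal_prod CC I J \<Longrightarrow> y \<in> ideal_prod CC I J \<Longrightarrow> x + y \<in> ideal_prod CC I J"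
  using ideal_prod.sum[of x CC I J y] by simp

lemma ideal_prod_CC_induct [consumes 1, case_names mult add]:
  assumes "x \<in> ideal_prod CC I J" "\<And>i j. i \<in> I \<Longrightarrow> j \<in> J \<Longrightarrow> R (i * j)"
    "\<And>x y. R x \<Longrightarrow> R y \<Longrightarrow> R (x + y)"
  shows "R x" using assms(1) by (induction rule: ideal_prod.induct) (auto intro: assms)

lemma ideal_prod_CC_subset:
  assumes "\<And>i j. i \<in> I \<Longrightarrow> j \<in> J \<Longrightarrow> i * j \<in> A" "\<And>x y. x \<in> A \<Longrightarrow> y \<in> A \<Longrightarrow> x + y \<in> A"
  shows "ideal_prod CC I J \<subseteq> A"
proof
  fix x assume "x \<in> ideal_prod CC I J"
  then show "x \<in> A" by (induction rule: ideal_prod_CC_induct) (auto intro: assms)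
qed

lemma ideal_prod_CC_commute: "ideal_prod CC I J = ideal_prod CC J I"
proof -
  have "ideal_prod CC I J \<subseteq> ideal_prod CC J I" for I J
  proof (rule ideal_prod_CC_subset)
    fix i j assume "i \<in> I" "j \<in> J"
    then show "i * j \<in> ideal_prod CC J I" using ideal_prod_CC_mem[of j J i I] by (simp add: mult.commute)
  qed (rule ideal_prod_CC_add)
  then show ?thesis by blast
qed

lemma ideal_prod_CC_assoc: "ideal_prod CC (ideal_prod CC I J) K = ideal_prod CC I (ideal_prod CC J K)"
proof -
  have *: "ideal_prod CC (ideal_prod CC I J) K \<subseteq> ideal_prod CC I (ideal_prod CC J K)" for I J K
  proof (rule ideal_prod_CC_subset)
    fix s k assume "s \<in> ideal_prod CC I J" and k: "k \<in> K"
    then show "s * k \<in> ideal_prod CC I (ideal_prod CC J K)"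
    proof (induction rule: ideal_prod_CC_induct)
      case (mult i j)
      then show ?case unfolding mult.assoc using k by (intro ideal_prod_CC_mem)
    next
      case (add x y)
      then show ?case unfolding distrib_right using k by (intro ideal_prod_CC_add) auto
    qed
  qed (rule ideal_prod_CC_add)
  show ?thesis
  proof
    show "ideal_prod CC I (ideal_prod CC J K) \<subseteq> ideal_prod CC (ideal_prod CC I J) K"
      using *[of K J I] by (metis ideal_prod_CC_commute)
  qed (rule *)
qed

lemma frac_ideals_simps [simp]:
  "I \<otimes>\<^bsub>frac_ideals N\<^esub> J = ideal_prod CC I J" "\<one>\<^bsub>frac_ideals N\<^esub> = \<O> N"
  by (simp_all add: frac_ideals_def)

context number_field
begin

text \<open>Replaces the integral ideal and the denominator by intrinsic closure properties, which
  pass to products.\<close>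

lemma frac_ideal_iff:
  "J \<in> carrier (frac_ideals N) \<longleftrightarrow> J \<subseteq> N \<and> 0 \<in> J \<and> J \<noteq> {0} \<and> (\<forall>x\<in>J. \<forall>y\<in>J. x + y \<in> J) \<and>
     (\<forall>a\<in>\<O> N. \<forall>x\<in>J. a * x \<in> J) \<and> (\<exists>c\<in>\<O> N. c \<noteq> 0 \<and> (\<forall>x\<in>J. c * x \<in> \<O> N))"
  (is "_ \<longleftrightarrow> ?R")
proof
  assume "J \<in> carrier (frac_ideals N)"
  then obtain I c where I: "J = (\<lambda>a. a / c) ` I" "integral_ideal I" "I \<noteq> {0}" "c \<in> \<O> N" "c \<noteq> 0"
    by (auto simp: frac_ideals_def)
  note I' = I(2)[unfolded ideal_iff]
  show ?R
  proof (intro conjI)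
    show "J \<subseteq> N" using I I' int_ring_subset by (auto intro!: subfield_divide[OF subfield])
    show "0 \<in> J" using I' unfolding I(1) by force
    show "J \<noteq> {0}"
    proof -
      obtain a where "a \<in> I" "a \<noteq> 0" using I' I(3) by blast
      then have "a / c \<in> J" "a / c \<noteq> 0" using I by auto
      then show ?thesis by blast
    qed
    show "\<forall>x\<in>J. \<forall>y\<in>J. x + y \<in> J"
      using I' unfolding I(1) by (auto simp: add_divide_distrib[symmetric])
    show "\<forall>a\<in>\<O> N. \<forall>x\<in>J. a * x \<in> J" using I' unfolding I(1) by auto
    show "\<exists>c\<in>\<O> N. c \<noteq> 0 \<and> (\<forall>x\<in>J. c * x \<in> \<O> N)" using I I' by (intro bexI[of _ c]) auto
  qed
next
  assume R: ?R
  then obtain c where c: "c \<in> \<O> N" "c \<noteq> 0" "\<And>x. x \<in> J \<Longrightarrow> c * x \<in> \<O> N" by blast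
  have "integral_ideal ((\<lambda>x. c * x) ` J)" unfolding ideal_iff
  proof (intro conjI ballI)
    show "0 \<in> (*) c ` J" using R by (intro image_eqI[of _ _ 0]) auto
    fix x assume x: "x \<in> (*) c ` J"
    {
      fix y assume "y \<in> (*) c ` J"
      with x R show "x + y \<in> (*) c ` J" by (auto simp: distrib_left[symmetric])
    }
    fix a assume "a \<in> \<O> N"
    with x R show "a * x \<in> (*) c ` J" by (auto simp: mult.left_commute)
  qed (use c in auto)
  moreover have "(\<lambda>x. c * x) ` J \<noteq> {0}"
  proof -
    obtain x where "x \<in> J" "x \<noteq> 0" using R by blast
    then have "c * x \<in> (\<lambda>x. c * x) ` J" "c * x \<noteq> 0" using c(2) by auto
    then show ?thesis by blast
  qed
  moreover have "J = (\<lambda>a. a / c) ` (\<lambda>x. c * x) ` J" using c(2) by (simp add: image_image)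
  ultimately show "J \<in> carrier (frac_ideals N)"
    unfolding frac_ideals_def partial_object.simps mem_Collect_eq using c(1,2) by blast
qed

lemma frac_ideal_subset: "J \<in> carrier (frac_ideals N) \<Longrightarrow> J \<subseteq> N" by (simp add: frac_ideal_iff)

lemma frac_ideal_nonzero: "J \<in> carrier (frac_ideals N) \<Longrightarrow> \<exists>x\<in>J. x \<noteq> 0"
  unfolding frac_ideal_iff by blast

lemma ideal_frac_ideal: "integral_ideal I \<Longrightarrow> I \<noteq> {0} \<Longrightarrow> I \<in> carrier (frac_ideals N)"
  unfolding ideal_iff frac_ideal_iff using int_ring_subset int_ring_1 by (intro conjI bexI[of _ 1]) auto

lemma principal_frac_ideal:
  assumes "x \<in> N" "x \<noteq> 0"
  shows "principal N x \<in> carrier (frac_ideals N)"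
proof -
  obtain m :: int where m: "m \<noteq> 0" "of_int m * x \<in> \<O> N" using common_denominator[OF assms(1)] .
  show ?thesis unfolding frac_ideal_iff
  proof (intro conjI ballI bexI[of _ "of_int m"])
    show "principal N x \<subseteq> N" using assms(1) int_ring_subset by (auto intro: subfield_mult[OF subfield])
    show "0 \<in> principal N x" using int_ring_0 by force
    have "1 * x \<in> principal N x" using int_ring_1 by (rule imageI)
    then show "principal N x \<noteq> {0}" using assms(2) by auto
    show "y + z \<in> principal N x" if "y \<in> principal N x" "z \<in> principal N x" for y z
    proof -
      obtain a b where "a \<in> \<O> N" "b \<in> \<O> N" "y = a * x" "z = b * x" using \<open>y \<in> _\<close> \<open>z \<in> _\<close> by blast
      then show ?thesis using int_ring_add[of a b] by (auto simp: distrib_right[symmetric])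
    qed
    show "a * y \<in> principal N x" if "a \<in> \<O> N" "y \<in> principal N x" for a y
    proof -
      obtain b where "b \<in> \<O> N" "y = b * x" using \<open>y \<in> _\<close> by blast
      then show ?thesis using int_ring_mult[OF \<open>a \<in> _\<close>, of b] by (auto simp: mult.assoc[symmetric])
    qed
    show "of_int m \<noteq> (0 :: complex)" using m(1) by simp
    show "of_int m * y \<in> \<O> N" if "y \<in> principal N x" for y
    proof -
      obtain a where "a \<in> \<O> N" "y = a * x" using \<open>y \<in> _\<close> by blast
      then show ?thesis using int_ring_mult[OF _ m(2), of a] by (simp add: mult_ac)
    qed
  qed (rule int_ring_of_int)
qed

lemma frac_ideals_comm_monoid: "comm_monoid (frac_ideals N)"
proof (rule comm_monoidI)
  show "\<one>\<^bsub>frac_ideals N\<^esub> \<in> carrier (frac_ideals N)"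
    using principal_frac_ideal[of 1] subfield_1[OF subfield] by simp
  fix I J assume I: "I \<in> carrier (frac_ideals N)" and J: "J \<in> carrier (frac_ideals N)"
  have "ideal_prod CC I J \<in> carrier (frac_ideals N)" unfolding frac_ideal_iff
  proof (intro conjI ballI)
    show "ideal_prod CC I J \<subseteq> N" using frac_ideal_subset[OF I] frac_ideal_subset[OF J]
      by (intro ideal_prod_CC_subset) (auto intro!: subfield_mult[OF subfield] subfield_add[OF subfield])
    obtain x where x: "x \<in> I" "x \<noteq> 0" using frac_ideal_nonzero[OF I] by blast
    obtain y where y: "y \<in> J" "y \<noteq> 0" using frac_ideal_nonzero[OF J] by blast
    show "ideal_prod CC I J \<noteq> {0}"
    proof
      assume "ideal_prod CC I J = {0}"
      then have "x * y \<in> {0}" using ideal_prod_CC_mem[OF x(1) y(1)] by (rule subst)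
      then show False using x(2) y(2) by simp
    qed
    have "0 \<in> J" using J unfolding frac_ideal_iff by blast
    from ideal_prod_CC_mem[OF x(1) this] show "0 \<in> ideal_prod CC I J" by simp
    show "s + t \<in> ideal_prod CC I J" if "s \<in> ideal_prod CC I J" "t \<in> ideal_prod CC I J" for s t
      using that by (rule ideal_prod_CC_add)
    show "a * s \<in> ideal_prod CC I J" if a: "a \<in> \<O> N" and "s \<in> ideal_prod CC I J" for a s
      using that(2)
    proof (induction rule: ideal_prod_CC_induct)
      case (mult i j)
      have "a * i \<in> I" using I a mult(1) unfolding frac_ideal_iff by blast
      from ideal_prod_CC_mem[OF this mult(2)] show ?case by (simp add: mult.assoc)
    next
      case (add x y)
      then show ?case unfolding distrib_left by (intro ideal_prod_CC_add)
    qed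
    obtain c where c: "c \<in> \<O> N" "c \<noteq> 0" "\<And>x. x \<in> I \<Longrightarrow> c * x \<in> \<O> N"
      using I unfolding frac_ideal_iff by blast
    obtain c' where c': "c' \<in> \<O> N" "c' \<noteq> 0" "\<And>x. x \<in> J \<Longrightarrow> c' * x \<in> \<O> N"
      using J unfolding frac_ideal_iff by blast
    have "c * c' * s \<in> \<O> N" if "s \<in> ideal_prod CC I J" for s using that
    proof (induction rule: ideal_prod_CC_induct)
      case (mult i j)
      then have "(c * i) * (c' * j) \<in> \<O> N" by (intro int_ring_mult c c')
      then show ?case by (simp add: mult_ac)
    next
      case (add x y)
      then show ?case unfolding distrib_left by (rule int_ring_add)
    qed
    then show "\<exists>c\<in>\<O> N. c \<noteq> 0 \<and> (\<forall>x\<in>ideal_prod CC I J. c * x \<in> \<O> N)"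
      using c c' by (intro bexI[of _ "c * c'"]) (auto intro: int_ring_mult)
  qed
  then show "I \<otimes>\<^bsub>frac_ideals N\<^esub> J \<in> carrier (frac_ideals N)" by simp
  show "I \<otimes>\<^bsub>frac_ideals N\<^esub> J = J \<otimes>\<^bsub>frac_ideals N\<^esub> I" by (simp add: ideal_prod_CC_commute)
next
  fix I assume I: "I \<in> carrier (frac_ideals N)"
  have "ideal_prod CC (\<O> N) I = I"
  proof
    show "ideal_prod CC (\<O> N) I \<subseteq> I"
      using I unfolding frac_ideal_iff by (intro ideal_prod_CC_subset) auto
    show "I \<subseteq> ideal_prod CC (\<O> N) I" using ideal_prod_CC_mem[OF int_ring_1] by fastforce
  qed
  then show "\<one>\<^bsub>frac_ideals N\<^esub> \<otimes>\<^bsub>frac_ideals N\<^esub> I = I" by simp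
qed (simp add: ideal_prod_CC_assoc)

section \<open>Prime ideals are invertible\<close>

text \<open>The image of \<open>P\<close> modulo \<open>r\<close> is a vector space of dimension at
  most \<open>d\<close> over the field with \<open>r\<close> elements. The \<open>a i\<close> are a
  longest family in \<open>P\<close> that is independent modulo \<open>r\<close>; by maximality they
  generate \<open>P\<close> up to multiples of \<open>r\<close>.\<close>

lemma prime_ideal_finite_mod_prime:
  assumes P: "prime_ideal N P" and r: "Factorial_Ring.prime r" "of_nat r \<in> P"
  obtains k and a :: "nat \<Rightarrow> complex" where "\<And>i. i < k \<Longrightarrow> a i \<in> P"
    "\<And>x. x \<in> P \<Longrightarrow> \<exists>n u. u \<in> \<O> N \<and> x = (\<Sum>i<k. of_int (n i) * a i) + of_nat r * u"
proof -
  have r0: "(of_nat r :: complex) \<noteq> 0" using r(1) by auto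
  define indep where "indep k a \<longleftrightarrow> (\<forall>i<k. a i \<in> P) \<and>
      (\<forall>n. (\<Sum>i<k. of_int (n i) * a i) / of_nat r \<in> \<O> N \<longrightarrow> (\<forall>i<k. int r dvd n i))"
    for k and a :: "nat \<Rightarrow> complex"
  \<comment> \<open>Among more than \<open>d\<close> elements, \<open>d + 1\<close> satisfy a
    relation with coprime coefficients, which independence would make divisible by
    \<open>r\<close>.\<close>
  have bound: "k \<le> d" if ka: "\<exists>a. indep k a" for k
  proof (rule ccontr)
    assume "\<not> k \<le> d"
    obtain a where a: "\<And>i. i < k \<Longrightarrow> a i \<in> P"
      and ind: "\<And>n i. (\<Sum>i<k. of_int (n i) * a i) / of_nat r \<in> \<O> N \<Longrightarrow> i < k \<Longrightarrow> int r dvd n i"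
      using ka unfolding indep_def by blast
    obtain z where z: "(\<Sum>j\<le>d. of_int (z j) * a j) = 0" "Gcd (z ` {..d}) = 1"
      using dim_le_Rats_primitive[OF dim, of a] a \<open>\<not> k \<le> d\<close> prime_ideal_subset[OF P] int_ring_subset
      by (metis le_less_trans not_le subsetD)
    define n where "n i = (if i \<le> d then z i else 0)" for i
    have "(\<Sum>i<k. of_int (n i) * a i) = (\<Sum>i\<le>d. of_int (z i) * a i)"
      using \<open>\<not> k \<le> d\<close> by (intro sum.mono_neutral_cong_right) (auto simp: n_def)
    then have "(\<Sum>i<k. of_int (n i) * a i) / of_nat r \<in> \<O> N" using z(1) int_ring_0 by simp
    then have "int r dvd n i" if "i < k" for i using ind that by blast
    then have "int r dvd z i" if "i \<le> d" for i
      using that \<open>\<not> k \<le> d\<close> \<open>\<And>i. i < k \<Longrightarrow> int r dvd n i\<close>[of i] by (simp add: n_def)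
    then have "int r dvd Gcd (z ` {..d})" by (intro Gcd_greatest) auto
    then show False using z(2) r(1) by simp
  qed
  have ex0: "\<exists>a. indep 0 a" by (auto simp: indep_def)
  define k where "k = (GREATEST k. \<exists>a. indep k a)"
  have "\<exists>a. indep k a" unfolding k_def by (rule GreatestI_nat[of _ 0 d]) (use ex0 bound in auto)
  then obtain a where a: "indep k a" by blast
  have not: "\<not> indep (Suc k) b" for b
    using Greatest_le_nat[of "\<lambda>k. \<exists>a. indep k a" "Suc k" d] bound unfolding k_def by fastforce
  show ?thesis
  proof
    show "a i \<in> P" if "i < k" for i using a that unfolding indep_def by blast
    fix x assume x: "x \<in> P"
    define b where "b = a(k := x)"
    have "\<forall>i<Suc k. b i \<in> P" using x a unfolding indep_def b_def by (auto simp: less_Suc_eq)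
    then obtain n i where n: "(\<Sum>i<Suc k. of_int (n i) * b i) / of_nat r \<in> \<O> N" "i < Suc k" "\<not> int r dvd n i"
      using not[of b] unfolding indep_def by blast
    have b_sum: "(\<Sum>i<Suc k. of_int (m i) * b i) = (\<Sum>i<k. of_int (m i) * a i) + of_int (m k) * x" for m
      by (simp add: b_def)
    \<comment> \<open>Otherwise the term with \<open>x\<close> could be absorbed, and the
      \<open>a i\<close> themselves would be dependent modulo \<open>r\<close>. Once this
      coefficient is invertible modulo \<open>r\<close>, the relation is solved for
      \<open>x\<close>.\<close>
    have "\<not> int r dvd n k"
    proof
      assume "int r dvd n k"
      then obtain t where t: "n k = int r * t" by blast
      have "(\<Sum>i<k. of_int (n i) * a i) / of_nat r
          = (\<Sum>i<Suc k. of_int (n i) * b i) / of_nat r - of_int t * x"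
        unfolding b_sum t using r0 by (simp add: field_simps)
      also have "\<dots> \<in> \<O> N" using n(1) x prime_ideal_subset[OF P] by (intro int_ring_closed) auto
      finally have "\<forall>i<k. int r dvd n i" using a unfolding indep_def by blast
      with \<open>int r dvd n k\<close> n(2,3) show False by (auto simp: less_Suc_eq)
    qed
    then obtain v w where vw: "of_int w * of_int (n k) = 1 - (of_int v * of_nat r :: complex)"
      by (rule prime_inverse_mod[OF r(1)])
    define u where "u = (\<Sum>i<Suc k. of_int (n i) * b i) / of_nat r"
    have "of_nat r * u = (\<Sum>i<k. of_int (n i) * a i) + of_int (n k) * x"
      unfolding u_def b_sum using r0 by simp
    then have "of_int w * (of_nat r * u) = (\<Sum>i<k. of_int w * (of_int (n i) * a i)) + (of_int w * of_int (n k)) * x"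
      by (simp add: distrib_left sum_distrib_left mult.assoc)
    then have "x = (\<Sum>i<k. of_int (- w * n i) * a i) + of_nat r * (of_int w * u + of_int v * x)"
      unfolding vw by (simp add: algebra_simps sum_negf)
    moreover have "of_int w * u + of_int v * x \<in> \<O> N"
      using n(1) x prime_ideal_subset[OF P] unfolding u_def by (intro int_ring_closed) auto
    ultimately show "\<exists>n u. u \<in> \<O> N \<and> x = (\<Sum>i<k. of_int (n i) * a i) + of_nat r * u"
      by (intro exI[of _ "\<lambda>i. - w * n i"] exI[of _ "of_int w * u + of_int v * x"] conjI)
  qed
qed

text \<open>Every \<open>a \<in> P\<close> is nilpotent modulo \<open>r\<close> after multiplication by some element outside \<open>P\<close>.
  Starting from the product of these elements over finitely many generators of \<open>P\<close> modulo \<open>r\<close>,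
  one multiplies by each generator as often as the result stays nonzero modulo \<open>r\<close>.\<close>

lemma prime_ideal_annihilator:
  assumes P: "prime_ideal N P" and r: "Factorial_Ring.prime r" "of_nat r \<in> P"
  obtains b where "b \<in> \<O> N" "b / of_nat r \<notin> \<O> N" "\<And>x. x \<in> P \<Longrightarrow> b / of_nat r * x \<in> \<O> N"
proof -
  have r0: "(of_nat r :: complex) \<noteq> 0" using r(1) by auto
  obtain k and a :: "nat \<Rightarrow> complex" where a: "\<And>i. i < k \<Longrightarrow> a i \<in> P"
    and gen: "\<And>x. x \<in> P \<Longrightarrow> \<exists>n u. u \<in> \<O> N \<and> x = (\<Sum>i<k. of_int (n i) * a i) + of_nat r * u"
    using prime_ideal_finite_mod_prime[OF assms] by blast
  have aO: "a i \<in> \<O> N" if "i < k" for i using a[OF that] prime_ideal_subset[OF P] by blast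
  have "\<forall>i. \<exists>se. i < k \<longrightarrow> fst se \<in> \<O> N - P \<and> fst se * a i ^ snd se / of_nat r \<in> \<O> N"
  proof
    fix i
    show "\<exists>se. i < k \<longrightarrow> fst se \<in> \<O> N - P \<and> fst se * a i ^ snd se / of_nat r \<in> \<O> N"
    proof (cases "i < k")
      case True
      have "\<not> int r dvd 1" using r(1) by auto
      then obtain e c t u n z where *: "\<not> int r dvd c" "t \<in> \<O> N" "u \<in> \<O> N"
        "a i ^ e * (of_int c + a i * t) = of_int (int r) * u" "t = (\<Sum>j<n. of_int (z j) * a i ^ j)"
        by (rule integral_equation_split[OF aO[OF True]])
      \<comment> \<open>\<open>a i\<close> lies in \<open>P\<close> and \<open>c\<close> does not.
        So this factor is an element outside \<open>P\<close>, and by the equation it makes a power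
        of \<open>a i\<close> divisible by \<open>r\<close>.\<close>
      have "of_int c + a i * t \<notin> P"
      proof
        assume "of_int c + a i * t \<in> P"
        then have "of_int c + a i * t - a i * t \<in> P"
          using a[OF True] *(2) by (intro prime_ideal_diff[OF P] prime_ideal_mult2[OF P])
        then show False using prime_ideal_of_int_iff[OF P r] *(1) by simp
      qed
      moreover have "of_int c + a i * t \<in> \<O> N" using aO[OF True] *(2) by (intro int_ring_closed)
      moreover have "(of_int c + a i * t) * a i ^ e / of_nat r = u" using *(4) r0 by (simp add: field_simps)
      ultimately show ?thesis using *(3) by (intro exI[of _ "(of_int c + a i * t, e)"]) auto
    qed auto
  qed
  from choice[OF this] obtain se where se: "\<And>i. i < k \<Longrightarrow> fst (se i) \<in> \<O> N - P"
    "\<And>i. i < k \<Longrightarrow> fst (se i) * a i ^ snd (se i) / of_nat r \<in> \<O> N" by blast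
  define e where "e = (\<lambda>i. snd (se i))"
  define s where "s = (\<Prod>i<k. fst (se i))"
  have s: "s \<in> \<O> N - P" unfolding s_def using se(1) by (intro prime_ideal_prod[OF P]) auto
  have s_kill: "s * a i ^ e i / of_nat r \<in> \<O> N" if "i < k" for i
  proof -
    have "s = fst (se i) * (\<Prod>j\<in>{..<k} - {i}. fst (se j))"
      unfolding s_def using that by (intro prod.remove) auto
    then have "s * a i ^ e i / of_nat r = (\<Prod>j\<in>{..<k} - {i}. fst (se j)) * (fst (se i) * a i ^ e i / of_nat r)"
      by simp
    also have "\<dots> \<in> \<O> N" using se that unfolding e_def by (intro int_ring_mult int_ring_prod) auto
    finally show ?thesis .
  qed
  \<comment> \<open>The clause with \<open>e i\<close> is carried along for all generators, so that
    a minimal exponent exists when the turn of each comes; the last clause records the generators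
    already treated.\<close>
  have "\<exists>b\<in>\<O> N. b / of_nat r \<notin> \<O> N \<and> (\<forall>i<k. b * a i ^ e i / of_nat r \<in> \<O> N) \<and>
      (\<forall>i<j. b * a i / of_nat r \<in> \<O> N)" if "j \<le> k" for j using that
  proof (induction j)
    case 0
    have "s / of_nat r \<notin> \<O> N"
    proof
      assume "s / of_nat r \<in> \<O> N"
      from prime_ideal_mult[OF P this r(2)] show False using s r0 by simp
    qed
    then show ?case using s s_kill by (intro bexI[of _ s]) auto
  next
    case (Suc j)
    then obtain b where b: "b \<in> \<O> N" "b / of_nat r \<notin> \<O> N" "\<And>i. i < k \<Longrightarrow> b * a i ^ e i / of_nat r \<in> \<O> N"
      "\<And>i. i < j \<Longrightarrow> b * a i / of_nat r \<in> \<O> N" by auto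
    \<comment> \<open>With \<open>m - 1\<close> factors \<open>a j\<close> the element is still
      nonzero modulo \<open>r\<close>, and one more factor makes it vanish.\<close>
    define m where "m = (LEAST m. b * a j ^ m / of_nat r \<in> \<O> N)"
    have "b * a j ^ e j / of_nat r \<in> \<O> N" using b(3)[of j] Suc.prems by simp
    then have m: "b * a j ^ m / of_nat r \<in> \<O> N" unfolding m_def by (rule LeastI)
    have "m > 0" using m b(2) by (cases m) auto
    have m': "b * a j ^ (m - 1) / of_nat r \<notin> \<O> N"
      using not_less_Least[of "m - 1" "\<lambda>m. b * a j ^ m / of_nat r \<in> \<O> N"] \<open>m > 0\<close> unfolding m_def by auto
    have aj: "a j ^ (m - 1) \<in> \<O> N" using aO Suc.prems by (intro int_ring_power) auto
    show ?case
    proof (intro bexI[of _ "b * a j ^ (m - 1)"] conjI allI impI)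
      show "b * a j ^ (m - 1) / of_nat r \<notin> \<O> N" by (rule m')
      fix i
      show "b * a j ^ (m - 1) * a i ^ e i / of_nat r \<in> \<O> N" if "i < k"
        using int_ring_mult[OF aj b(3)[OF that]] by (simp add: mult_ac)
      show "b * a j ^ (m - 1) * a i / of_nat r \<in> \<O> N" if "i < Suc j"
      proof (cases "i = j")
        case True
        then show ?thesis using m \<open>m > 0\<close> by (cases m) (auto simp: mult_ac)
      next
        case False
        then show ?thesis using int_ring_mult[OF aj b(4)[of i]] that by (simp add: mult_ac)
      qed
    qed (use b(1) aj in \<open>auto intro: int_ring_mult\<close>)
  qed
  from this[of k] obtain b where b: "b \<in> \<O> N" "b / of_nat r \<notin> \<O> N" "\<And>i. i < k \<Longrightarrow> b * a i / of_nat r \<in> \<O> N"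
    by auto
  show ?thesis
  proof
    fix x assume "x \<in> P"
    then obtain n u where x: "u \<in> \<O> N" "x = (\<Sum>i<k. of_int (n i) * a i) + of_nat r * u" using gen by blast
    have "b / of_nat r * x = (\<Sum>i<k. of_int (n i) * (b * a i / of_nat r)) + b * u"
      unfolding x(2) using r0 by (simp add: distrib_left sum_distrib_left mult_ac)
    also have "\<dots> \<in> \<O> N"
      using b x(1) by (intro int_ring_add int_ring_sum int_ring_mult int_ring_of_int) auto
    finally show "b / of_nat r * x \<in> \<O> N" .
  qed (fact b)+
qed

text \<open>A multiplier of \<open>P\<close> is integral, although \<open>P\<close> is not known to be finitely generated:
  all \<open>r \<theta>\<^sup>j\<close> lie in \<open>P\<close>, and a primitive integral relation between them is monic modulo \<open>r\<close>.\<close>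

lemma prime_ideal_multiplier_integral:
  assumes P: "prime_ideal N P" and r: "Factorial_Ring.prime r" "of_nat r \<in> P"
    and \<theta>: "\<And>x. x \<in> P \<Longrightarrow> \<theta> * x \<in> P"
  shows "\<theta> \<in> \<O> N"
proof -
  have r0: "(of_nat r :: complex) \<noteq> 0" using r(1) by auto
  have powP: "of_nat r * \<theta> ^ j \<in> P" for j
    by (induction j) (use r(2) \<theta> in \<open>auto simp: mult.left_commute\<close>)
  have PN: "P \<subseteq> N" using prime_ideal_subset[OF P] int_ring_subset by blast
  have "\<theta> = (\<theta> * of_nat r) / of_nat r" using r0 by simp
  also have "\<dots> \<in> N"
    using \<theta>[OF r(2)] PN by (intro subfield_divide[OF subfield] subfield_of_nat[OF subfield]) auto
  finally have "\<theta> \<in> N" .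
  obtain z where z: "(\<Sum>j\<le>d. of_int (z j) * (of_nat r * \<theta> ^ j)) = 0" "Gcd (z ` {..d}) = 1"
    using dim_le_Rats_primitive[OF dim, of "\<lambda>j. of_nat r * \<theta> ^ j"] powP PN by (metis subsetD)
  have "of_nat r * (\<Sum>j\<le>d. of_int (z j) * \<theta> ^ j) = 0"
    using z(1) by (simp add: sum_distrib_left mult_ac)
  then have rel: "(\<Sum>j\<le>d. of_int (z j) * \<theta> ^ j) = 0" using r0 by simp
  have "\<not> int r dvd 1" using r(1) by auto
  then obtain n where n: "n \<le> d" "\<not> int r dvd z n" and n_max: "\<And>j. j \<le> d \<Longrightarrow> \<not> int r dvd z j \<Longrightarrow> j \<le> n"
    by (rule primitive_last_index[OF z(2)]) (rule that)
  obtain v w where vw: "of_int w * of_int (z n) = 1 - (of_int v * of_nat r :: complex)"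
    by (rule prime_inverse_mod[OF r(1) n(2)])
  \<comment> \<open>After multiplication by the inverse \<open>w\<close> of \<open>z n\<close>
    modulo \<open>r\<close>, everything outside the monic part is collected here. It lies in
    \<open>P\<close>, because the coefficients above \<open>n\<close> are divisible by
    \<open>r\<close> and \<open>of_nat r * \<theta> ^ j\<close> lies in \<open>P\<close>.\<close>
  define b where "b = of_int v * (of_nat r * \<theta> ^ n) - (\<Sum>j\<in>{Suc n..d}. of_int (w * (z j div int r)) * (of_nat r * \<theta> ^ j))"
  have bP: "b \<in> P"
    unfolding b_def by (intro prime_ideal_diff[OF P] prime_ideal_sum[OF P] prime_ideal_mult[OF P] int_ring_of_int powP)
  have split: "{..d} = {..<n} \<union> {n} \<union> {Suc n..d}" using n(1) by auto
  have "0 = of_int w * (\<Sum>j\<le>d. of_int (z j) * \<theta> ^ j)" using rel by simp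
  also have "\<dots> = (\<Sum>j\<le>d. of_int w * of_int (z j) * \<theta> ^ j)" by (simp add: sum_distrib_left mult_ac)
  also have "\<dots> = (\<Sum>j<n. of_int w * of_int (z j) * \<theta> ^ j) + of_int w * of_int (z n) * \<theta> ^ n
      + (\<Sum>j\<in>{Suc n..d}. of_int w * of_int (z j) * \<theta> ^ j)"
    unfolding split by (subst sum.union_disjoint, auto)+
  also have "(\<Sum>j\<in>{Suc n..d}. of_int w * of_int (z j) * \<theta> ^ j)
      = (\<Sum>j\<in>{Suc n..d}. of_int (w * (z j div int r)) * (of_nat r * \<theta> ^ j))"
  proof (rule sum.cong[OF refl])
    fix j assume "j \<in> {Suc n..d}"
    then have "int r dvd z j" using n_max[of j] by force
    then have "z j = (z j div int r) * int r" by simp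
    then have "(of_int (z j) :: complex) = of_int (z j div int r) * of_nat r" by (metis of_int_mult of_int_of_nat_eq)
    then show "of_int w * of_int (z j) * \<theta> ^ j = of_int (w * (z j div int r)) * (of_nat r * \<theta> ^ j)"
      by simp
  qed
  finally have "\<theta> ^ n = (\<Sum>j<n. of_int (- w * z j) * \<theta> ^ j) + b"
    unfolding vw b_def by (simp add: algebra_simps sum_negf)
  \<comment> \<open>For \<open>n = 0\<close> the relation would say that 1 equals \<open>b\<close>,
    an element of \<open>P\<close>.\<close>
  moreover from this have "n > 0" using bP prime_ideal_1[OF P] by (cases n) auto
  moreover have "algebraic_int b" using bP prime_ideal_subset[OF P] int_ring_algebraic_int by blast
  ultimately have "algebraic_int \<theta>" using algebraic_int_monic_relation[of n b \<theta> "\<lambda>j. - w * z j"] by blast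
  then show ?thesis using \<open>\<theta> \<in> N\<close> by (simp add: int_ring_def)
qed

text \<open>The inverse is generated by 1 and \<theta> = b / r, where \<open>b\<close> annihilates
  \<open>P\<close> modulo \<open>r\<close>. As \<theta> is not integral, it does not map
  \<open>P\<close> into itself, so some \<theta> x with x in \<open>P\<close> is an integer outside
  \<open>P\<close>; by maximality a multiple of it and an element of \<open>P\<close> add up to
  1.\<close>

lemma prime_ideal_invertible:
  assumes P: "prime_ideal N P"
  shows "P \<in> Units (frac_ideals N)"
proof -
  obtain r where r: "Factorial_Ring.prime r" "of_nat r \<in> P" using prime_ideal_contains_prime[OF P] .
  then have r0: "(of_nat r :: complex) \<noteq> 0" by auto
  obtain b where b: "b \<in> \<O> N" "b / of_nat r \<notin> \<O> N" "\<And>x. x \<in> P \<Longrightarrow> b / of_nat r * x \<in> \<O> N"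
    by (rule prime_ideal_annihilator[OF P r]) (rule that)
  define \<theta> where "\<theta> = b / of_nat r"
  obtain x where x: "x \<in> P" "\<theta> * x \<notin> P"
    using prime_ideal_multiplier_integral[OF P r, of \<theta>] b(2) unfolding \<theta>_def by blast
  obtain a y where ay: "a \<in> \<O> N" "y \<in> P" "\<theta> * x * a + y = 1"
    using prime_ideal_maximal[OF P, of "\<theta> * x"] x b(3) unfolding \<theta>_def by blast
  define J where "J = {u + \<theta> * v | u v. u \<in> \<O> N \<and> v \<in> \<O> N}"
  have JI: "u + \<theta> * v \<in> J" if "u \<in> \<O> N" "v \<in> \<O> N" for u v using that unfolding J_def by blast
  have "1 \<in> J" using JI[OF int_ring_1 int_ring_0] by simp
  have J: "J \<in> carrier (frac_ideals N)" unfolding frac_ideal_iff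
  proof (intro conjI ballI)
    show "J \<subseteq> N" unfolding J_def \<theta>_def using b(1) int_ring_subset
      by (auto intro!: subfield_closed[OF subfield] subfield_of_nat[OF subfield])
    show "0 \<in> J" using JI[OF int_ring_0 int_ring_0] by simp
    show "J \<noteq> {0}" using \<open>1 \<in> J\<close> by auto
    show "s + t \<in> J" if st: "s \<in> J" "t \<in> J" for s t
    proof -
      obtain u v u' v' where "s = u + \<theta> * v" "t = u' + \<theta> * v'" "u \<in> \<O> N" "v \<in> \<O> N" "u' \<in> \<O> N" "v' \<in> \<O> N"
        using st unfolding J_def by blast
      then show ?thesis using JI[of "u + u'" "v + v'"] by (simp add: int_ring_add algebra_simps)
    qed
    show "c * s \<in> J" if cs: "c \<in> \<O> N" "s \<in> J" for c s
    proof -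
      obtain u v where "s = u + \<theta> * v" "u \<in> \<O> N" "v \<in> \<O> N" using cs unfolding J_def by blast
      then show ?thesis using JI[of "c * u" "c * v"] cs by (simp add: int_ring_mult algebra_simps)
    qed
    have "of_nat r * s \<in> \<O> N" if s: "s \<in> J" for s
    proof -
      obtain u v where "s = u + \<theta> * v" "u \<in> \<O> N" "v \<in> \<O> N" using s unfolding J_def by blast
      then have "of_nat r * s = of_nat r * u + b * v" "u \<in> \<O> N" "v \<in> \<O> N"
        using r0 by (auto simp: \<theta>_def distrib_left)
      then show ?thesis using b(1) by (auto intro!: int_ring_add int_ring_mult int_ring_of_nat)
    qed
    then show "\<exists>c\<in>\<O> N. c \<noteq> 0 \<and> (\<forall>x\<in>J. c * x \<in> \<O> N)"
      using r0 int_ring_of_nat by (intro bexI[of _ "of_nat r"]) auto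
  qed
  have PJ: "ideal_prod CC P J = \<O> N"
  proof
    show "ideal_prod CC P J \<subseteq> \<O> N"
    proof (rule ideal_prod_CC_subset)
      fix s t assume s: "s \<in> P" and "t \<in> J"
      then obtain u v where t: "t = u + \<theta> * v" "u \<in> \<O> N" "v \<in> \<O> N" unfolding J_def by blast
      have "s * t = s * u + (\<theta> * s) * v" unfolding t by (simp add: algebra_simps)
      also have "\<dots> \<in> \<O> N"
        using int_ring_mult[of s u] int_ring_mult[OF b(3)[OF s] t(3)] s t(2) prime_ideal_subset[OF P]
        unfolding \<theta>_def by (auto intro: int_ring_add)
      finally show "s * t \<in> \<O> N" .
    qed (rule int_ring_add)
    have "x * (0 + \<theta> * a) + y * 1 \<in> ideal_prod CC P J"
      using x(1) ay \<open>1 \<in> J\<close> by (intro ideal_prod_CC_add ideal_prod_CC_mem JI int_ring_0)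
    then have one: "1 \<in> ideal_prod CC P J" using ay(3) by (simp add: mult_ac)
    interpret comm_monoid "frac_ideals N" by (rule frac_ideals_comm_monoid)
    have "P \<in> carrier (frac_ideals N)" using P ideal_frac_ideal unfolding prime_ideal_iff by blast
    then have "ideal_prod CC P J \<in> carrier (frac_ideals N)" using m_closed[OF _ J] by simp
    then have "c * 1 \<in> ideal_prod CC P J" if "c \<in> \<O> N" for c
      using that one unfolding frac_ideal_iff by blast
    then show "\<O> N \<subseteq> ideal_prod CC P J" by auto
  qed
  have "P \<in> carrier (frac_ideals N)" using P ideal_frac_ideal unfolding prime_ideal_iff by blast
  then show ?thesis using J PJ ideal_prod_CC_commute[of P J] unfolding Units_def by auto
qed

end

lemma int_pow_nonneg: "k \<ge> 0 \<Longrightarrow> a [^]\<^bsub>G\<^esub> k = a [^]\<^bsub>G\<^esub> nat k" by (subst int_pow_def2) simp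

lemma int_pow_neg_eq_inv: "k < 0 \<Longrightarrow> a [^]\<^bsub>G\<^esub> k = inv\<^bsub>G\<^esub> (a [^]\<^bsub>G\<^esub> nat (- k))"
  by (subst int_pow_def2) simp

lemma (in monoid) Units_nat_pow: "x \<in> Units G \<Longrightarrow> x [^] (n :: nat) \<in> Units G" by (induction n) auto

section \<open>Valuations at the primes above an unramified prime\<close>

locale unramified_prime = number_field +
  fixes q :: nat and S :: "complex set set"
  assumes q: "Factorial_Ring.prime q" and finite_S: "finite S" and prime_S: "\<And>P. P \<in> S \<Longrightarrow> prime_ideal N P"
    and factorisation: "principal N (of_nat q) = (\<Otimes>\<^bsub>frac_ideals N\<^esub>P\<in>S. P)"
begin

sublocale G: comm_monoid "frac_ideals N" by (rule frac_ideals_comm_monoid)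

abbreviation prime_prod :: "complex set set \<Rightarrow> complex set" where
  "prime_prod T \<equiv> (\<Otimes>\<^bsub>frac_ideals N\<^esub>P\<in>T. P)"

abbreviation frac_mult (infixl \<open>\<odot>\<close> 70) where "I \<odot> J \<equiv> I \<otimes>\<^bsub>frac_ideals N\<^esub> J"

abbreviation frac_pow (infixr \<open>\<up>\<close> 75) where "I \<up> k \<equiv> I [^]\<^bsub>frac_ideals N\<^esub> k"

lemma q_nonzero: "(of_nat q :: complex) \<noteq> 0" using q by auto

lemma S_Units: "P \<in> S \<Longrightarrow> P \<in> Units (frac_ideals N)" by (rule prime_ideal_invertible[OF prime_S])

lemma S_carrier: "P \<in> S \<Longrightarrow> P \<in> carrier (frac_ideals N)" using S_Units by (rule G.Units_closed)

lemma finprod_S_insert: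
  assumes "P \<in> S" "T \<subseteq> S" "P \<notin> T"
  shows "prime_prod (insert P T) = ideal_prod CC P (prime_prod T)"
proof -
  have "finite T" using assms(2) finite_S by (rule finite_subset)
  moreover have "(\<lambda>P. P) \<in> T \<rightarrow> carrier (frac_ideals N)" using assms(2) S_carrier by auto
  ultimately show ?thesis using G.finprod_insert[of T P "\<lambda>P. P"] assms S_carrier by simp
qed

lemma finprod_S_mem:
  assumes "T \<subseteq> S" "\<And>P. P \<in> T \<Longrightarrow> f P \<in> P"
  shows "prod f T \<in> prime_prod T"
proof -
  have "finite T" using assms(1) finite_S by (rule finite_subset)
  then show ?thesis using assms
  proof (induction T rule: finite_induct)
    case empty
    then show ?case using int_ring_1 by simp
  next
    case (insert P T)
    then show ?case using finprod_S_insert[of P T] by (auto intro!: ideal_prod_CC_mem)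
  qed
qed

lemma finprod_S_subset_int_ring:
  assumes "T \<subseteq> S"
  shows "prime_prod T \<subseteq> \<O> N"
proof -
  have "finite T" using assms finite_S by (rule finite_subset)
  then show ?thesis using assms
  proof (induction T rule: finite_induct)
    case (insert P T)
    have "ideal_prod CC P (prime_prod T) \<subseteq> \<O> N" using insert prime_ideal_subset[OF prime_S, of P]
      by (intro ideal_prod_CC_subset) (auto intro!: int_ring_mult int_ring_add)
    then show ?case using insert finprod_S_insert[of P T] by simp
  qed simp
qed

lemma q_mem: "Q \<in> S \<Longrightarrow> of_nat q \<in> Q"
proof -
  assume Q: "Q \<in> S"
  have "of_nat q = 1 * (of_nat q :: complex)" by simp
  also have "\<dots> \<in> principal N (of_nat q)" using int_ring_1 by (rule imageI)
  also have "principal N (of_nat q) = prime_prod (insert Q (S - {Q}))"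
    unfolding factorisation using Q by (simp add: insert_absorb)
  also have "\<dots> = ideal_prod CC Q (prime_prod (S - {Q}))" using Q by (intro finprod_S_insert) auto
  also have "\<dots> \<subseteq> Q"
    using finprod_S_subset_int_ring[of "S - {Q}"] prime_ideal_mult2[OF prime_S[OF Q]] prime_ideal_add[OF prime_S[OF Q]]
    by (intro ideal_prod_CC_subset) auto
  finally show ?thesis .
qed

text \<open>For empty \<open>S\<close> the prime \<open>q\<close> would be a unit, and 1 / q a
  rational algebraic integer.\<close>

lemma S_nonempty: "S \<noteq> {}"
proof
  assume "S = {}"
  then have "principal N (of_nat q) = \<O> N" using factorisation by simp
  then obtain a where a: "a \<in> \<O> N" "1 = a * of_nat q" using int_ring_1 by (metis imageE)
  then have "a = 1 / of_nat q" using q_nonzero by (simp add: field_simps)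
  then have "a \<in> \<rat>" by simp
  then have "a \<in> \<int>" using a(1) int_ring_algebraic_int rational_algebraic_int_is_int by blast
  then obtain m where "a = of_int m" by (auto elim: Ints_cases)
  then have "of_int (m * int q) = (1 :: complex)" using a(2) by simp
  then have "m * int q = 1" by (simp only: of_int_eq_1_iff)
  then have "int q dvd 1" by (metis dvd_triv_right)
  then show False using q by simp
qed

text \<open>Primes are maximal, so for a prime Q outside \<open>S\<close> each \<open>P\<close> in
  \<open>S\<close> has an element outside Q. The product of these elements is a multiple of
  \<open>q\<close>; if Q contained \<open>q\<close>, it would contain this product.\<close>

lemma primes_above_eq: "primes_above N q = S"
proof
  show "S \<subseteq> primes_above N q" using prime_S q_mem by (auto simp: primes_above_def)
  show "primes_above N q \<subseteq> S"
  proof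
    fix Q assume "Q \<in> primes_above N q"
    then have Q: "prime_ideal N Q" "of_nat q \<in> Q" by (auto simp: primes_above_def)
    show "Q \<in> S"
    proof (rule ccontr)
      assume "Q \<notin> S"
      have "\<exists>a. a \<in> P \<and> a \<notin> Q" if "P \<in> S" for P
        using prime_ideal_subset_eq[OF prime_S[OF that] Q(1)] that \<open>Q \<notin> S\<close> by blast
      then obtain f where f: "\<And>P. P \<in> S \<Longrightarrow> f P \<in> P \<and> f P \<notin> Q" by metis
      have "prod f S \<in> principal N (of_nat q)"
        unfolding factorisation using f by (intro finprod_S_mem) auto
      then have "prod f S \<in> Q" using prime_ideal_mult[OF Q(1) _ Q(2)] by auto
      moreover have "prod f S \<in> \<O> N - Q"
        using f prime_ideal_subset[OF prime_S] by (intro prime_ideal_prod[OF Q(1)]) blast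
      ultimately show False by simp
    qed
  qed
qed

text \<open>This makes \<open>Q\<close> locally principal: multiplication by \<open>c\<close>, a
  unit at \<open>Q\<close>, turns every element of \<open>Q\<close> into a multiple of
  \<open>q\<close>, because \<open>c\<close> lies in the product of the other primes of
  \<open>S\<close>.\<close>

lemma complementary_element:
  assumes Q: "Q \<in> S"
  obtains c where "c \<in> \<O> N - Q" "\<And>P. P \<in> S \<Longrightarrow> P \<noteq> Q \<Longrightarrow> c \<in> P"
    "\<And>x. x \<in> Q \<Longrightarrow> c * x / of_nat q \<in> \<O> N" "c \<in> prime_prod (S - {Q})"
proof -
  have "\<exists>a. a \<in> P \<and> a \<notin> Q" if "P \<in> S - {Q}" for P
    using prime_ideal_subset_eq[OF prime_S prime_S[OF Q], of P] that by blast
  then obtain f where f: "\<And>P. P \<in> S - {Q} \<Longrightarrow> f P \<in> P \<and> f P \<notin> Q" by metis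
  have fO: "f P \<in> \<O> N" if "P \<in> S - {Q}" for P
    using f[OF that] prime_ideal_subset[OF prime_S, of P] that by blast
  define c where "c = prod f (S - {Q})"
  show ?thesis
  proof
    show "c \<in> \<O> N - Q" unfolding c_def using f fO by (intro prime_ideal_prod[OF prime_S[OF Q]]) blast
    show "c \<in> P" if P: "P \<in> S" "P \<noteq> Q" for P
    proof -
      have "c = f P * prod f (S - {Q} - {P})"
        unfolding c_def using P finite_S by (intro prod.remove) auto
      moreover have "prod f (S - {Q} - {P}) \<in> \<O> N" using fO by (intro int_ring_prod) auto
      ultimately show ?thesis using f[of P] P prime_ideal_mult2[OF prime_S[OF P(1)]] by auto
    qed
    show "c \<in> prime_prod (S - {Q})" unfolding c_def using f by (intro finprod_S_mem) auto
    fix x assume x: "x \<in> Q"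
    have "prod (f(Q := x)) S \<in> prime_prod S" using f x by (intro finprod_S_mem) auto
    moreover have "prod (f(Q := x)) S = x * c"
    proof -
      have "prod (f(Q := x)) S = (f(Q := x)) Q * prod (f(Q := x)) (S - {Q})"
        using Q finite_S by (intro prod.remove)
      also have "prod (f(Q := x)) (S - {Q}) = c" unfolding c_def by (intro prod.cong) auto
      finally show ?thesis by simp
    qed
    ultimately have "x * c \<in> principal N (of_nat q)" unfolding factorisation by simp
    then show "c * x / of_nat q \<in> \<O> N" using q_nonzero by (auto simp: mult.commute)
  qed
qed

text \<open>\<open>x\<close> is the \<open>k\<close>-th power of \<open>q\<close> times a unit of
  the local ring at \<open>Q\<close>, with denominators multiplied out so that no localisation has
  to be formed.\<close>

definition has_val :: "complex set \<Rightarrow> int \<Rightarrow> complex \<Rightarrow> bool" where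
  "has_val Q k x \<longleftrightarrow> (\<exists>a\<in>\<O> N - Q. \<exists>b\<in>\<O> N - Q. x * b = of_nat q powi k * a)"

definition val :: "complex set \<Rightarrow> complex \<Rightarrow> int" where
  "val Q x = (THE k. has_val Q k x)"

context
  fixes Q assumes Q: "Q \<in> S"
begin

lemma S_mem_0: "0 \<in> Q" using prime_ideal_0[OF prime_S[OF Q]] .

lemma compl_mult: "a \<in> \<O> N - Q \<Longrightarrow> b \<in> \<O> N - Q \<Longrightarrow> a * b \<in> \<O> N - Q"
  using prime_ideal_prime[OF prime_S[OF Q]] by (auto intro: int_ring_mult)

lemma q_powi_mem: "k > 0 \<Longrightarrow> a \<in> \<O> N \<Longrightarrow> of_nat q powi k * a \<in> Q"
proof -
  assume k: "k > 0" and a: "a \<in> \<O> N"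
  then have "of_nat q powi k * a = of_nat q * (of_nat q ^ (nat k - 1) * a)"
    by (cases "nat k") (auto simp: power_int_def)
  also have "\<dots> \<in> Q"
    using a by (intro prime_ideal_mult2[OF prime_S[OF Q] q_mem[OF Q]] int_ring_mult int_ring_power int_ring_of_nat)
  finally show ?thesis .
qed

lemma has_val_unique:
  assumes "has_val Q k x" "has_val Q l x"
  shows "k = l"
proof -
  have "\<not> k < l" if "has_val Q k x" "has_val Q l x" for k l
  proof
    assume "k < l"
    obtain a b where ab: "a \<in> \<O> N - Q" "b \<in> \<O> N - Q" "x * b = of_nat q powi k * a"
      using \<open>has_val Q k x\<close> unfolding has_val_def by blast
    obtain a' b' where ab': "a' \<in> \<O> N - Q" "b' \<in> \<O> N - Q" "x * b' = of_nat q powi l * a'"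
      using \<open>has_val Q l x\<close> unfolding has_val_def by blast
    have "of_nat q powi k * (a * b') = (x * b) * b'" using ab(3) by simp
    also have "\<dots> = of_nat q powi l * (a' * b)" using ab'(3) by (simp add: mult_ac)
    also have "of_nat q powi l = (of_nat q powi k * of_nat q powi (l - k) :: complex)"
      using q_nonzero by (simp flip: power_int_add)
    finally have "a * b' = of_nat q powi (l - k) * (a' * b)" using q_nonzero by simp
    then have "a * b' \<in> Q" using q_powi_mem[of "l - k" "a' * b"] \<open>k < l\<close> ab ab' by (auto intro: int_ring_mult)
    then show False using compl_mult[OF ab(1) ab'(2)] by simp
  qed
  from this[of k l] this[of l k] assms show ?thesis by auto
qed

lemma has_val_mult: "has_val Q k x \<Longrightarrow> has_val Q l y \<Longrightarrow> has_val Q (k + l) (x * y)"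
proof -
  assume "has_val Q k x" "has_val Q l y"
  then obtain a b a' b' where ab: "a \<in> \<O> N - Q" "b \<in> \<O> N - Q" "x * b = of_nat q powi k * a"
    and ab': "a' \<in> \<O> N - Q" "b' \<in> \<O> N - Q" "y * b' = of_nat q powi l * a'"
    unfolding has_val_def by blast
  have "(x * y) * (b * b') = (x * b) * (y * b')" by simp
  also have "\<dots> = of_nat q powi (k + l) * (a * a')"
    unfolding ab(3) ab'(3) using q_nonzero by (simp add: power_int_add mult_ac)
  finally show ?thesis unfolding has_val_def using compl_mult ab ab' by blast
qed

lemma has_val_nonzero: "has_val Q k x \<Longrightarrow> x \<noteq> 0" unfolding has_val_def using q_nonzero S_mem_0 by auto

lemma has_val_inverse: "has_val Q k x \<Longrightarrow> has_val Q (- k) (inverse x)"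
proof -
  assume "has_val Q k x"
  moreover from this obtain a b where ab: "a \<in> \<O> N - Q" "b \<in> \<O> N - Q" "x * b = of_nat q powi k * a"
    unfolding has_val_def by blast
  ultimately have "inverse x * a = of_nat q powi (- k) * b"
    using q_nonzero has_val_nonzero by (simp add: power_int_minus field_simps)
  then show ?thesis unfolding has_val_def using ab by blast
qed

lemma has_val_unit: "a \<in> \<O> N - Q \<Longrightarrow> has_val Q 0 a"
  unfolding has_val_def using prime_ideal_1[OF prime_S[OF Q]] int_ring_1
  by (intro bexI[of _ a] bexI[of _ 1]) auto

lemma has_val_q: "has_val Q 1 (of_nat q)"
  unfolding has_val_def using prime_ideal_1[OF prime_S[OF Q]] int_ring_1
  by (intro bexI[of _ 1]) auto

text \<open>If no value existed, \<open>x\<close> would be divisible at \<open>Q\<close> by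
  arbitrarily high powers of \<open>q\<close>: as long as the cofactor lies in \<open>Q\<close>, the
  element \<open>c\<close> extracts another factor \<open>q\<close>. But \<open>x\<close> divides a
  nonzero integer, in which the exponent of \<open>q\<close> is finite.\<close>

lemma has_val_ex_int:
  assumes x: "x \<in> \<O> N" "x \<noteq> 0"
  shows "\<exists>k. has_val Q k x"
proof (rule ccontr)
  assume no: "\<not> ?thesis"
  obtain c where c: "c \<in> \<O> N - Q" "\<And>x. x \<in> Q \<Longrightarrow> c * x / of_nat q \<in> \<O> N"
    using complementary_element[OF Q] by metis
  have div: "\<exists>a\<in>\<O> N. \<exists>b\<in>\<O> N - Q. x * b = of_nat q ^ n * a" for n
  proof (induction n)
    case 0
    show ?case using x prime_ideal_1[OF prime_S[OF Q]] int_ring_1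
      by (intro bexI[of _ x] bexI[of _ 1]) auto
  next
    case (Suc n)
    then obtain a b where ab: "a \<in> \<O> N" "b \<in> \<O> N - Q" "x * b = of_nat q ^ n * a" by blast
    have "a \<in> Q"
    proof (rule ccontr)
      assume "a \<notin> Q"
      then have "has_val Q (int n) x" unfolding has_val_def using ab by auto
      then show False using no by blast
    qed
    have "x * (b * c) = of_nat q ^ n * a * c" using ab(3) by (metis mult.assoc)
    also have "\<dots> = of_nat q ^ Suc n * (c * a / of_nat q)" using q_nonzero by simp
    finally show ?case using c(2)[OF \<open>a \<in> Q\<close>] compl_mult[OF ab(2) c(1)] by blast
  qed
  obtain m :: int and x' where m: "m \<noteq> 0" "x' \<in> \<O> N" "x * x' = of_int m"
    using divides_nonzero_int[OF x] .
  have "\<not> is_unit (int q)" using q by auto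
  then obtain m' where m': "m = int q ^ multiplicity (int q) m * m'" "\<not> int q dvd m'"
    by (rule multiplicity_decompose'[OF m(1)])
  define n where "n = multiplicity (int q) m"
  \<comment> \<open>One factor \<open>q\<close> more than \<open>m\<close> has. After cancelling,
    the part \<open>m'\<close> of \<open>m\<close> prime to \<open>q\<close> would lie in
    \<open>Q\<close>.\<close>
  obtain a b where ab: "a \<in> \<O> N" "b \<in> \<O> N - Q" "x * b = of_nat q ^ Suc n * a" using div by blast
  have "of_nat q ^ n * (of_int m' * b) = of_int m * b" by (subst m'(1)) (simp add: n_def)
  also have "\<dots> = x' * (x * b)" unfolding m(3)[symmetric] by (simp add: mult_ac)
  also have "\<dots> = of_nat q ^ n * (of_nat q * (a * x'))" unfolding ab(3) by (simp add: mult_ac)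
  finally have "of_int m' * b = of_nat q * (a * x')" using q_nonzero by simp
  also have "\<dots> \<in> Q" using ab(1) m(2)
    by (intro prime_ideal_mult2[OF prime_S[OF Q] q_mem[OF Q]] int_ring_mult)
  finally have "of_int m' \<in> Q" using prime_ideal_prime[OF prime_S[OF Q] int_ring_of_int, of b m'] ab(2) by blast
  then show False using prime_ideal_of_int_iff[OF prime_S[OF Q] q q_mem[OF Q]] m'(2) by blast
qed

lemma has_val_ex:
  assumes x: "x \<in> N" "x \<noteq> 0"
  shows "\<exists>k. has_val Q k x"
proof -
  obtain m :: int where m: "m \<noteq> 0" "of_int m * x \<in> \<O> N" using common_denominator[OF x(1)] .
  obtain k where k: "has_val Q k (of_int m * x)" using has_val_ex_int[OF m(2)] m(1) x(2) by auto
  obtain l where l: "has_val Q l (of_int m)" using has_val_ex_int[OF int_ring_of_int] m(1) by auto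
  have "has_val Q (- l + k) (inverse (of_int m) * (of_int m * x))"
    by (intro has_val_mult has_val_inverse k l)
  moreover have "inverse (of_int m) * (of_int m * x) = x" using m(1) by simp
  ultimately show ?thesis by metis
qed

lemma val_eqI: "has_val Q k x \<Longrightarrow> val Q x = k"
  unfolding val_def using has_val_unique by (intro the_equality) auto

lemma has_val_val: "x \<in> N \<Longrightarrow> x \<noteq> 0 \<Longrightarrow> has_val Q (val Q x) x" using has_val_ex val_eqI by blast

lemma val_mult: "x \<in> N \<Longrightarrow> x \<noteq> 0 \<Longrightarrow> y \<in> N \<Longrightarrow> y \<noteq> 0 \<Longrightarrow> val Q (x * y) = val Q x + val Q y"
  by (intro val_eqI has_val_mult has_val_val)

lemma val_1: "val Q 1 = 0"
  using prime_ideal_1[OF prime_S[OF Q]] int_ring_1 by (intro val_eqI has_val_unit) auto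

lemma val_q: "val Q (of_nat q) = 1" by (intro val_eqI has_val_q)

lemma val_inverse: "x \<in> N \<Longrightarrow> x \<noteq> 0 \<Longrightarrow> val Q (inverse x) = - val Q x"
  by (intro val_eqI has_val_inverse has_val_val)

lemma val_power: "x \<in> N \<Longrightarrow> x \<noteq> 0 \<Longrightarrow> val Q (x ^ n) = int n * val Q x"
  by (induction n) (auto simp: val_1 val_mult subfield_power[OF subfield] algebra_simps)

lemma val_powi: "x \<in> N \<Longrightarrow> x \<noteq> 0 \<Longrightarrow> val Q (x powi n) = n * val Q x"
  by (auto simp: power_int_def val_power val_inverse subfield_inverse[OF subfield])

lemma val_prod:
  "(\<And>i. i \<in> I \<Longrightarrow> f i \<in> N \<and> f i \<noteq> 0) \<Longrightarrow> val Q (prod f I) = (\<Sum>i\<in>I. val Q (f i))"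
proof (induction I rule: infinite_finite_induct)
  case (insert i I)
  then have "prod f I \<in> N" "prod f I \<noteq> 0" by (auto intro: subfield_prod[OF subfield])
  then show ?case using insert by (simp add: val_mult)
qed (auto simp: val_1)

lemma val_unit: "a \<in> \<O> N - Q \<Longrightarrow> val Q a = 0" by (intro val_eqI has_val_unit)

lemma val_nonneg:
  assumes "x \<in> \<O> N" "x \<noteq> 0"
  shows "val Q x \<ge> 0"
proof (rule ccontr)
  assume neg: "\<not> ?thesis"
  obtain a b where ab: "a \<in> \<O> N - Q" "b \<in> \<O> N - Q" "x * b = of_nat q powi (val Q x) * a"
    using has_val_val[of x] assms int_ring_subset unfolding has_val_def by blast
  have "of_nat q powi (- val Q x) * (x * b) = a"
    unfolding ab(3) mult.assoc[symmetric] using q_nonzero by (simp flip: power_int_add)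
  moreover have "x * b \<in> \<O> N" using assms(1) ab(2) by (auto intro: int_ring_mult)
  then have "of_nat q powi (- val Q x) * (x * b) \<in> Q" using neg by (intro q_powi_mem) auto
  ultimately show False using ab(1) by simp
qed

lemma val_pos:
  assumes "x \<in> Q" "x \<noteq> 0"
  shows "val Q x \<ge> 1"
proof -
  have x: "x \<in> \<O> N" "x \<in> N" using assms prime_ideal_subset[OF prime_S[OF Q]] int_ring_subset by auto
  have "val Q x \<noteq> 0"
  proof
    assume "val Q x = 0"
    then obtain a b where ab: "a \<in> \<O> N - Q" "b \<in> \<O> N - Q" "x * b = a"
      using has_val_val[of x] x assms unfolding has_val_def by auto
    moreover have "x * b \<in> Q" using ab by (intro prime_ideal_mult2[OF prime_S[OF Q] assms(1)]) auto
    ultimately show False by simp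
  qed
  then show ?thesis using val_nonneg[OF x(1) assms(2)] by simp
qed

text \<open>\<open>val Q 0\<close> is unspecified; this predicate treats the value of 0 as
  infinite.\<close>

definition val_ge :: "int \<Rightarrow> complex \<Rightarrow> bool" where
  "val_ge k x \<longleftrightarrow> x = 0 \<or> k \<le> val Q x"

lemma val_ge_add:
  assumes x: "x \<in> N" "val_ge k x" and y: "y \<in> N" "val_ge k y"
  shows "val_ge k (x + y)"
proof (cases "x = 0 \<or> y = 0 \<or> x + y = 0")
  case True
  then show ?thesis using x(2) y(2) by (auto simp: val_ge_def)
next
  case False
  then have "x \<noteq> 0" "y \<noteq> 0" "x + y \<noteq> 0" by auto
  obtain a b where ab: "a \<in> \<O> N - Q" "b \<in> \<O> N - Q" "x * b = of_nat q powi (val Q x) * a"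
    using has_val_val[OF x(1) \<open>x \<noteq> 0\<close>] unfolding has_val_def by blast
  obtain a' b' where ab': "a' \<in> \<O> N - Q" "b' \<in> \<O> N - Q" "y * b' = of_nat q powi (val Q y) * a'"
    using has_val_val[OF y(1) \<open>y \<noteq> 0\<close>] unfolding has_val_def by blast
  define \<pi> where "\<pi> = (of_nat q :: complex)"
  have \<pi>: "\<pi> \<in> \<O> N" "\<pi> \<in> N" "\<pi> \<noteq> 0" unfolding \<pi>_def using q_nonzero int_ring_of_nat int_ring_subset by auto
  \<comment> \<open>Relative to \<open>k\<close> the exponents are natural numbers, so both summands
    become \<open>\<pi> powi k\<close> times an element of \<open>\<O> N\<close>.\<close>
  have kx: "val Q x = k + int (nat (val Q x - k))" and ky: "val Q y = k + int (nat (val Q y - k))"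
    using x(2) y(2) \<open>x \<noteq> 0\<close> \<open>y \<noteq> 0\<close> by (auto simp: val_ge_def)
  have pow: "\<pi> powi (k + int n) = \<pi> powi k * \<pi> ^ n" for n using \<pi> by (simp add: power_int_add)
  define w where "w = \<pi> ^ nat (val Q x - k) * (a * b') + \<pi> ^ nat (val Q y - k) * (a' * b)"
  have w: "w \<in> \<O> N" unfolding w_def using \<pi> ab ab' by (auto intro!: int_ring_add int_ring_mult int_ring_power)
  have "(x + y) * (b * b') = (x * b) * b' + (y * b') * b" by (simp add: algebra_simps)
  also have "\<dots> = \<pi> powi k * w"
    unfolding ab(3) ab'(3) w_def \<pi>_def[symmetric] by (subst kx, subst ky, unfold pow) (simp add: algebra_simps)
  finally have eq: "(x + y) * (b * b') = \<pi> powi k * w" .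
  have bb: "b * b' \<in> \<O> N - Q" using compl_mult ab ab' by blast
  then have bb': "b * b' \<in> N" "b * b' \<noteq> 0" using int_ring_subset S_mem_0 by auto
  have "\<pi> powi k \<in> N" "\<pi> powi k \<noteq> 0"
    using \<pi> by (auto simp: power_int_def intro: subfield_power[OF subfield] subfield_inverse[OF subfield])
  have "w \<noteq> 0" using eq bb'(2) \<open>x + y \<noteq> 0\<close> by auto
  have "val Q (x + y) = val Q ((x + y) * (b * b'))"
    using x y \<open>x + y \<noteq> 0\<close> bb' val_unit[OF bb] by (simp add: val_mult subfield_add[OF subfield])
  also have "\<dots> = k + val Q w"
    unfolding eq using \<open>\<pi> powi k \<in> N\<close> \<open>\<pi> powi k \<noteq> 0\<close> \<open>w \<noteq> 0\<close> w int_ring_subset \<pi> val_q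
    by (subst val_mult) (auto simp: val_powi \<pi>_def)
  finally show ?thesis using val_nonneg[OF w \<open>w \<noteq> 0\<close>] by (simp add: val_ge_def)
qed

lemma val_ge_sum:
  assumes "\<And>i. i \<in> I \<Longrightarrow> f i \<in> N \<and> val_ge k (f i)"
  shows "val_ge k (sum f I)" using assms by (induction I rule: infinite_finite_induct)
    (auto simp: subfield_sum[OF subfield] intro!: val_ge_add, auto simp: val_ge_def)

lemma val_ge_mult: "x \<in> N \<Longrightarrow> y \<in> N \<Longrightarrow> val_ge k x \<Longrightarrow> val_ge l y \<Longrightarrow> val_ge (k + l) (x * y)"
  by (auto simp: val_ge_def val_mult)

lemma val_ge_uminus: "x \<in> N \<Longrightarrow> val_ge k x \<Longrightarrow> val_ge k (- x)"
  using val_ge_mult[of "-1" x 0 k] val_nonneg[of "-1"] int_ring_of_int[of "-1"] int_ring_subset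
  by (auto simp: val_ge_def)

text \<open>Equality in the ultrametric inequality: otherwise \<open>x\<close>, as the difference of
  \<open>x + y\<close> and \<open>y\<close>, would have too large a value.\<close>

lemma val_add_eq:
  assumes x: "x \<in> N" "x \<noteq> 0" and y: "y \<in> N" "val_ge (val Q x + 1) y"
  shows "x + y \<noteq> 0 \<and> val Q (x + y) = val Q x"
proof -
  have "\<not> val_ge (val Q x + 1) (x + y)"
  proof
    assume "val_ge (val Q x + 1) (x + y)"
    from val_ge_add[OF subfield_add[OF subfield x(1) y(1)] this subfield_minus[OF subfield y(1)] val_ge_uminus[OF y]]
    show False using x by (simp add: val_ge_def)
  qed
  moreover have "val_ge (val Q x) (x + y)" using x y by (intro val_ge_add) (auto simp: val_ge_def)
  ultimately show ?thesis by (auto simp: val_ge_def)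
qed

section \<open>Valuations of fractional ideals\<close>

text \<open>The least value on \<open>J\<close>, required to be attained. \<open>J\<close> may be
  any subset of \<open>N\<close>, such as a set of norms, which is in general not closed under
  addition.\<close>

definition ideal_val :: "int \<Rightarrow> complex set \<Rightarrow> bool" where
  "ideal_val k J \<longleftrightarrow> J \<subseteq> N \<and> (\<forall>x\<in>J. val_ge k x) \<and> (\<exists>x\<in>J. x \<noteq> 0 \<and> val Q x = k)"

lemma ideal_valI:
  "J \<subseteq> N \<Longrightarrow> (\<And>x. x \<in> J \<Longrightarrow> x \<noteq> 0 \<Longrightarrow> k \<le> val Q x) \<Longrightarrow> a \<in> J \<Longrightarrow> a \<noteq> 0 \<Longrightarrow> val Q a = k \<Longrightarrow> ideal_val k J"
  unfolding ideal_val_def val_ge_def by blast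

lemma ideal_val_unique: "ideal_val k J \<Longrightarrow> ideal_val l J \<Longrightarrow> k = l"
  unfolding ideal_val_def val_ge_def by (metis order_antisym)

text \<open>The lower bound passes to sums of products, and the product of two minimal elements
  attains it.\<close>

lemma ideal_val_mult:
  assumes I: "ideal_val k I" and J: "ideal_val l J"
  shows "ideal_val (k + l) (ideal_prod CC I J)"
proof -
  have IJ: "I \<subseteq> N" "J \<subseteq> N" using I J by (auto simp: ideal_val_def)
  have "ideal_prod CC I J \<subseteq> {x \<in> N. val_ge (k + l) x}"
  proof (rule ideal_prod_CC_subset)
    show "i * j \<in> {x \<in> N. val_ge (k + l) x}" if "i \<in> I" "j \<in> J" for i j
      using that I J by (auto simp: ideal_val_def intro!: val_ge_mult subfield_mult[OF subfield])
    show "x + y \<in> {x \<in> N. val_ge (k + l) x}" if "x \<in> {x \<in> N. val_ge (k + l) x}" "y \<in> {x \<in> N. val_ge (k + l) x}" for x y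
      using that by (auto intro: val_ge_add subfield_add[OF subfield])
  qed
  moreover obtain x where "x \<in> I" "x \<noteq> 0" "val Q x = k" using I by (auto simp: ideal_val_def)
  moreover obtain y where "y \<in> J" "y \<noteq> 0" "val Q y = l" using J by (auto simp: ideal_val_def)
  moreover have "x * y \<in> ideal_prod CC I J" "x * y \<noteq> 0" "val Q (x * y) = k + l"
    using calculation(2-) IJ by (auto intro!: ideal_prod_CC_mem simp: val_mult subset_iff)
  ultimately show ?thesis unfolding ideal_val_def by blast
qed

text \<open>The common denominator \<open>c\<close> bounds the values from below, and integers
  bounded below have a minimum.\<close>

lemma ideal_val_ex:
  assumes "J \<subseteq> N" "x \<in> J" "x \<noteq> 0" and c: "c \<in> N" "c \<noteq> 0" "\<And>x. x \<in> J \<Longrightarrow> c * x \<in> \<O> N"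
  shows "\<exists>k. ideal_val k J"
proof -
  define m where "m = (LEAST m. \<exists>x\<in>J. x \<noteq> 0 \<and> nat (val Q (c * x)) = m)"
  have "\<exists>m. \<exists>x\<in>J. x \<noteq> 0 \<and> nat (val Q (c * x)) = m" using assms by blast
  then have "\<exists>x\<in>J. x \<noteq> 0 \<and> nat (val Q (c * x)) = m" unfolding m_def by (rule LeastI_ex)
  then obtain y where y: "y \<in> J" "y \<noteq> 0" "nat (val Q (c * y)) = m" by blast
  have least: "m \<le> nat (val Q (c * z))" if "z \<in> J" "z \<noteq> 0" for z
    unfolding m_def using that by (intro Least_le) auto
  have "val Q y \<le> val Q z" if z: "z \<in> J" "z \<noteq> 0" for z
  proof -
    have "0 \<le> val Q (c * y)" "0 \<le> val Q (c * z)" using val_nonneg c y z by auto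
    then have "val Q (c * y) \<le> val Q (c * z)" using least[OF z] y(3) by linarith
    moreover have "y \<in> N" "z \<in> N" using y(1) z(1) assms(1) by auto
    ultimately show ?thesis using c(1,2) y z by (simp add: val_mult)
  qed
  then have "ideal_val (val Q y) J" unfolding ideal_val_def val_ge_def using y assms(1) by blast
  then show ?thesis by blast
qed

lemma ideal_val_subring:
  assumes "A \<subseteq> \<O> N" "1 \<in> A"
  shows "ideal_val 0 A" unfolding ideal_val_def val_ge_def
  using assms int_ring_subset val_nonneg val_1 by (auto intro!: bexI[of _ 1])

lemma ideal_val_principal: "x \<in> N \<Longrightarrow> x \<noteq> 0 \<Longrightarrow> ideal_val (val Q x) (principal N x)"
proof -
  assume x: "x \<in> N" "x \<noteq> 0"
  have "x \<in> principal N x" using imageI[OF int_ring_1, of "\<lambda>a. a * x"] by simp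
  moreover have "y \<in> N \<and> val_ge (val Q x) y" if "y \<in> principal N x" for y
  proof -
    obtain a where a: "a \<in> \<O> N" "y = a * x" using \<open>y \<in> _\<close> by blast
    moreover have "a \<in> N" using a(1) int_ring_subset by blast
    ultimately show ?thesis
      using x val_nonneg[of a] by (auto simp: val_ge_def val_mult intro: subfield_mult[OF subfield])
  qed
  ultimately show ?thesis using x unfolding ideal_val_def by blast
qed

lemma ideal_val_ideal_not_subset:
  assumes "integral_ideal A" "\<not> A \<subseteq> Q"
  shows "ideal_val 0 A"
proof -
  obtain a where "a \<in> A" "a \<notin> Q" using assms(2) by blast
  then show ?thesis using assms(1) int_ring_subset val_nonneg val_unit[of a] S_mem_0
    by (intro ideal_valI[of A 0 a]) (auto simp: ideal_iff)
qed

lemma ideal_val_prime: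
  assumes P: "P \<in> S"
  shows "ideal_val (of_bool (P = Q)) P"
proof (cases "P = Q")
  case True
  then show ?thesis
    using prime_ideal_subset[OF prime_S[OF Q]] int_ring_subset q_mem[OF Q] q_nonzero val_q val_pos
    by (intro ideal_valI[of P _ "of_nat q"]) auto
next
  case False
  then have "\<not> P \<subseteq> Q" using prime_ideal_subset_eq[OF prime_S[OF P] prime_S[OF Q]] by blast
  then show ?thesis
    using False prime_S[OF P] ideal_val_ideal_not_subset unfolding prime_ideal_iff by auto
qed

text \<open>The subfield \<open>M\<close> admits both the primes of \<open>L\<close> and the prime
  \<open>P\<close> of \<open>K\<close>. For negative \<open>k\<close> the inverse has some least
  value because it has a common denominator, and the value 0 of \<open>\<O> M\<close> determines
  it.\<close>

lemma ideal_val_int_pow: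
  assumes M: "number_field M e" "M \<subseteq> N" and J: "J \<in> Units (frac_ideals M)" "ideal_val w J"
  shows "ideal_val (k * w) (J [^]\<^bsub>frac_ideals M\<^esub> k)"
proof -
  interpret M: number_field M e by fact
  interpret H: comm_monoid "frac_ideals M" by (rule M.frac_ideals_comm_monoid)
  have OM: "\<O> M \<subseteq> \<O> N" using M(2) by (auto simp: int_ring_def)
  have one: "ideal_val 0 (\<O> M)" using OM M.int_ring_1 by (rule ideal_val_subring)
  have nat: "ideal_val (int n * w) (J [^]\<^bsub>frac_ideals M\<^esub> n)" for n :: nat
  proof (induction n)
    case (Suc n)
    from ideal_val_mult[OF Suc J(2)] show ?case by (simp add: algebra_simps)
  qed (simp add: one)
  have pow_Units: "J [^]\<^bsub>frac_ideals M\<^esub> n \<in> Units (frac_ideals M)" for n :: nat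
    using J(1) by (rule H.Units_nat_pow)
  show ?thesis
  proof (cases "k < 0")
    case False
    then have "int (nat k) = k" "J [^]\<^bsub>frac_ideals M\<^esub> k = J [^]\<^bsub>frac_ideals M\<^esub> nat k"
      by (auto intro: int_pow_nonneg)
    then show ?thesis using nat[of "nat k"] by (simp only:)
  next
    case True
    define A where "A = J [^]\<^bsub>frac_ideals M\<^esub> nat (- k)"
    define B where "B = inv\<^bsub>frac_ideals M\<^esub> A"
    have A: "A \<in> Units (frac_ideals M)" "ideal_val (- k * w) A"
      using pow_Units[of "nat (- k)"] nat[of "nat (- k)"] True unfolding A_def[symmetric] by auto
    have B: "B \<in> carrier (frac_ideals M)" "ideal_prod CC A B = \<O> M"
      unfolding B_def using A(1) H.Units_r_inv[of A] by auto
    obtain c where c: "c \<in> \<O> M" "c \<noteq> 0" "\<And>x. x \<in> B \<Longrightarrow> c * x \<in> \<O> M"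
      using B(1) unfolding M.frac_ideal_iff by blast
    have "B \<subseteq> N" using B(1) M.frac_ideal_subset M(2) by blast
    moreover obtain x where "x \<in> B" "x \<noteq> 0" using M.frac_ideal_nonzero[OF B(1)] by blast
    ultimately obtain v where v: "ideal_val v B"
      using ideal_val_ex[of B x c] c OM int_ring_subset by (metis subsetD)
    have "ideal_val (- k * w + v) (\<O> M)" using ideal_val_mult[OF A(2) v] B(2) by simp
    then have "v = k * w" using ideal_val_unique[OF one] by fastforce
    then show ?thesis using v unfolding B_def A_def int_pow_neg_eq_inv[OF True] by simp
  qed
qed

lemma ideal_val_finprod:
  assumes "finite T" "\<And>P. P \<in> T \<Longrightarrow> f P \<in> carrier (frac_ideals N) \<and> ideal_val (w P) (f P)"
  shows "ideal_val (\<Sum>P\<in>T. w P) (\<Otimes>\<^bsub>frac_ideals N\<^esub>P\<in>T. f P)" using assms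
proof (induction T rule: finite_induct)
  case empty
  then show ?case using ideal_val_subring[of "\<O> N"] int_ring_1 by simp
next
  case (insert P T)
  have "(\<Otimes>\<^bsub>frac_ideals N\<^esub>P\<in>insert P T. f P) = ideal_prod CC (f P) (\<Otimes>\<^bsub>frac_ideals N\<^esub>P\<in>T. f P)"
    using G.finprod_insert[of T P f] insert by auto
  then show ?case using ideal_val_mult[of "w P" "f P"] insert by simp
qed

end

section \<open>Exponents in principal ideals and the part of an ideal above \<open>q\<close>\<close>

lemma principal_mult: "ideal_prod CC (principal N x) (principal N y) = principal N (x * y)"
proof
  show "ideal_prod CC (principal N x) (principal N y) \<subseteq> principal N (x * y)"
  proof (rule ideal_prod_CC_subset)
    fix i j assume "i \<in> principal N x" "j \<in> principal N y"
    then obtain a b where "a \<in> \<O> N" "b \<in> \<O> N" "i = a * x" "j = b * y" by blast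
    then show "i * j \<in> principal N (x * y)" by (intro image_eqI[of _ _ "a * b"]) (auto intro: int_ring_mult)
  next
    fix s t assume "s \<in> principal N (x * y)" "t \<in> principal N (x * y)"
    then obtain a b where "a \<in> \<O> N" "b \<in> \<O> N" "s = a * (x * y)" "t = b * (x * y)" by blast
    then show "s + t \<in> principal N (x * y)"
      by (intro image_eqI[of _ _ "a + b"]) (auto intro: int_ring_add simp: algebra_simps)
  qed
  show "principal N (x * y) \<subseteq> ideal_prod CC (principal N x) (principal N y)"
  proof
    fix s assume "s \<in> principal N (x * y)"
    then obtain a where a: "a \<in> \<O> N" "s = a * (x * y)" by blast
    have "(a * x) * (1 * y) \<in> ideal_prod CC (principal N x) (principal N y)"
      using a(1) int_ring_1 by (intro ideal_prod_CC_mem imageI)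
    then show "s \<in> ideal_prod CC (principal N x) (principal N y)" using a(2) by (simp add: mult_ac)
  qed
qed

lemma principal_pow: "principal N (x ^ n) = principal N x \<up> (n :: nat)"
proof (induction n)
  case (Suc n)
  have "principal N (x ^ Suc n) = ideal_prod CC (principal N (x ^ n)) (principal N x)"
    unfolding principal_mult by (simp add: mult.commute)
  then show ?case using Suc by simp
qed simp

lemma int_pow_carrier:
  assumes "P \<in> S"
  shows "P \<up> (k :: int) \<in> carrier (frac_ideals N)"
proof -
  have "P \<up> n \<in> Units (frac_ideals N)" for n :: nat
    using S_Units[OF assms] by (rule G.Units_nat_pow)
  then show ?thesis unfolding int_pow_def2 by (auto intro: G.Units_closed simp del: pow_nat)
qed

text \<open>With \<open>C\<close> the product of the other primes, \<open>Q \<odot> C\<close> is the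
  principal ideal of \<open>q\<close>. Hence in the equation defining the value each power of
  \<open>q\<close> splits into a power of \<open>Q\<close> and an ideal not contained in
  \<open>Q\<close>, which gives existence. Uniqueness follows by comparing least values at
  \<open>Q\<close>.\<close>

lemma ideal_exponent_eq_val:
  assumes Q: "Q \<in> S" and x: "x \<in> N" "x \<noteq> 0"
  shows "ideal_exponent N Q (principal N x) = val Q x" unfolding ideal_exponent_def
proof (rule the_equality)
  have QU: "Q \<in> Units (frac_ideals N)" and Qc: "Q \<in> carrier (frac_ideals N)"
    using Q S_Units S_carrier by auto
  define C where "C = prime_prod (S - {Q})"
  have Cc: "C \<in> carrier (frac_ideals N)"
    unfolding C_def using S_carrier by (intro G.finprod_closed) auto
  have CO: "C \<subseteq> \<O> N" unfolding C_def by (rule finprod_S_subset_int_ring) auto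
  obtain c where c: "c \<in> \<O> N - Q" "c \<in> C" using complementary_element[OF Q] unfolding C_def by metis
  have QC: "Q \<odot> C = principal N (of_nat q)"
    using finprod_S_insert[OF Q, of "S - {Q}"] Q unfolding factorisation C_def by (simp add: insert_absorb)
  have CnO: "C \<up> n \<subseteq> \<O> N \<and> c ^ n \<in> C \<up> n" for n :: nat
  proof (induction n)
    case (Suc n)
    have "ideal_prod CC (C \<up> n) C \<subseteq> \<O> N"
      using Suc CO by (intro ideal_prod_CC_subset) (auto intro: int_ring_mult int_ring_add)
    moreover have "c ^ n * c \<in> ideal_prod CC (C \<up> n) C"
      using Suc c by (intro ideal_prod_CC_mem) auto
    ultimately show ?case by (simp add: mult.commute)
  qed (auto intro: int_ring_1)
  \<comment> \<open>The ideals A and B will have this form. They are not contained in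
    \<open>Q\<close> because \<open>c ^ n * a\<close> is a product of elements outside
    \<open>Q\<close>.\<close>
  have C_times_ideal: "integral_ideal (C \<up> n \<odot> principal N a) \<and>
      \<not> C \<up> n \<odot> principal N a \<subseteq> Q \<and> principal N a \<in> carrier (frac_ideals N)"
    if a: "a \<in> \<O> N - Q" for a and n :: nat
  proof (intro conjI)
    have "a \<noteq> 0" "a \<in> N" using a S_mem_0[OF Q] int_ring_subset by auto
    then show pa: "principal N a \<in> carrier (frac_ideals N)" by (intro principal_frac_ideal)
    have "C \<up> n \<odot> principal N a \<in> carrier (frac_ideals N)"
      using Cc pa by (intro G.m_closed G.nat_pow_closed)
    moreover have "C \<up> n \<odot> principal N a \<subseteq> \<O> N" unfolding frac_ideals_simps using CnO[of n] a
      by (intro ideal_prod_CC_subset) (auto intro!: int_ring_mult intro: int_ring_add)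
    ultimately show "integral_ideal (C \<up> n \<odot> principal N a)"
      unfolding frac_ideal_iff ideal_iff by blast
    have "c ^ n * (1 * a) \<in> C \<up> n \<odot> principal N a"
      unfolding frac_ideals_simps using CnO int_ring_1 by (intro ideal_prod_CC_mem imageI) auto
    moreover have "c ^ n * (1 * a) \<in> \<O> N - Q"
      using compl_mult[OF Q prime_ideal_power[OF prime_S[OF Q] c(1)] a] by simp
    ultimately show "\<not> C \<up> n \<odot> principal N a \<subseteq> Q" by blast
  qed
  have qn: "principal N (of_nat q ^ n) = Q \<up> n \<odot> C \<up> n" for n :: nat
    unfolding principal_pow QC[symmetric] using Qc Cc by (intro G.nat_pow_distrib)
  obtain a b where ab: "a \<in> \<O> N - Q" "b \<in> \<O> N - Q" "x * b = of_nat q powi (val Q x) * a"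
    using has_val_val[OF Q x] unfolding has_val_def by blast
  have px: "principal N x \<in> carrier (frac_ideals N)" using x by (rule principal_frac_ideal)
  have pa: "principal N a \<in> carrier (frac_ideals N)" and pb: "principal N b \<in> carrier (frac_ideals N)"
    using C_times_ideal ab by auto
  \<comment> \<open>Positive and negative part of the value; with them all powers of
    \<open>q\<close> and of \<open>C\<close> have natural exponents.\<close>
  define n m where "n = nat (val Q x)" and "m = nat (- val Q x)"
  show "\<exists>A B. integral_ideal A \<and> \<not> A \<subseteq> Q \<and> integral_ideal B \<and> \<not> B \<subseteq> Q \<and>
      principal N x \<odot> B = (Q \<up> val Q x) \<odot> A"
  proof (intro exI conjI)
    define Qm Qv where "Qm = Q \<up> m" and "Qv = Q \<up> val Q x"
    have QmU: "Qm \<in> Units (frac_ideals N)" unfolding Qm_def using QU by (rule G.Units_nat_pow)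
    have Qvc: "Qv \<in> carrier (frac_ideals N)" unfolding Qv_def using Q by (rule int_pow_carrier)
    have Qv: "Qm \<odot> Qv = Q \<up> n"
    proof (cases "val Q x < 0")
      case True
      then show ?thesis using G.Units_r_inv[OF QmU] unfolding Qm_def Qv_def n_def m_def
        by (simp only: int_pow_neg_eq_inv nat_pow_0) simp
    next
      case False
      then have "val Q x \<ge> 0" "m = 0" by (auto simp: m_def)
      then show ?thesis using Qvc unfolding Qm_def Qv_def n_def by (simp only: int_pow_nonneg nat_pow_0 G.l_one)
    qed
    have Cc': "C \<up> k \<in> carrier (frac_ideals N)" for k :: nat using Cc by (rule G.nat_pow_closed)
    have "of_nat q ^ m * (x * b) = of_nat q ^ n * a"
      unfolding ab(3) n_def m_def using q_nonzero by (simp add: power_int_def field_simps)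
    then have "principal N (of_nat q ^ m) \<odot> (principal N x \<odot> principal N b) = principal N (of_nat q ^ n) \<odot> principal N a"
      by (simp add: principal_mult)
    then have "Qm \<odot> (principal N x \<odot> (C \<up> m \<odot> principal N b)) = Q \<up> n \<odot> (C \<up> n \<odot> principal N a)"
      unfolding qn Qm_def using Qc Cc' px pa pb by (simp add: G.m_ac G.nat_pow_closed del: frac_ideals_simps)
    also have "\<dots> = Qm \<odot> (Qv \<odot> (C \<up> n \<odot> principal N a))"
      unfolding Qv[symmetric] using QmU Qvc Cc' pa by (simp add: G.m_assoc G.Units_closed del: frac_ideals_simps)
    \<comment> \<open>The invertible factor \<open>Qm\<close> is cancelled.\<close>
    finally show "principal N x \<odot> (C \<up> m \<odot> principal N b) = (Q \<up> val Q x) \<odot> (C \<up> n \<odot> principal N a)"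
      using QmU Qvc Cc' px pa pb unfolding Qv_def[symmetric] by (simp del: frac_ideals_simps)
  qed (use C_times_ideal[OF ab(1)] C_times_ideal[OF ab(2)] in blast)+
  fix k :: int
  assume "\<exists>A B. integral_ideal A \<and> \<not> A \<subseteq> Q \<and> integral_ideal B \<and> \<not> B \<subseteq> Q \<and>
      principal N x \<odot> B = (Q \<up> k) \<odot> A"
  then obtain A B where A: "integral_ideal A" "\<not> A \<subseteq> Q"
    and B: "integral_ideal B" "\<not> B \<subseteq> Q"
    and eq: "ideal_prod CC (principal N x) B = ideal_prod CC (Q \<up> k) A" by auto
  have "ideal_val Q 1 Q" using ideal_val_prime[OF Q Q] by simp
  then have "ideal_val Q k (Q \<up> k)"
    using ideal_val_int_pow[OF Q number_field_axioms order.refl QU, of 1 k] by simp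
  from ideal_val_mult[OF Q this ideal_val_ideal_not_subset[OF Q A]]
  have "ideal_val Q k (ideal_prod CC (principal N x) B)" using eq by simp
  with ideal_val_mult[OF Q ideal_val_principal[OF Q x] ideal_val_ideal_not_subset[OF Q B]]
  show "k = val Q x" using ideal_val_unique[OF Q] by fastforce
qed

lemma J_part_carrier:
  "J_part N q x \<in> carrier (frac_ideals N)"
  unfolding J_part_def primes_above_eq using int_pow_carrier by (intro G.finprod_closed) auto

text \<open>Among the factors of the product only the power of \<open>Q\<close> itself can have a
  nonzero value at \<open>Q\<close>.\<close>

lemma J_part_ideal_val:
  assumes Q: "Q \<in> S" and x: "x \<in> N" "x \<noteq> 0"
  shows "ideal_val Q (val Q x) (J_part N q x)"
proof -
  have "ideal_val Q (\<Sum>P\<in>S. ideal_exponent N P (principal N x) * of_bool (P = Q)) (J_part N q x)"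
    unfolding J_part_def primes_above_eq
  proof (rule ideal_val_finprod[OF Q finite_S], intro conjI)
    fix P assume P: "P \<in> S"
    show "P \<up> ideal_exponent N P (principal N x) \<in> carrier (frac_ideals N)"
      using P by (rule int_pow_carrier)
    show "ideal_val Q (ideal_exponent N P (principal N x) * of_bool (P = Q))
        (P \<up> ideal_exponent N P (principal N x))"
      by (rule ideal_val_int_pow[OF Q number_field_axioms order.refl S_Units[OF P] ideal_val_prime[OF Q P]])
  qed
  also have "(\<Sum>P\<in>S. ideal_exponent N P (principal N x) * of_bool (P = Q)) = val Q x"
    using finite_S Q ideal_exponent_eq_val[OF Q x] by (simp add: of_bool_def if_distrib cong: if_cong)
  finally show ?thesis .
qed

text \<open>One element has to attain the least value at all primes of \<open>S\<close> at once,
  because the value of a norm at one prime is a sum of values at several. Local minimisers are added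
  with weights that are units at their own prime and lie in all other primes of
  \<open>S\<close>.\<close>

lemma J_part_generic_element:
  assumes x: "x \<in> N" "x \<noteq> 0"
  obtains a where "a \<in> J_part N q x" "a \<noteq> 0" "\<And>Q. Q \<in> S \<Longrightarrow> val Q a = val Q x"
proof -
  have "\<exists>c. c \<in> \<O> N - Q \<and> (\<forall>P\<in>S. P \<noteq> Q \<longrightarrow> c \<in> P)" if "Q \<in> S" for Q
    using complementary_element[OF that] by metis
  then obtain c where c: "\<And>Q. Q \<in> S \<Longrightarrow> c Q \<in> \<O> N - Q" "\<And>Q P. Q \<in> S \<Longrightarrow> P \<in> S \<Longrightarrow> P \<noteq> Q \<Longrightarrow> c Q \<in> P"
    by metis
  have "\<exists>e. e \<in> J_part N q x \<and> e \<noteq> 0 \<and> val Q e = val Q x" if "Q \<in> S" for Q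
    using J_part_ideal_val[OF that x] that unfolding ideal_val_def[OF that] by blast
  then obtain e where e: "\<And>Q. Q \<in> S \<Longrightarrow> e Q \<in> J_part N q x \<and> e Q \<noteq> 0 \<and> val Q (e Q) = val Q x" by metis
  note J = J_part_carrier[of x, unfolded frac_ideal_iff]
  have eN: "e Q \<in> N" if "Q \<in> S" for Q using e[OF that] J by blast
  have cN: "c Q \<in> N" if "Q \<in> S" for Q using c(1)[OF that] int_ring_subset by blast
  define a where "a = (\<Sum>Q\<in>S. c Q * e Q)"
  have sum_J: "sum f T \<in> J_part N q x" if "\<And>i. i \<in> T \<Longrightarrow> f i \<in> J_part N q x" for f and T :: "complex set set"
    using that J by (induction T rule: infinite_finite_induct) auto
  have "a \<in> J_part N q x" unfolding a_def using J c e by (intro sum_J) auto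
  moreover have val_a: "a \<noteq> 0 \<and> val Q a = val Q x" if Q: "Q \<in> S" for Q
  proof -
    have c0: "c Q \<noteq> 0" using c(1)[OF Q] S_mem_0[OF Q] by auto
    have v: "val Q (c Q * e Q) = val Q x"
      using e[OF Q] val_unit[OF Q c(1)[OF Q]] eN[OF Q] cN[OF Q] c0 by (simp add: val_mult[OF Q])
    \<comment> \<open>Every summand other than the one for \<open>Q\<close> gains at least 1 at
      \<open>Q\<close>, since its weight \<open>c P\<close> lies in \<open>Q\<close>.\<close>
    have "val_ge Q (val Q (c Q * e Q) + 1) (\<Sum>P\<in>S - {Q}. c P * e P)"
    proof (rule val_ge_sum[OF Q], intro conjI)
      fix P assume P: "P \<in> S - {Q}"
      then show "c P * e P \<in> N" using cN eN by (intro subfield_mult[OF subfield]) auto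
      have "val_ge Q 1 (c P)"
        using c(2)[of P Q] P Q val_pos[OF Q, of "c P"] unfolding val_ge_def[OF Q] by auto
      moreover have "val_ge Q (val Q x) (e P)"
        using J_part_ideal_val[OF Q x] e[of P] P unfolding ideal_val_def[OF Q] by blast
      ultimately have "val_ge Q (1 + val Q x) (c P * e P)" using P cN eN by (intro val_ge_mult[OF Q]) auto
      then show "val_ge Q (val Q (c Q * e Q) + 1) (c P * e P)" unfolding v by (simp add: add.commute)
    qed
    moreover have "(\<Sum>P\<in>S - {Q}. c P * e P) \<in> N"
      using cN eN by (intro subfield_sum[OF subfield] subfield_mult[OF subfield]) auto
    moreover have "a = c Q * e Q + (\<Sum>P\<in>S - {Q}. c P * e P)"
      unfolding a_def using finite_S Q by (intro sum.remove)
    ultimately show ?thesis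
      using val_add_eq[OF Q, of "c Q * e Q"] v e[OF Q] c0 cN[OF Q] eN[OF Q] subfield_mult[OF subfield] by auto
  qed
  moreover obtain Q where "Q \<in> S" using S_nonempty by blast
  ultimately show ?thesis using that by blast
qed

text \<open>\<open>P\<close> is the preimage of \<open>Q\<close>; it contains \<open>q\<close>,
  which \<open>\<sigma>\<close> fixes, and so belongs to \<open>S\<close>. As the uniformizer is
  fixed too, the representation of \<open>x\<close> at \<open>P\<close> is carried to one of
  \<open>\<sigma> x\<close> at \<open>Q\<close>.\<close>

lemma val_automorphism:
  assumes \<sigma>: "subfield_hom N \<sigma>" "\<sigma> ` N = N" and Q: "Q \<in> S"
  obtains P where "P \<in> S" "\<And>x. x \<in> N \<Longrightarrow> x \<noteq> 0 \<Longrightarrow> val Q (\<sigma> x) = val P x"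
proof -
  define P where "P = {x \<in> \<O> N. \<sigma> x \<in> Q}"
  note hom = subfield_hom_1[OF subfield \<sigma>(1)] subfield_hom_0[OF subfield \<sigma>(1)] subfield_hom_add[OF subfield \<sigma>(1)]
    subfield_hom_mult[OF subfield \<sigma>(1)] subfield_hom_of_nat[OF subfield \<sigma>(1)]
  have ON: "x \<in> N" if "x \<in> \<O> N" for x using that int_ring_subset by blast
  have \<sigma>O: "\<sigma> x \<in> \<O> N" if "x \<in> \<O> N" for x
    using that subfield_hom_algebraic_int[OF subfield \<sigma>(1), of x] \<sigma>(2) by (auto simp: int_ring_def)
  have "integral_ideal P" unfolding ideal_iff P_def
    using hom ON \<sigma>O int_ring_closed prime_ideal_0[OF prime_S[OF Q]] prime_ideal_add[OF prime_S[OF Q]]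
      prime_ideal_mult[OF prime_S[OF Q]] by auto
  moreover have qP: "of_nat q \<in> P" unfolding P_def using hom q_mem[OF Q] int_ring_of_nat by simp
  moreover have "1 \<notin> P" unfolding P_def using hom prime_ideal_1[OF prime_S[OF Q]] by simp
  moreover have "a \<in> P \<or> b \<in> P" if "a \<in> \<O> N" "b \<in> \<O> N" "a * b \<in> P" for a b
    using that prime_ideal_prime[OF prime_S[OF Q] \<sigma>O[of a] \<sigma>O[of b]] hom(4)[OF ON ON, of a b] by (auto simp: P_def)
  ultimately have "prime_ideal N P" unfolding prime_ideal_iff using q_nonzero by blast
  then have P: "P \<in> S" using qP primes_above_eq unfolding primes_above_def by blast
  have "val Q (\<sigma> x) = val P x" if x: "x \<in> N" "x \<noteq> 0" for x
  proof (rule val_eqI[OF Q])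
    obtain a b where ab: "a \<in> \<O> N - P" "b \<in> \<O> N - P" "x * b = of_nat q powi (val P x) * a"
      using has_val_val[OF P x] unfolding has_val_def by blast
    have "\<sigma> (of_nat q powi (val P x)) = of_nat q powi (val P x)"
      by (intro subfield_hom_Rats[OF subfield \<sigma>(1)]) (auto simp: power_int_def)
    moreover have "of_nat q powi (val P x) \<in> N"
      using subfield_of_nat[OF subfield] by (auto simp: power_int_def intro!: subfield_power[OF subfield] subfield_inverse[OF subfield])
    moreover have "a \<in> N" "b \<in> N" using ab ON by auto
    ultimately have eq: "\<sigma> x * \<sigma> b = of_nat q powi (val P x) * \<sigma> a"
      using arg_cong[OF ab(3), of \<sigma>] x(1) by (simp only: hom(4))
    have "\<sigma> a \<in> \<O> N - Q" "\<sigma> b \<in> \<O> N - Q" using ab(1,2) \<sigma>O by (auto simp: P_def)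
    with eq show "has_val Q (val P x) (\<sigma> x)" unfolding has_val_def by blast
  qed
  with P show ?thesis by (rule that)
qed

end

section \<open>Automorphisms and embeddings\<close>

lemma embeddings_iff:
  "\<sigma> \<in> embeddings E F \<longleftrightarrow> \<sigma> \<in> extensional E \<and> subfield_hom E \<sigma> \<and> (\<forall>a\<in>F. \<sigma> a = a)"
  by (auto simp: embeddings_def subfield_hom_iff)

lemma Gal_iff:
  "\<sigma> \<in> carrier (Gal E F) \<longleftrightarrow> \<sigma> \<in> extensional E \<and> \<sigma> ` E = E \<and> inj_on \<sigma> E \<and> subfield_hom E \<sigma> \<and> (\<forall>a\<in>F. \<sigma> a = a)"
  by (auto simp: Gal_def subfield_hom_iff Bij_def bij_betw_def)

lemma Gal_iff_embeddings:
  assumes "subfield E CC"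
  shows "\<sigma> \<in> carrier (Gal E F) \<longleftrightarrow> \<sigma> \<in> embeddings E F \<and> \<sigma> ` E = E"
  unfolding Gal_iff embeddings_iff using subfield_hom_inj[OF assms] by auto

lemma Gal_mult_apply:
  "\<sigma> \<in> carrier (Gal E F) \<Longrightarrow> \<tau> \<in> carrier (Gal E F) \<Longrightarrow> x \<in> E \<Longrightarrow> (\<sigma> \<otimes>\<^bsub>Gal E F\<^esub> \<tau>) x = \<sigma> (\<tau> x)"
  by (auto simp: Gal_def BijGroup_def compose_def)

lemma Gal_one_apply: "x \<in> E \<Longrightarrow> \<one>\<^bsub>Gal E F\<^esub> x = x" by (simp add: Gal_def BijGroup_def)

lemma group_Gal:
  assumes E: "subfield E CC" and FE: "F \<subseteq> E"
  shows "group (Gal E F)"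
proof -
  interpret B: group "BijGroup E" by (rule group_BijGroup)
  have carrier: "carrier (BijGroup E) = Bij E" by (simp add: BijGroup_def)
  have Gal_Bij: "carrier (Gal E F) \<subseteq> Bij E" by (auto simp: Gal_def)
  have GalI: "f \<in> carrier (Gal E F)" if "f \<in> Bij E" "subfield_hom E f" "\<And>a. a \<in> F \<Longrightarrow> f a = a" for f
    using that unfolding Gal_iff by (auto simp: Bij_def bij_betw_def)
  have "subgroup (carrier (Gal E F)) (BijGroup E)"
  proof
    show "carrier (Gal E F) \<subseteq> carrier (BijGroup E)" using Gal_Bij carrier by simp
    show "\<one>\<^bsub>BijGroup E\<^esub> \<in> carrier (Gal E F)"
      by (rule GalI) (use FE in \<open>auto simp: BijGroup_def id_Bij subfield_hom_def subfield_closed[OF E]\<close>)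
  next
    fix f g assume f: "f \<in> carrier (Gal E F)" and g: "g \<in> carrier (Gal E F)"
    have fg: "f \<otimes>\<^bsub>BijGroup E\<^esub> g = compose E f g" using f g Gal_Bij by (auto simp: BijGroup_def)
    have gE: "g x \<in> E" if "x \<in> E" for x using g that unfolding Gal_iff by blast
    show "f \<otimes>\<^bsub>BijGroup E\<^esub> g \<in> carrier (Gal E F)" unfolding fg
    proof (rule GalI)
      show "compose E f g \<in> Bij E" using f g Gal_Bij by (intro compose_Bij) auto
      show "subfield_hom E (compose E f g)"
        using f g gE unfolding Gal_iff subfield_hom_def by (simp add: compose_def subfield_closed[OF E])
      show "compose E f g a = a" if "a \<in> F" for a
        using that f g FE unfolding Gal_iff by (auto simp: compose_def)
    qed
  next
    fix f assume f: "f \<in> carrier (Gal E F)"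
    then have fB: "f \<in> Bij E" using Gal_Bij by auto
    have inv: "inv\<^bsub>BijGroup E\<^esub> f = (\<lambda>x\<in>E. inv_into E f x)" using fB by (rule inv_BijGroup)
    have fE: "f ` E = E" "inj_on f E" "subfield_hom E f" and fF: "\<And>a. a \<in> F \<Longrightarrow> f a = a"
      using f unfolding Gal_iff by auto
    have iE: "inv_into E f x \<in> E" "f (inv_into E f x) = x" if "x \<in> E" for x
      using that fE inv_into_into[of x f E] f_inv_into_f[of x f E] by auto
    have ieq: "inv_into E f y = x" if "x \<in> E" "f x = y" for x y using that fE(2) by auto
    show "inv\<^bsub>BijGroup E\<^esub> f \<in> carrier (Gal E F)" unfolding inv
    proof (rule GalI)
      show "(\<lambda>x\<in>E. inv_into E f x) \<in> Bij E" using fB by (rule restrict_inv_into_Bij)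
      have "inv_into E f 1 = 1" using subfield_hom_1[OF E fE(3)] subfield_1[OF E] by (intro ieq)
      moreover have "inv_into E f (x + y) = inv_into E f x + inv_into E f y"
        "inv_into E f (x * y) = inv_into E f x * inv_into E f y" if "x \<in> E" "y \<in> E" for x y
        using that iE by (auto intro!: ieq simp: subfield_closed[OF E] subfield_hom_add[OF E fE(3)] subfield_hom_mult[OF E fE(3)])
      ultimately show "subfield_hom E (\<lambda>x\<in>E. inv_into E f x)"
        unfolding subfield_hom_def by (simp add: subfield_closed[OF E])
      show "(\<lambda>x\<in>E. inv_into E f x) a = a" if "a \<in> F" for a using that FE ieq[of a a] fF by auto
    qed
  qed
  moreover have "BijGroup E\<lparr>carrier := carrier (Gal E F)\<rparr> = Gal E F" by (simp add: Gal_def)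
  ultimately show ?thesis using subgroup.subgroup_is_group[OF _ group_BijGroup] by metis
qed

text \<open>Dedekind's independence of characters: the relation at \<open>x * y\<close> minus
  \<open>\<tau> y\<close> times the relation at \<open>x\<close> no longer contains
  \<open>\<tau>\<close>. Extensionality provides a \<open>y\<close> in \<open>E\<close> at which two
  different homomorphisms differ.\<close>

lemma subfield_homs_independent:
  assumes E: "subfield E CC" and "finite T"
    and "\<And>\<sigma>. \<sigma> \<in> T \<Longrightarrow> \<sigma> \<in> extensional E \<and> subfield_hom E \<sigma>"
    and "\<And>x. x \<in> E \<Longrightarrow> (\<Sum>\<sigma>\<in>T. c \<sigma> * \<sigma> x) = 0"
  shows "\<forall>\<sigma>\<in>T. c \<sigma> = 0" using assms(2-)
proof (induction T arbitrary: c rule: finite_induct)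
  case (insert \<tau> T)
  have hom: "\<sigma> 1 = 1" "\<sigma> (x * y) = \<sigma> x * \<sigma> y" if "\<sigma> \<in> insert \<tau> T" "x \<in> E" "y \<in> E" for \<sigma> x y
    using insert.prems(1)[OF that(1)] that(2,3) by (auto simp: subfield_hom_def)
  have diff: "\<forall>\<sigma>\<in>T. c \<sigma> * (\<sigma> y - \<tau> y) = 0" if y: "y \<in> E" for y
  proof (rule insert.IH)
    show "\<sigma> \<in> extensional E \<and> subfield_hom E \<sigma>" if "\<sigma> \<in> T" for \<sigma> using that insert.prems(1) by simp
    fix x assume x: "x \<in> E"
    have 1: "(\<Sum>\<sigma>\<in>insert \<tau> T. c \<sigma> * \<sigma> (x * y)) = 0"
      using insert.prems(2)[OF subfield_mult[OF E x y]] .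
    have 2: "\<tau> y * (\<Sum>\<sigma>\<in>insert \<tau> T. c \<sigma> * \<sigma> x) = 0" using insert.prems(2)[OF x] by simp
    have "(\<Sum>\<sigma>\<in>T. c \<sigma> * (\<sigma> y - \<tau> y) * \<sigma> x) = (\<Sum>\<sigma>\<in>T. c \<sigma> * \<sigma> (x * y)) - (\<Sum>\<sigma>\<in>T. \<tau> y * (c \<sigma> * \<sigma> x))"
      unfolding sum_subtractf[symmetric]
      using hom(2)[OF _ x y] by (intro sum.cong) (auto simp: algebra_simps)
    also have "(\<Sum>\<sigma>\<in>T. c \<sigma> * \<sigma> (x * y)) = - (c \<tau> * (\<tau> x * \<tau> y))"
      using 1 insert.hyps hom(2)[OF insertI1 x y] by (simp add: eq_neg_iff_add_eq_0 add.commute)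
    also have "(\<Sum>\<sigma>\<in>T. \<tau> y * (c \<sigma> * \<sigma> x)) = - (c \<tau> * (\<tau> x * \<tau> y))"
      using 2 insert.hyps by (simp add: sum_distrib_left eq_neg_iff_add_eq_0 algebra_simps)
    finally show "(\<Sum>\<sigma>\<in>T. c \<sigma> * (\<sigma> y - \<tau> y) * \<sigma> x) = 0" by simp
  qed
  have T0: "c \<sigma> = 0" if \<sigma>: "\<sigma> \<in> T" for \<sigma>
  proof (rule ccontr)
    assume "c \<sigma> \<noteq> 0"
    then have "\<sigma> y = \<tau> y" if "y \<in> E" for y using diff[OF that] \<sigma> by auto
    moreover have "\<sigma> \<in> extensional E" "\<tau> \<in> extensional E" using insert.prems(1) \<sigma> by auto
    ultimately have "\<sigma> = \<tau>" by (intro extensionalityI[of _ E])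
    then show False using insert.hyps \<sigma> by simp
  qed
  moreover have "c \<tau> = 0"
    using insert.prems(2)[OF subfield_1[OF E]] insert.hyps T0 hom(1)[OF insertI1] subfield_1[OF E] by simp
  ultimately show ?case by simp
qed simp

text \<open>More than \<open>d\<close> embeddings would satisfy a nontrivial linear relation on
  \<open>d\<close> spanning elements, hence on all of \<open>E\<close>, against
  independence.\<close>

lemma card_embeddings_le:
  assumes E: "subfield E CC" and dim: "ring.dimension CC d \<rat> E"
  shows "finite (embeddings E \<rat>) \<and> card (embeddings E \<rat>) \<le> d"
proof (rule finite_if_finite_subsets_card_bdd)
  obtain u where u: "\<And>i. i < d \<Longrightarrow> u i \<in> E"
    and span: "\<And>x. x \<in> E \<Longrightarrow> \<exists>c. (\<forall>i<d. c i \<in> \<rat>) \<and> x = (\<Sum>i<d. c i * u i)"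
    and "\<And>c. \<forall>i<d. c i \<in> \<rat> \<Longrightarrow> (\<Sum>i<d. c i * u i) = 0 \<Longrightarrow> \<forall>i<d. c i = 0"
    by (rule dimension_basis[OF subfield_Rats dim]) (rule that)
  fix T assume T: "T \<subseteq> embeddings E \<rat>" "finite T"
  show "card T \<le> d"
  proof (rule ccontr)
    assume "\<not> card T \<le> d"
    then obtain c where c: "\<exists>\<sigma>\<in>T. c \<sigma> \<noteq> 0" "\<And>i. i < d \<Longrightarrow> (\<Sum>\<sigma>\<in>T. \<sigma> (u i) * c \<sigma>) = 0"
      using homogeneous_system_solution[OF subfield_UNIV finite_lessThan[of d] T(2), of "\<lambda>i \<sigma>. \<sigma> (u i)"] by auto
    have "(\<Sum>\<sigma>\<in>T. c \<sigma> * \<sigma> x) = 0" if x: "x \<in> E" for x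
    proof -
      obtain r where r: "\<And>i. i < d \<Longrightarrow> r i \<in> \<rat>" "x = (\<Sum>i<d. r i * u i)" using span[OF x] by auto
      have \<sigma>x: "\<sigma> x = (\<Sum>i<d. r i * \<sigma> (u i))" if "\<sigma> \<in> T" for \<sigma>
      proof -
        have \<sigma>: "subfield_hom E \<sigma>" using that T(1) by (auto simp: embeddings_iff)
        have rE: "r i \<in> E" if "i < d" for i using r(1)[OF that] Rats_subset_subfield[OF E] by blast
        have "\<sigma> x = (\<Sum>i<d. \<sigma> (r i * u i))"
          unfolding r(2) using rE u by (intro subfield_hom_sum[OF E \<sigma>] subfield_mult[OF E]) auto
        also have "\<dots> = (\<Sum>i<d. r i * \<sigma> (u i))"
          using rE u r(1) by (intro sum.cong) (auto simp: subfield_hom_mult[OF E \<sigma>] subfield_hom_Rats[OF E \<sigma>])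
        finally show ?thesis .
      qed
      have "(\<Sum>\<sigma>\<in>T. c \<sigma> * \<sigma> x) = (\<Sum>\<sigma>\<in>T. \<Sum>i<d. r i * (\<sigma> (u i) * c \<sigma>))"
      proof (rule sum.cong[OF refl])
        fix \<sigma> assume "\<sigma> \<in> T"
        show "c \<sigma> * \<sigma> x = (\<Sum>i<d. r i * (\<sigma> (u i) * c \<sigma>))"
          unfolding \<sigma>x[OF \<open>\<sigma> \<in> T\<close>] by (simp add: sum_distrib_left mult_ac)
      qed
      also have "\<dots> = (\<Sum>i<d. r i * (\<Sum>\<sigma>\<in>T. \<sigma> (u i) * c \<sigma>))"
        by (subst sum.swap) (simp add: sum_distrib_left)
      also have "\<dots> = 0" using c(2) by simp
      finally show ?thesis .
    qed
    then have "\<forall>\<sigma>\<in>T. c \<sigma> = 0"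
      using T by (intro subfield_homs_independent[OF E]) (auto simp: embeddings_iff)
    then show False using c(1) by blast
  qed
qed

text \<open>Artin's argument. With fewer than \<open>d\<close> automorphisms the equations indexed
  by \<open>\<Gamma>\<close> have a nonzero solution in \<open>F\<close>. One of minimal support,
  scaled to have an entry 1, is fixed by the group, hence rational; the equation for the identity
  then contradicts the independence of \<open>u\<close>.\<close>

lemma card_Gal_ge:
  assumes gal: "galois_extension F \<rat>" and dim: "ring.dimension CC d \<rat> F"
    and fin: "finite (carrier (Gal F \<rat>))"
  shows "d \<le> card (carrier (Gal F \<rat>))"
proof (rule ccontr)
  assume less: "\<not> ?thesis"
  define \<Gamma> where "\<Gamma> = carrier (Gal F \<rat>)"
  have F: "subfield F CC" and QF: "\<rat> \<subseteq> F" and fixed: "{a \<in> F. \<forall>\<sigma>\<in>\<Gamma>. \<sigma> a = a} = \<rat>"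
    using gal by (auto simp: galois_extension_def \<Gamma>_def)
  interpret group "Gal F \<rat>" using F QF by (rule group_Gal)
  have \<Gamma>: "subfield_hom F \<sigma>" "x \<in> F \<Longrightarrow> \<sigma> x \<in> F" if "\<sigma> \<in> \<Gamma>" for \<sigma> x
    using that unfolding \<Gamma>_def Gal_iff by auto
  obtain u where u: "\<And>i. i < d \<Longrightarrow> u i \<in> F"
    and "\<And>x. x \<in> F \<Longrightarrow> \<exists>c. (\<forall>i<d. c i \<in> \<rat>) \<and> x = (\<Sum>i<d. c i * u i)"
    and indep: "\<And>c. \<forall>i<d. c i \<in> \<rat> \<Longrightarrow> (\<Sum>i<d. c i * u i) = 0 \<Longrightarrow> \<forall>i<d. c i = 0"
    by (rule dimension_basis[OF subfield_Rats dim]) (rule that)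
  define sol where "sol c \<longleftrightarrow> (\<forall>j<d. c j \<in> F) \<and> (\<exists>j<d. c j \<noteq> 0) \<and> (\<forall>\<sigma>\<in>\<Gamma>. (\<Sum>j<d. \<sigma> (u j) * c j) = 0)"
    for c :: "nat \<Rightarrow> complex"
  define supp where "supp c = {j. j < d \<and> c j \<noteq> 0}" for c :: "nat \<Rightarrow> complex"
  have "\<exists>c. sol c"
    using homogeneous_system_solution[OF F, of \<Gamma> "{..<d}" "\<lambda>\<sigma> j. \<sigma> (u j)"] fin less u \<Gamma>
    unfolding sol_def \<Gamma>_def[symmetric] by auto
  then obtain c0 where "sol c0" by blast
  then obtain c where c: "sol c" and c_min: "\<And>c'. sol c' \<Longrightarrow> card (supp c) \<le> card (supp c')"
    using ex_has_least_nat[of sol c0 "\<lambda>c. card (supp c)"] by auto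
  obtain k where k: "k < d" "c k \<noteq> 0" using c unfolding sol_def by blast
  define b where "b j = c j / c k" for j
  have bF: "b j \<in> F" if "j < d" for j
    using c k that unfolding b_def sol_def by (auto intro: subfield_divide[OF F])
  have b0: "(\<Sum>j<d. \<sigma> (u j) * b j) = 0" if "\<sigma> \<in> \<Gamma>" for \<sigma>
    using c that unfolding b_def sol_def by (simp flip: sum_divide_distrib)
  have "b j \<in> \<rat>" if j: "j < d" for j
  proof -
    have "g (b j) = b j" if g: "g \<in> \<Gamma>" for g
    proof (rule ccontr)
      assume gj: "g (b j) \<noteq> b j"
      \<comment> \<open>Applying \<open>g\<close> permutes the equations and so gives a solution
        again. The difference of the two solutions vanishes at \<open>k\<close>, where
        \<open>b k = 1\<close>, and thus has smaller support.\<close>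
      define a where "a j = g (b j) - b j" for j
      have "(\<Sum>j<d. \<sigma> (u j) * a j) = 0" if \<sigma>: "\<sigma> \<in> \<Gamma>" for \<sigma>
      proof -
        define \<rho> where "\<rho> = inv\<^bsub>Gal F \<rat>\<^esub> g \<otimes>\<^bsub>Gal F \<rat>\<^esub> \<sigma>"
        have \<rho>: "\<rho> \<in> \<Gamma>" using g \<sigma> unfolding \<rho>_def \<Gamma>_def by simp
        have "g \<otimes>\<^bsub>Gal F \<rat>\<^esub> \<rho> = \<sigma>" using g \<sigma> unfolding \<rho>_def \<Gamma>_def by (simp flip: m_assoc)
        then have g\<rho>: "g (\<rho> x) = \<sigma> x" if "x \<in> F" for x
          using Gal_mult_apply[of g F \<rat> \<rho> x] g \<rho> that unfolding \<Gamma>_def by simp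
        have "(\<Sum>j<d. \<sigma> (u j) * g (b j)) = (\<Sum>j<d. g (\<rho> (u j) * b j))"
          using u bF g\<rho> \<Gamma>[OF \<rho>] by (intro sum.cong) (auto simp: subfield_hom_mult[OF F \<Gamma>(1)[OF g]])
        also have "\<dots> = g (\<Sum>j<d. \<rho> (u j) * b j)"
          using u bF \<Gamma>[OF \<rho>] by (intro subfield_hom_sum[OF F \<Gamma>(1)[OF g], symmetric] subfield_mult[OF F]) auto
        also have "\<dots> = 0" using b0[OF \<rho>] subfield_hom_0[OF F \<Gamma>(1)[OF g]] by simp
        finally show ?thesis using b0[OF \<sigma>] by (simp add: a_def algebra_simps sum_subtractf)
      qed
      moreover have "a i \<in> F" if "i < d" for i
        using bF that \<Gamma>(2)[OF g] unfolding a_def by (auto intro: subfield_diff[OF F])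
      ultimately have "sol a" using j gj unfolding sol_def a_def by auto
      moreover have "supp a \<subset> supp c"
      proof
        show "supp a \<subseteq> supp c"
          using subfield_hom_0[OF F \<Gamma>(1)[OF g]] unfolding supp_def a_def b_def by auto
        have "k \<notin> supp a" "k \<in> supp c"
          using k subfield_hom_1[OF F \<Gamma>(1)[OF g]] unfolding supp_def a_def b_def by auto
        then show "supp a \<noteq> supp c" by blast
      qed
      moreover have "finite (supp c)" unfolding supp_def by simp
      ultimately show False using c_min[of a] psubset_card_mono[of "supp c" "supp a"] by simp
    qed
    then show ?thesis using bF[OF j] fixed by blast
  qed
  moreover have "\<one>\<^bsub>Gal F \<rat>\<^esub> \<in> \<Gamma>" unfolding \<Gamma>_def by simp
  from b0[OF this] have "(\<Sum>j<d. b j * u j) = 0" using u by (simp add: Gal_one_apply mult.commute)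
  ultimately have "\<forall>j<d. b j = 0" using indep by blast
  then show False using k unfolding b_def by auto
qed

text \<open>The number of automorphisms is enclosed between the two bounds, so every embedding is an
  automorphism.\<close>

lemma galois_embeddings:
  assumes gal: "galois_extension F \<rat>" and dim: "ring.dimension CC d \<rat> F"
  shows "embeddings F \<rat> = carrier (Gal F \<rat>)" "finite (carrier (Gal F \<rat>))" "card (carrier (Gal F \<rat>)) = d"
proof -
  have F: "subfield F CC" using gal by (simp add: galois_extension_def)
  have sub: "carrier (Gal F \<rat>) \<subseteq> embeddings F \<rat>" using Gal_iff_embeddings[OF F] by blast
  note emb = card_embeddings_le[OF F dim]
  show fin: "finite (carrier (Gal F \<rat>))" using sub emb by (blast intro: finite_subset)
  note ge = card_Gal_ge[OF gal dim fin]
  have "carrier (Gal F \<rat>) = embeddings F \<rat>" using emb ge by (intro card_seteq[OF _ sub]) auto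
  then show "embeddings F \<rat> = carrier (Gal F \<rat>)" "card (carrier (Gal F \<rat>)) = d" using emb ge by auto
qed

section \<open>The cyclotomic polynomial over an extension of degree \<open>p\<close>\<close>

lemma coeff_mult_closed:
  "subfield F CC \<Longrightarrow> (\<And>i. coeff g i \<in> F) \<Longrightarrow> (\<And>i. coeff h i \<in> F) \<Longrightarrow> coeff (g * h) i \<in> F"
  unfolding coeff_mult by (intro subfield_sum subfield_mult)

text \<open>Division with remainder, one leading term at a time, so that the coefficients visibly
  stay in \<open>F\<close>.\<close>

lemma minimal_monic_dvd:
  assumes F: "subfield F CC" and f: "\<And>i. coeff f i \<in> F" "lead_coeff f = 1" "poly f x = 0"
    and minimal: "\<And>g. g \<noteq> 0 \<Longrightarrow> (\<And>i. coeff g i \<in> F) \<Longrightarrow> poly g x = 0 \<Longrightarrow> degree f \<le> degree g"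
    and g: "\<And>i. coeff g i \<in> F" "poly g x = 0"
  shows "f dvd g" using g
proof (induction "degree g" arbitrary: g rule: less_induct)
  case less
  show ?case
  proof (cases "g = 0")
    case False
    then have le: "degree f \<le> degree g" using minimal less.prems by blast
    define m where "m = monom (lead_coeff g) (degree g - degree f)"
    define h where "h = g - f * m"
    have "coeff m i \<in> F" for i using less.prems subfield_0[OF F] by (simp add: m_def)
    then have hF: "coeff h i \<in> F" for i
      unfolding h_def coeff_diff using less.prems f by (intro subfield_diff[OF F] coeff_mult_closed[OF F])
    have hx: "poly h x = 0" using less.prems f(3) by (simp add: h_def)
    have deg: "degree (f * m) = degree g"
      using False f(2) le by (subst degree_mult_eq) (auto simp: m_def degree_monom_eq monom_eq_0_iff)
    have lead: "lead_coeff (f * m) = lead_coeff g"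
      unfolding lead_coeff_mult f(2) using False by (simp add: m_def degree_monom_eq)
    have "f dvd h"
    proof (cases "h = 0")
      case False
      have "degree h \<le> degree g" using degree_diff_le[of g "degree g" "f * m"] deg unfolding h_def by simp
      moreover have "coeff h (degree g) = 0" using lead deg unfolding h_def by simp
      ultimately have "degree h < degree g" using False
        by (metis le_neq_implies_less leading_coeff_0_iff)
      then show ?thesis using hF hx by (intro less.hyps)
    qed simp
    then have "f dvd h + f * m" by simp
    then show ?thesis by (simp add: h_def)
  qed simp
qed

text \<open>At each z in \<open>B\<close> either \<open>f\<close> or its cofactor vanishes, and the
  linear factor is cancelled from the one that does.\<close>

lemma monic_dvd_prod_linear:
  fixes f :: "complex poly"
  assumes "finite B" "f dvd (\<Prod>z\<in>B. [:- z, 1:])" "lead_coeff f = 1"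
  shows "\<exists>A\<subseteq>B. f = (\<Prod>z\<in>A. [:- z, 1:])" using assms
proof (induction B arbitrary: f rule: finite_induct)
  case empty
  then have "degree f = 0" by (simp add: is_unit_iff_degree)
  then have "f = 1" using empty.prems(2) by (metis degree_0_id lead_coeff_1 one_pCons)
  then show ?case by auto
next
  case (insert z B)
  define R where "R = (\<Prod>z\<in>B. [:- z, 1:])"
  obtain h where h: "[:- z, 1:] * R = f * h" using insert.prems(1) insert.hyps by (auto simp: R_def)
  show ?case
  proof (cases "poly f z = 0")
    case True
    then obtain g where g: "f = [:- z, 1:] * g" by (auto simp: poly_eq_0_iff_dvd)
    then have "[:- z, 1:] * R = [:- z, 1:] * (g * h)" using h by (simp only: mult.assoc)
    then have "R = g * h" by (subst (asm) mult_cancel_left) simp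
    then have "g dvd R" by simp
    moreover have "lead_coeff g = 1" using insert.prems(2) unfolding g lead_coeff_mult by simp
    ultimately obtain A where A: "A \<subseteq> B" "g = (\<Prod>z\<in>A. [:- z, 1:])"
      using insert.IH unfolding R_def by blast
    have "finite A" "z \<notin> A" using A(1) insert.hyps finite_subset by auto
    then have "f = (\<Prod>z\<in>insert z A. [:- z, 1:])" unfolding g A(2) by simp
    then show ?thesis using A(1) by (intro exI[of _ "insert z A"]) auto
  next
    case False
    have "poly (f * h) z = 0" unfolding h[symmetric] by simp
    then have "poly h z = 0" using False by simp
    then obtain g where g: "h = [:- z, 1:] * g" by (auto simp: poly_eq_0_iff_dvd)
    then have "[:- z, 1:] * R = [:- z, 1:] * (f * g)" using h by (simp add: mult.left_commute)
    then have "R = f * g" by (subst (asm) mult_cancel_left) simp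
    then have "f dvd R" by simp
    then show ?thesis using insert.IH[OF _ insert.prems(2)] unfolding R_def by blast
  qed
qed

section \<open>Roots of unity of order \<open>p\<close>\<close>

locale prime_root_of_unity =
  fixes p :: nat and \<zeta> :: complex
  assumes p: "Factorial_Ring.prime p" "odd p" and \<zeta>: "primitive_root_of_unity p \<zeta>"
begin

lemma p_gt_2: "p > 2"
proof -
  have "p \<ge> 2" using p(1) by (rule prime_ge_2_nat)
  moreover have "p \<noteq> 2" using p(2) by auto
  ultimately show ?thesis by simp
qed

lemma zeta_power_p: "\<zeta> ^ p = 1" and zeta_power_neq_1: "0 < k \<Longrightarrow> k < p \<Longrightarrow> \<zeta> ^ k \<noteq> 1"
  using \<zeta> unfolding primitive_root_of_unity_def by auto

lemma zeta_nonzero: "\<zeta> \<noteq> 0" using zeta_power_p p_gt_2 by (intro notI) (simp add: zero_power)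

lemma zeta_power_mod: "\<zeta> ^ k = \<zeta> ^ (k mod p)"
proof -
  have "\<zeta> ^ k = \<zeta> ^ (p * (k div p) + k mod p)" by simp
  also have "\<dots> = \<zeta> ^ (k mod p)" unfolding power_add power_mult zeta_power_p by simp
  finally show ?thesis .
qed

lemma zeta_power_inj: "inj_on (\<lambda>k. \<zeta> ^ k) {..<p}"
proof (rule linorder_inj_onI')
  fix i j assume "i \<in> {..<p}" "j \<in> {..<p}" "i < j"
  show "\<zeta> ^ i \<noteq> \<zeta> ^ j"
  proof
    assume "\<zeta> ^ i = \<zeta> ^ j"
    moreover have "\<zeta> ^ j = \<zeta> ^ i * \<zeta> ^ (j - i)" using \<open>i < j\<close> by (simp flip: power_add)
    ultimately have "\<zeta> ^ (j - i) = 1" using zeta_nonzero by simp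
    moreover have "0 < j - i" "j - i < p" using \<open>i < j\<close> \<open>j \<in> {..<p}\<close> by auto
    ultimately show False using zeta_power_neq_1 by blast
  qed
qed

definition B :: "complex set" where "B = (\<lambda>k. \<zeta> ^ k) ` {1..<p}"

lemma finite_B: "finite B" and card_B: "card B = p - 1" and zeta_B: "\<zeta> \<in> B"
proof -
  have "inj_on (\<lambda>k. \<zeta> ^ k) {1..<p}" by (rule inj_on_subset[OF zeta_power_inj]) auto
  then show "card B = p - 1" unfolding B_def by (simp add: card_image)
  show "\<zeta> \<in> B" unfolding B_def using p_gt_2 by (intro image_eqI[of _ _ 1]) auto
qed (simp add: B_def)

lemma B_power_p: "z \<in> B \<Longrightarrow> z ^ p = 1" and B_neq_1: "z \<in> B \<Longrightarrow> z \<noteq> 1"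
  using zeta_power_neq_1 zeta_power_p by (auto simp: B_def simp flip: power_mult) (metis mult.commute power_mult power_one)

lemma B_powers:
  assumes "z \<in> B" "w \<in> B"
  obtains s where "w = z ^ s"
proof -
  obtain k l where k: "k \<in> {1..<p}" "z = \<zeta> ^ k" and l: "l \<in> {1..<p}" "w = \<zeta> ^ l"
    using assms unfolding B_def by blast
  have "\<not> p dvd k" using k(1) by (auto dest: dvd_imp_le)
  then have "Rings.coprime k p" using p(1) by (metis coprime_commute prime_imp_coprime)
  then obtain t where "[k * t = 1] (mod p)" using cong_solve_coprime_nat by auto
  then have "[k * t * l = 1 * l] (mod p)" by (rule cong_scalar_right)
  then have "(k * (t * l)) mod p = l mod p" by (simp add: cong_def mult.assoc)
  then have "z ^ (t * l) = w"
    unfolding k(2) l(2) power_mult[symmetric] using zeta_power_mod by metis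
  then show ?thesis using that by blast
qed

definition cyc :: "complex poly" where "cyc = (\<Sum>i<p. monom 1 i)"

lemma poly_cyc: "poly cyc x = (\<Sum>i<p. x ^ i)" by (simp add: cyc_def poly_sum poly_monom)

lemma cyc_factorisation: "cyc = (\<Prod>z\<in>B. [:- z, 1:])"
proof (rule poly_eqI_degree_lead_coeff[of _ "p - 1" _ B])
  have deg: "degree (\<Prod>z\<in>B. [:- z, 1:]) = p - 1"
    by (subst degree_prod_eq_sum_degree) (auto simp: card_B)
  then show "degree (\<Prod>z\<in>B. [:- z, 1:]) \<le> p - 1" by simp
  show "degree cyc \<le> p - 1"
    unfolding cyc_def by (rule degree_sum_le) (auto intro: order.trans[OF degree_monom_le])
  have "coeff (\<Prod>z\<in>B. [:- z, 1:]) (p - 1) = 1"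
    using deg lead_coeff_prod[of "\<lambda>z. [:- z, 1:]" B] by simp
  moreover have "coeff cyc (p - 1) = 1" unfolding cyc_def coeff_sum using p_gt_2 by simp
  ultimately show "coeff cyc (p - 1) = coeff (\<Prod>z\<in>B. [:- z, 1:]) (p - 1)" by simp
  show "p - 1 \<le> card B" by (simp add: card_B)
  show "poly cyc z = poly (\<Prod>z\<in>B. [:- z, 1:]) z" if z: "z \<in> B" for z
  proof -
    have "(1 - z) * poly cyc z = 1 - z ^ p" unfolding poly_cyc by (rule one_diff_power_eq[symmetric])
    then have "poly cyc z = 0" using B_power_p[OF z] B_neq_1[OF z] by simp
    moreover have "poly (\<Prod>z\<in>B. [:- z, 1:]) z = 0" using z finite_B by (auto simp: poly_prod)
    ultimately show ?thesis by simp
  qed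
qed

lemma root_of_unity_B:
  assumes "w ^ p = 1" "w \<noteq> 1"
  shows "w \<in> B"
proof -
  have "(1 - w) * poly cyc w = 1 - w ^ p" unfolding poly_cyc by (rule one_diff_power_eq[symmetric])
  then have "poly cyc w = 0" using assms by simp
  then show ?thesis unfolding cyc_factorisation using finite_B by (auto simp: poly_prod)
qed

lemma prod_one_minus_B: "(\<Prod>z\<in>B. 1 - z) = of_nat p"
proof -
  have "(\<Prod>z\<in>B. 1 - z) = poly cyc 1" unfolding cyc_factorisation by (simp add: poly_prod)
  then show ?thesis by (simp add: poly_cyc)
qed

lemma algebraic_int_B: "z \<in> B \<Longrightarrow> algebraic_int z"
  using algebraic_int_root[of 1 "monom 1 p" z] B_power_p[of z] p_gt_2
  by (auto simp: poly_monom degree_monom_eq)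

text \<open>\<open>z\<close> is a power of \<open>w\<close>, so the quotient is a geometric sum.
  Exchanging \<open>z\<close> and \<open>w\<close> shows that it is a unit.\<close>

lemma algebraic_int_cyclotomic_unit:
  assumes "z \<in> B" "w \<in> B"
  shows "algebraic_int ((1 - z) / (1 - w))"
proof -
  obtain s where s: "z = w ^ s" using B_powers[OF assms(2,1)] .
  have "(1 - z) / (1 - w) = (\<Sum>i<s. w ^ i)"
    using one_diff_power_eq[of w s] B_neq_1[OF assms(2)] unfolding s by (simp add: field_simps)
  also have "algebraic_int \<dots>" using algebraic_int_B[OF assms(2)] by (intro algebraic_int_sum algebraic_int_power)
  finally show ?thesis .
qed

text \<open>The product over \<open>A\<close> is the value at 1 of the factor with root set
  \<open>A\<close>. The norm of \<open>p\<close> from \<open>F\<close> is \<open>p ^ p\<close>, so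
  the norm of this value is an integer whose power with exponent \<open>p - 1\<close> is
  \<open>p ^ (p * m)\<close> up to sign.\<close>

lemma cyclotomic_factor_degree:
  assumes gal: "galois_extension F \<rat>" and dim: "ring.dimension CC p \<rat> F"
    and A: "A \<subseteq> B" and c: "(\<Prod>z\<in>A. 1 - z) \<in> F"
  shows "p - 1 dvd card A"
proof -
  define \<Gamma> where "\<Gamma> = carrier (Gal F \<rat>)"
  have F: "subfield F CC" and QF: "\<rat> \<subseteq> F" and fixed: "{a \<in> F. \<forall>\<sigma>\<in>\<Gamma>. \<sigma> a = a} = \<rat>"
    using gal by (auto simp: galois_extension_def \<Gamma>_def)
  interpret group "Gal F \<rat>" using F QF by (rule group_Gal)
  have \<Gamma>: "subfield_hom F \<sigma>" "x \<in> F \<Longrightarrow> \<sigma> x \<in> F" if "\<sigma> \<in> \<Gamma>" for \<sigma> x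
    using that unfolding \<Gamma>_def Gal_iff by auto
  have card\<Gamma>: "card \<Gamma> = p" and "finite \<Gamma>" using galois_embeddings[OF gal dim] unfolding \<Gamma>_def by auto
  \<comment> \<open>The norm of \<open>F\<close>, as a product over its automorphisms; left
    multiplication by \<open>g\<close> permutes the factors, so it is rational.\<close>
  define n where "n x = (\<Prod>\<sigma>\<in>\<Gamma>. \<sigma> x)" for x
  have n_rat: "n x \<in> \<rat>" if x: "x \<in> F" for x
  proof -
    have "g (n x) = n x" if g: "g \<in> \<Gamma>" for g
    proof -
      have "g (n x) = (\<Prod>\<sigma>\<in>\<Gamma>. g (\<sigma> x))"
        unfolding n_def using \<Gamma>(2) x by (intro subfield_hom_prod[OF F \<Gamma>(1)[OF g]])
      also have "\<dots> = (\<Prod>\<sigma>\<in>\<Gamma>. (g \<otimes>\<^bsub>Gal F \<rat>\<^esub> \<sigma>) x)"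
        using g x unfolding \<Gamma>_def by (intro prod.cong) (auto simp: Gal_mult_apply)
      also have "\<dots> = (\<Prod>\<sigma>\<in>\<Gamma>. \<sigma> x)"
      proof (rule prod.reindex_bij_betw)
        show "bij_betw ((\<otimes>\<^bsub>Gal F \<rat>\<^esub>) g) \<Gamma> \<Gamma>"
          unfolding bij_betw_def \<Gamma>_def using g inj_on_cmult[of g] surj_const_mult[of g] by (simp add: \<Gamma>_def)
      qed
      finally show ?thesis by (simp add: n_def)
    qed
    moreover have "n x \<in> F" unfolding n_def using \<Gamma>(2) x by (intro subfield_prod[OF F])
    ultimately show ?thesis using fixed by blast
  qed
  have n_int: "n x \<in> \<int>" if x: "x \<in> F" "algebraic_int x" for x
  proof -
    have "algebraic_int (n x)"
      unfolding n_def using subfield_hom_algebraic_int[OF F \<Gamma>(1)] x by (intro algebraic_int_prod)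
    then show ?thesis using n_rat[OF x(1)] by (rule rational_algebraic_int_is_int)
  qed
  have n_mult: "n (x * y) = n x * n y" if "x \<in> F" "y \<in> F" for x y
    unfolding n_def using that by (simp add: subfield_hom_mult[OF F \<Gamma>(1)] prod.distrib)
  have n_power: "n (x ^ k) = n x ^ k" if "x \<in> F" for x k
    unfolding n_def using that by (simp add: subfield_hom_power[OF F \<Gamma>(1)] prod_power_distrib)
  define m where "m = card A"
  define c where "c = (\<Prod>z\<in>A. 1 - z)"
  define t where "t = c ^ (p - 1) / of_nat p ^ m"
  have cF: "c \<in> F" using c by (simp add: c_def)
  have tF: "t \<in> F" unfolding t_def using cF by (intro subfield_divide[OF F] subfield_power[OF F] subfield_of_nat[OF F])
  \<comment> \<open>\<open>B\<close> has \<open>p - 1\<close> elements, so numerator and denominator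
    of \<open>t\<close> are double products over \<open>A\<close> and \<open>B\<close>, and
    \<open>t\<close> is a product of cyclotomic units.\<close>
  have "c ^ (p - 1) = (\<Prod>z\<in>A. \<Prod>w\<in>B. 1 - z)" unfolding c_def by (simp add: prod_power_distrib card_B)
  moreover have "of_nat p ^ m = (\<Prod>z\<in>A. \<Prod>w\<in>B. 1 - w)" unfolding m_def by (simp add: prod_one_minus_B)
  ultimately have t: "t = (\<Prod>z\<in>A. \<Prod>w\<in>B. (1 - z) / (1 - w))" "1 / t = (\<Prod>z\<in>A. \<Prod>w\<in>B. (1 - w) / (1 - z))"
    unfolding t_def by (simp_all add: prod_dividef)
  have t_int: "algebraic_int t" unfolding t(1) using A by (intro algebraic_int_prod algebraic_int_cyclotomic_unit) auto
  have t_int': "algebraic_int (1 / t)" unfolding t(2) using A by (intro algebraic_int_prod algebraic_int_cyclotomic_unit) auto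
  have p0: "(of_nat p :: complex) \<noteq> 0" using p_gt_2 by simp
  have "1 - z \<noteq> 0" if "z \<in> B" for z using B_neq_1[OF that] by auto
  then have c0: "c \<noteq> 0" unfolding c_def using A finite_subset[OF A finite_B] by (auto simp: prod_zero_iff)
  then have t0: "t \<noteq> 0" unfolding t_def using p0 by simp
  have "1 / t \<in> F" using tF by (intro subfield_divide[OF F] subfield_1[OF F])
  \<comment> \<open>Both norms are integers and their product is 1, so the norm of \<open>t\<close>
    is a sign.\<close>
  then obtain a b where a: "n t = of_int a" and b: "n (1 / t) = of_int b"
    using n_int[OF tF t_int] n_int[OF _ t_int'] by (auto elim!: Ints_cases)
  have "n t * n (1 / t) = n 1" using n_mult[OF tF \<open>1 / t \<in> F\<close>] t0 by simp
  also have "n 1 = 1" unfolding n_def by (intro prod.neutral ballI subfield_hom_1[OF F \<Gamma>(1)])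
  finally have "of_int (a * b) = (1 :: complex)" using a b by simp
  then have "a * b = 1" by (simp only: of_int_eq_1_iff)
  then have abs_a: "\<bar>a\<bar> = 1" by (simp add: zmult_eq_1_iff) auto
  have "algebraic_int c"
    unfolding c_def using A algebraic_int_B algebraic_int_add[OF algebraic_int_1 algebraic_int_minus]
    by (intro algebraic_int_prod) (auto simp: subset_iff)
  then obtain k where k: "n c = of_int k" using n_int[OF cF] by (auto elim: Ints_cases)
  have "c ^ (p - 1) = t * of_nat p ^ m" unfolding t_def using p0 by simp
  then have "n c ^ (p - 1) = n t * n (of_nat p) ^ m"
    using cF tF by (simp add: n_mult n_power subfield_power[OF F] subfield_of_nat[OF F] flip: n_power)
  also have "n (of_nat p) = (\<Prod>\<sigma>\<in>\<Gamma>. of_nat p)"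
    unfolding n_def by (intro prod.cong refl subfield_hom_of_nat[OF F \<Gamma>(1)])
  also have "\<dots> = of_nat p ^ p" by (simp add: card\<Gamma>)
  finally have "of_int (k ^ (p - 1)) = (of_int (a * int p ^ (p * m)) :: complex)"
    unfolding k a by (simp add: power_mult)
  then have "k ^ (p - 1) = a * int p ^ (p * m)" by (simp only: of_int_eq_iff)
  then have "\<bar>k\<bar> ^ (p - 1) = int p ^ (p * m)" using abs_a by (metis abs_mult abs_of_nat lambda_one of_nat_power power_abs)
  then have kp: "nat \<bar>k\<bar> ^ (p - 1) = p ^ (p * m)" by (metis nat_int nat_power_eq abs_ge_zero of_nat_power)
  have "multiplicity p (nat \<bar>k\<bar> ^ (p - 1)) = (p - 1) * multiplicity p (nat \<bar>k\<bar>)"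
  proof (rule prime_elem_multiplicity_power_distrib)
    show "prime_elem p" using p(1) by simp
    show "nat \<bar>k\<bar> \<noteq> 0"
    proof
      assume "nat \<bar>k\<bar> = 0"
      then have "p ^ (p * m) = 0" using kp p_gt_2 by (auto simp: power_0_left)
      then show False using p_gt_2 by simp
    qed
  qed
  moreover have "multiplicity p (p ^ (p * m)) = p * m" using p(1) by (intro multiplicity_same_power) auto
  ultimately have "p * m = (p - 1) * multiplicity p (nat \<bar>k\<bar>)" using kp by simp
  then have "p - 1 dvd p * m" by simp
  moreover have "Rings.coprime (p - 1) p" using coprime_diff_one_left_nat p_gt_2 by simp
  ultimately show ?thesis unfolding m_def by (simp add: coprime_dvd_mult_right_iff)
qed

text \<open>Irreducibility in the form that lets \<zeta> be sent to any other root. The minimal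
  polynomial of \<open>\<zeta>\<close> over \<open>F\<close> divides \<open>cyc\<close>, and its
  degree is a positive multiple of \<open>p - 1\<close>, so it is \<open>cyc\<close>.\<close>

lemma cyclotomic_irreducible:
  assumes gal: "galois_extension F \<rat>" and dim: "ring.dimension CC p \<rat> F"
    and g: "\<And>i. coeff g i \<in> F" "poly g \<zeta> = 0" and z: "z \<in> B"
  shows "poly g z = 0"
proof -
  have F: "subfield F CC" using gal by (simp add: galois_extension_def)
  define ann where "ann f \<longleftrightarrow> f \<noteq> 0 \<and> (\<forall>i. coeff f i \<in> F) \<and> poly f \<zeta> = 0" for f
  have cycF: "coeff cyc i \<in> F" for i
    unfolding cyc_def coeff_sum using subfield_0[OF F] subfield_1[OF F] by (intro subfield_sum[OF F]) simp
  have cyc\<zeta>: "poly cyc \<zeta> = 0" and cyc0: "cyc \<noteq> 0"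
    unfolding cyc_factorisation using zeta_B finite_B by (auto simp: poly_prod)
  then have "ann cyc" using cycF by (simp add: ann_def)
  then obtain f0 where f0: "ann f0" and f0_min: "\<And>f. ann f \<Longrightarrow> degree f0 \<le> degree f"
    using ex_has_least_nat[of ann cyc degree] by blast
  define f where "f = smult (inverse (lead_coeff f0)) f0"
  have f: "\<And>i. coeff f i \<in> F" "lead_coeff f = 1" "poly f \<zeta> = 0" "degree f = degree f0"
    using f0 unfolding f_def ann_def by (auto intro!: subfield_mult[OF F] subfield_inverse[OF F])
  have dvd: "f dvd h" if h: "\<And>i. coeff h i \<in> F" "poly h \<zeta> = 0" for h
    using f0_min f(4) by (intro minimal_monic_dvd[OF F f(1-3) _ h]) (auto simp: ann_def)
  obtain A where A: "A \<subseteq> B" "f = (\<Prod>z\<in>A. [:- z, 1:])"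
    using monic_dvd_prod_linear[OF finite_B _ f(2)] dvd[OF cycF cyc\<zeta>] unfolding cyc_factorisation by blast
  have "poly f 1 \<in> F" unfolding poly_altdef using f(1) by (intro subfield_sum[OF F]) simp
  then have "(\<Prod>z\<in>A. 1 - z) \<in> F" unfolding A(2) by (simp add: poly_prod)
  then have "p - 1 dvd card A" by (rule cyclotomic_factor_degree[OF gal dim A(1)])
  moreover have "A \<noteq> {}" using f(3) unfolding A(2) by auto
  then have "card A > 0" using finite_subset[OF A(1) finite_B] by (simp add: card_gt_0_iff)
  ultimately have "card B \<le> card A" unfolding card_B by (rule dvd_imp_le)
  then have "A = B" using A(1) finite_B by (intro card_seteq)
  then have "cyc dvd g" using dvd[OF g] unfolding A(2) cyc_factorisation by simp
  then obtain h where "g = cyc * h" by blast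
  moreover have "poly cyc z = 0" unfolding cyc_factorisation using z finite_B by (auto simp: poly_prod)
  ultimately show ?thesis by simp
qed

end

section \<open>The field \<open>L = F(\<zeta>)\<close>\<close>

locale cyclotomic_extension = prime_root_of_unity +
  fixes F K L :: "complex set" and D :: nat
  assumes gal: "galois_extension F \<rat>" and dimF: "ring.dimension CC p \<rat> F"
    and K_def: "K = generate_field CC {\<zeta>}" and L_def: "L = generate_field CC (F \<union> K)"
    and dimL: "ring.dimension CC D \<rat> L"
begin

lemma F: "subfield F CC" and K: "subfield K CC" and L: "subfield L CC"
  using gal by (auto simp: galois_extension_def K_def L_def subfield_generate_field)

lemma F_L: "F \<subseteq> L" and K_L: "K \<subseteq> L" and zeta_K: "\<zeta> \<in> K"
  using generate_field_superset[of "F \<union> K"] generate_field_superset[of "{\<zeta>}"] by (auto simp: K_def L_def)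

lemma zeta_L: "\<zeta> \<in> L" using zeta_K K_L by blast

lemma Rats_F: "\<rat> \<subseteq> F" and Rats_K: "\<rat> \<subseteq> K" and Rats_L: "\<rat> \<subseteq> L"
  using Rats_subset_subfield F K L by auto

lemma K_least: "subfield E CC \<Longrightarrow> \<zeta> \<in> E \<Longrightarrow> K \<subseteq> E" unfolding K_def by (rule generate_field_least) auto

lemma L_least: "subfield E CC \<Longrightarrow> F \<subseteq> E \<Longrightarrow> \<zeta> \<in> E \<Longrightarrow> L \<subseteq> E"
  unfolding L_def using K_least by (intro generate_field_least) auto

sublocale number_field L D
  by (rule number_field.intro[OF L dimension_imp_dim_le[OF subfield_Rats dimL]])

lemma number_field_K: "number_field K D"
  by (rule number_field.intro[OF K dim_le_subset[OF dim K_L]])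

text \<open>The polynomial values form a ring containing \<open>F\<close> and
  \<open>\<zeta>\<close>. It is a field because \<open>x\<close> has an integral multiple that
  divides a nonzero integer, with a cofactor that is a polynomial in that multiple.\<close>

lemma L_eq_polynomials: "L = {poly g \<zeta> | g. \<forall>i. coeff g i \<in> F}" (is "_ = ?R")
proof
  have RI: "poly g \<zeta> \<in> ?R" if "\<And>i. coeff g i \<in> F" for g using that by blast
  have sub: "?R \<subseteq> L"
    using F_L zeta_L by (auto simp: poly_altdef intro!: subfield_sum[OF L] subfield_mult[OF L] subfield_power[OF L])
  then show "?R \<subseteq> L" .
  have add: "x + y \<in> ?R" if "x \<in> ?R" "y \<in> ?R" for x y
  proof -
    obtain g h where "x = poly g \<zeta>" "y = poly h \<zeta>" "\<And>i. coeff g i \<in> F" "\<And>i. coeff h i \<in> F"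
      using \<open>x \<in> ?R\<close> \<open>y \<in> ?R\<close> by blast
    then show ?thesis using RI[of "g + h"] by (simp add: subfield_add[OF F])
  qed
  have mult: "x * y \<in> ?R" if "x \<in> ?R" "y \<in> ?R" for x y
  proof -
    obtain g h where gh: "x = poly g \<zeta>" "y = poly h \<zeta>" "\<And>i. coeff g i \<in> F" "\<And>i. coeff h i \<in> F"
      using \<open>x \<in> ?R\<close> \<open>y \<in> ?R\<close> by blast
    have "coeff (g * h) i \<in> F" for i
      unfolding coeff_mult using gh by (intro subfield_sum[OF F] subfield_mult[OF F])
    then show ?thesis using RI[of "g * h"] gh by simp
  qed
  have const: "a \<in> ?R" if "a \<in> F" for a
    using RI[of "[:a:]"] that subfield_0[OF F] by (simp add: coeff_pCons split: nat.splits)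
  have power: "x ^ n \<in> ?R" if "x \<in> ?R" for x n
    using that const[OF subfield_1[OF F]] mult by (induction n) auto
  have sum: "sum f I \<in> ?R" if "\<And>i. i \<in> I \<Longrightarrow> f i \<in> ?R" for f :: "nat \<Rightarrow> complex" and I using that
  proof (induction I rule: infinite_finite_induct)
    case (insert i I)
    then show ?case using add[of "f i" "sum f I"] by simp
  qed (use const[OF subfield_0[OF F]] in auto)
  have "subfield ?R CC"
  proof (rule subfield_CC_I)
    show "1 \<in> ?R" using const subfield_1[OF F] by blast
    show "- x \<in> ?R" if "x \<in> ?R" for x
      using mult[OF const[of "- 1"] that] subfield_minus[OF F subfield_1[OF F]] by simp
    fix x assume x: "x \<in> ?R" "x \<noteq> 0"
    then have "x \<in> L" using sub by blast
    then obtain m :: int where m: "m \<noteq> 0" "of_int m * x \<in> \<O> L" using common_denominator by blast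
    then obtain b a' n z where b: "b \<noteq> (0 :: int)" "of_int m * x * a' = of_int b"
      "a' = (\<Sum>j<n. of_int (z j) * (of_int m * x) ^ j)"
      using m x(2) by (auto elim: divides_nonzero_int[of "of_int m * x"])
    have rat: "r \<in> ?R" if "r \<in> \<rat>" for r using const that Rats_F by blast
    have "a' \<in> ?R" unfolding b(3) by (intro sum mult[OF rat power[OF mult[OF rat x(1)]]]) auto
    then have "of_int m / of_int b * a' \<in> ?R" by (intro mult[OF rat]) auto
    moreover have "inverse x = of_int m / of_int b * a'"
      using b(1,2) x(2) by (simp add: field_simps)
    ultimately show "inverse x \<in> ?R" by simp
  qed (use add mult in auto)
  moreover have "\<zeta> \<in> ?R"
    using RI[of "[:0, 1:]"] subfield_0[OF F] subfield_1[OF F] by (simp add: coeff_pCons split: nat.splits)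
  ultimately show "L \<subseteq> ?R" using const by (intro L_least) auto
qed

lemma subfield_hom_eqI:
  assumes "subfield_hom L \<phi>" "subfield_hom L \<psi>" "\<And>a. a \<in> F \<Longrightarrow> \<phi> a = \<psi> a" "\<phi> \<zeta> = \<psi> \<zeta>" "x \<in> L"
  shows "\<phi> x = \<psi> x"
proof -
  have "L \<subseteq> {x \<in> L. \<phi> x = \<psi> x}"
    using assms F_L zeta_L by (intro L_least subfield_hom_equalizer[OF L]) auto
  then show ?thesis using assms(5) by blast
qed

lemma L_subset_hom_image:
  assumes \<phi>: "subfield_hom L \<phi>" "F \<subseteq> \<phi> ` L" "\<phi> \<zeta> \<in> B"
  shows "L \<subseteq> \<phi> ` L"
proof (rule L_least[OF subfield_hom_image[OF L \<phi>(1)] \<phi>(2)])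
  obtain s where "\<zeta> = \<phi> \<zeta> ^ s" using B_powers[OF \<phi>(3) zeta_B] .
  then have "\<zeta> = \<phi> (\<zeta> ^ s)" using subfield_hom_power[OF L \<phi>(1) zeta_L] by simp
  then show "\<zeta> \<in> \<phi> ` L" using subfield_power[OF L zeta_L] by (rule image_eqI)
qed

lemma subfield_hom_zeta:
  assumes \<phi>: "subfield_hom L \<phi>"
  shows "\<phi> \<zeta> \<in> B"
proof (rule root_of_unity_B)
  show "\<phi> \<zeta> ^ p = 1"
    using subfield_hom_power[OF L \<phi> zeta_L, of p] zeta_power_p subfield_hom_1[OF L \<phi>] by simp
  show "\<phi> \<zeta> \<noteq> 1"
    using subfield_hom_inj[OF L \<phi>] zeta_L subfield_1[OF L] subfield_hom_1[OF L \<phi>] B_neq_1[OF zeta_B]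
    by (metis inj_on_contraD)
qed

text \<open>The map sends g(\<zeta>) to g(z) for polynomials g over \<open>F\<close>. It is well
  defined because the difference of two such polynomials vanishes at \<open>z\<close> whenever it
  vanishes at \<open>\<zeta>\<close>.\<close>

lemma ex_automorphism:
  assumes z: "z \<in> B"
  shows "\<exists>\<sigma>\<in>carrier (Gal L F). \<sigma> \<zeta> = z"
proof -
  define Fpoly where "Fpoly g \<longleftrightarrow> (\<forall>i. coeff g i \<in> F)" for g
  define \<sigma> where "\<sigma> = (\<lambda>x\<in>L. poly (SOME g. Fpoly g \<and> poly g \<zeta> = x) z)"
  have L_eq: "L = {poly g \<zeta> | g. Fpoly g}" unfolding Fpoly_def by (rule L_eq_polynomials)
  have \<sigma>: "\<sigma> (poly g \<zeta>) = poly g z" if g: "Fpoly g" for g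
  proof -
    define h where "h = (SOME h. Fpoly h \<and> poly h \<zeta> = poly g \<zeta>)"
    have h: "Fpoly h \<and> poly h \<zeta> = poly g \<zeta>" unfolding h_def by (rule someI[of _ g]) (use g in simp)
    have "poly (h - g) z = 0"
    proof (rule cyclotomic_irreducible[OF gal dimF _ _ z])
      show "coeff (h - g) i \<in> F" for i using h g by (simp add: Fpoly_def subfield_diff[OF F])
      show "poly (h - g) \<zeta> = 0" using h by simp
    qed
    moreover have "poly g \<zeta> \<in> L" unfolding L_eq using g by blast
    ultimately show ?thesis unfolding \<sigma>_def h_def by simp
  qed
  have const: "Fpoly [:a:]" if "a \<in> F" for a
    using that subfield_0[OF F] by (simp add: Fpoly_def coeff_pCons split: nat.splits)
  have hom: "subfield_hom L \<sigma>" unfolding subfield_hom_def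
  proof (intro conjI ballI)
    show "\<sigma> 1 = 1" using \<sigma>[OF const[OF subfield_1[OF F]]] by simp
    fix x y assume "x \<in> L" "y \<in> L"
    then obtain g h where gh: "Fpoly g" "Fpoly h" "x = poly g \<zeta>" "y = poly h \<zeta>" unfolding L_eq by blast
    have "Fpoly (g + h)" using gh by (auto simp: Fpoly_def intro: subfield_add[OF F])
    from \<sigma>[OF this] show "\<sigma> (x + y) = \<sigma> x + \<sigma> y" using gh \<sigma> by simp
    have "Fpoly (g * h)" unfolding Fpoly_def coeff_mult using gh
      by (auto simp: Fpoly_def intro!: subfield_sum[OF F] subfield_mult[OF F])
    from \<sigma>[OF this] show "\<sigma> (x * y) = \<sigma> x * \<sigma> y" using gh \<sigma> by simp
  qed
  have fix_F: "\<sigma> a = a" if "a \<in> F" for a using \<sigma>[OF const[OF that]] by simp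
  have "Fpoly [:0, 1:]"
    using subfield_0[OF F] subfield_1[OF F] by (simp add: Fpoly_def coeff_pCons split: nat.splits)
  from \<sigma>[OF this] have \<sigma>\<zeta>: "\<sigma> \<zeta> = z" by simp
  have "z \<in> L" using z zeta_L by (auto simp: B_def intro: subfield_power[OF L])
  have "\<sigma> ` L \<subseteq> L"
  proof
    fix y assume "y \<in> \<sigma> ` L"
    then obtain g where g: "Fpoly g" "y = \<sigma> (poly g \<zeta>)" unfolding L_eq by blast
    have "y = poly g z" using g \<sigma> by simp
    then show "y \<in> L" using g(1) F_L \<open>z \<in> L\<close>
      by (auto simp: Fpoly_def poly_altdef intro!: subfield_sum[OF L] subfield_mult[OF L] subfield_power[OF L])
  qed
  moreover have "F \<subseteq> \<sigma> ` L"
  proof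
    fix a assume "a \<in> F"
    then show "a \<in> \<sigma> ` L" using fix_F F_L by (intro image_eqI[of _ _ a]) auto
  qed
  then have "L \<subseteq> \<sigma> ` L" using z \<sigma>\<zeta> by (intro L_subset_hom_image[OF hom]) auto
  ultimately have "\<sigma> \<in> carrier (Gal L F)"
    unfolding Gal_iff_embeddings[OF L] embeddings_iff using hom fix_F by (auto simp: \<sigma>_def)
  then show ?thesis using \<sigma>\<zeta> by blast
qed

text \<open>\<open>L\<close> is normal over the rationals: \<open>F\<close> is Galois and so is
  mapped onto itself, and \<open>\<zeta>\<close> goes to a power of itself.\<close>

lemma embeddings_L_image:
  assumes "\<phi> \<in> embeddings L \<rat>"
  shows "\<phi> ` L = L"
proof -
  have \<phi>: "subfield_hom L \<phi>" using assms by (simp add: embeddings_iff)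
  have "restrict \<phi> F \<in> embeddings F \<rat>"
    unfolding embeddings_iff using \<phi> F_L Rats_F subfield_hom_Rats[OF L \<phi>]
    by (auto simp: subfield_hom_def subset_iff subfield_closed[OF F])
  then have "restrict \<phi> F ` F = F" unfolding galois_embeddings(1)[OF gal dimF] Gal_iff by blast
  then have \<phi>F: "\<phi> ` F = F" by simp
  have sub: "subfield {x \<in> L. \<phi> x \<in> L} CC" by (rule subfield_hom_vimage[OF L \<phi> L])
  have "B \<subseteq> L" using zeta_L by (auto simp: B_def intro: subfield_power[OF L])
  then have "L \<subseteq> {x \<in> L. \<phi> x \<in> L}"
    using \<phi>F F_L zeta_L subfield_hom_zeta[OF \<phi>] by (intro L_least[OF sub]) auto
  moreover have "F \<subseteq> \<phi> ` L" using \<phi>F F_L by blast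
  then have "L \<subseteq> \<phi> ` L" using subfield_hom_zeta[OF \<phi>] by (rule L_subset_hom_image[OF \<phi>])
  ultimately show ?thesis by blast
qed

lemma embeddings_L_eq: "embeddings L \<rat> = carrier (Gal L \<rat>)"
  using Gal_iff_embeddings[OF L] embeddings_L_image by blast

lemma embeddings_L_K_subset: "embeddings L K \<subseteq> embeddings L \<rat>"
proof
  fix h assume h: "h \<in> embeddings L K"
  then have "h a = a" if "a \<in> \<rat>" for a using subsetD[OF Rats_K that] by (simp add: embeddings_iff)
  then show "h \<in> embeddings L \<rat>" using h by (simp add: embeddings_iff)
qed

lemma embeddings_L_K_D:
  assumes "h \<in> embeddings L K"
  shows "subfield_hom L h" "h ` L = L"
proof -
  have "h \<in> embeddings L \<rat>" using assms embeddings_L_K_subset by blast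
  then show "subfield_hom L h" "h ` L = L" using embeddings_L_image by (auto simp: embeddings_iff)
qed

lemma finite_embeddings_L: "finite (embeddings L \<rat>)" "finite (embeddings L K)"
  using card_embeddings_le[OF L dimL] embeddings_L_K_subset by (auto intro: finite_subset)

lemma identity_embedding: "restrict (\<lambda>x. x) L \<in> embeddings L K"
  using K_L by (auto simp: embeddings_iff subfield_hom_def subfield_closed[OF L])

text \<open>The Galois group of \<open>L\<close> over \<open>F\<close> acts simply transitively on
  the primitive roots of unity; in particular it has order \<open>p - 1\<close>.\<close>

lemma Gal_L_F_zeta: "bij_betw (\<lambda>\<sigma>. \<sigma> \<zeta>) (carrier (Gal L F)) B"
proof -
  have "inj_on (\<lambda>\<sigma>. \<sigma> \<zeta>) (carrier (Gal L F))"
  proof (rule inj_onI)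
    fix \<sigma> \<rho> assume *: "\<sigma> \<in> carrier (Gal L F)" "\<rho> \<in> carrier (Gal L F)" "\<sigma> \<zeta> = \<rho> \<zeta>"
    then have hom: "subfield_hom L \<sigma>" "subfield_hom L \<rho>" and ext: "\<sigma> \<in> extensional L" "\<rho> \<in> extensional L"
      and "\<And>a. a \<in> F \<Longrightarrow> \<sigma> a = \<rho> a" unfolding Gal_iff by auto
    then have "\<sigma> x = \<rho> x" if "x \<in> L" for x using subfield_hom_eqI[OF hom _ *(3) that] by blast
    then show "\<sigma> = \<rho>" by (rule extensionalityI[OF ext])
  qed
  moreover have "(\<lambda>\<sigma>. \<sigma> \<zeta>) ` carrier (Gal L F) = B"
    using ex_automorphism subfield_hom_zeta by (auto simp: Gal_iff)
  ultimately show ?thesis by (simp add: bij_betw_def)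
qed

text \<open>\<open>\<Phi>\<close> iterates the function \<open>\<tau>\<close>, while the order of
  \<open>\<tau>\<close> is known in the Galois group; on \<open>L\<close> the two notions of power
  agree.\<close>

lemma Gal_pow_apply:
  assumes "E \<subseteq> L" "\<tau> \<in> carrier (Gal L E)" "x \<in> L"
  shows "(\<tau> [^]\<^bsub>Gal L E\<^esub> (j :: nat)) x = (\<tau> ^^ j) x"
proof -
  interpret group "Gal L E" by (rule group_Gal[OF L assms(1)])
  have \<tau>L: "\<tau> y \<in> L" if "y \<in> L" for y using assms(2) that by (auto simp: Gal_iff)
  show ?thesis using assms(3)
  proof (induction j arbitrary: x)
    case (Suc j)
    then show ?case using assms(2) \<tau>L[OF Suc.prems] by (simp add: Gal_mult_apply funpow_swap1)
  qed (simp add: Gal_one_apply)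
qed

lemma field_norm_L: "x \<in> L \<Longrightarrow> field_norm L K x \<in> L" "x \<in> L \<Longrightarrow> field_norm L K x = 0 \<longleftrightarrow> x = 0"
proof -
  have h: "subfield_hom L h" "x \<in> L \<Longrightarrow> h x \<in> L" if "h \<in> embeddings L K" for h x
    using embeddings_L_K_D[OF that] by auto
  show "x \<in> L \<Longrightarrow> field_norm L K x \<in> L"
    unfolding field_norm_def using h(2) by (intro subfield_prod[OF L])
  show "x \<in> L \<Longrightarrow> field_norm L K x = 0 \<longleftrightarrow> x = 0"
    unfolding field_norm_def using finite_embeddings_L(2) subfield_hom_eq_0_iff[OF L h(1)] identity_embedding
    by (auto simp: prod_zero_iff)
qed

context
  fixes \<tau> assumes \<tau>: "\<tau> \<in> carrier (Gal L F)" and gen: "generate (Gal L F) {\<tau>} = carrier (Gal L F)"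
begin

lemma funpow_hom: "subfield_hom L (\<tau> ^^ j)" and funpow_image: "(\<tau> ^^ j) ` L = L"
proof -
  interpret group "Gal L F" by (rule group_Gal[OF L F_L])
  define \<rho> where "\<rho> = \<tau> [^]\<^bsub>Gal L F\<^esub> j"
  have \<rho>: "\<rho> \<in> carrier (Gal L F)" unfolding \<rho>_def using \<tau> by simp
  have eq: "(\<tau> ^^ j) x = \<rho> x" if "x \<in> L" for x unfolding \<rho>_def by (rule Gal_pow_apply[OF F_L \<tau> that, symmetric])
  show "subfield_hom L (\<tau> ^^ j)"
    using \<rho> eq unfolding Gal_iff subfield_hom_def by (simp add: subfield_closed[OF L])
  have "(\<tau> ^^ j) ` L = \<rho> ` L" using eq by (intro image_cong) auto
  then show "(\<tau> ^^ j) ` L = L" using \<rho> by (simp add: Gal_iff)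
qed

lemma funpow_zeta: "bij_betw (\<lambda>j. (\<tau> ^^ j) \<zeta>) {0..p - 2} B"
proof -
  interpret group "Gal L F" by (rule group_Gal[OF L F_L])
  have card: "card (carrier (Gal L F)) = p - 1" using bij_betw_same_card[OF Gal_L_F_zeta] card_B by simp
  have fin: "finite (carrier (Gal L F))" using bij_betw_finite[OF Gal_L_F_zeta] finite_B by simp
  have "ord \<tau> = p - 1" using generate_pow_card[OF \<tau>] gen card by simp
  then have inj: "inj_on (\<lambda>j. \<tau> [^]\<^bsub>Gal L F\<^esub> j) {0..p - 2}"
    using ord_inj[OF \<tau>] by (simp add: numeral_2_eq_2)
  have "(\<lambda>j. \<tau> [^]\<^bsub>Gal L F\<^esub> j) ` {0..p - 2} = carrier (Gal L F)"
    using card_image[OF inj] card p_gt_2 \<tau> by (intro card_seteq[OF fin]) auto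
  with inj have "bij_betw (\<lambda>j. \<tau> [^]\<^bsub>Gal L F\<^esub> j) {0..p - 2} (carrier (Gal L F))"
    by (simp add: bij_betw_def)
  from bij_betw_trans[OF this Gal_L_F_zeta]
  have "bij_betw (\<lambda>j. (\<tau> [^]\<^bsub>Gal L F\<^esub> j) \<zeta>) {0..p - 2} B" by (simp add: comp_def)
  then show ?thesis using Gal_pow_apply[OF F_L \<tau> zeta_L] by simp
qed

text \<open>The map from (j, h) to \<tau>^j h is a bijection onto \<open>Gal L \<rat>\<close>: since
  h fixes \<open>\<zeta>\<close>, the image of \<open>\<zeta>\<close> determines j. The homomorphism
  \<tau>^j then moves outside the inner product over h.\<close>

lemma field_norm_tower:
  assumes x: "x \<in> L"
  shows "field_norm L \<rat> x = (\<Prod>j=0..p - 2. (\<tau> ^^ j) (field_norm L K x))"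
proof -
  interpret G: group "Gal L \<rat>" by (rule group_Gal[OF L Rats_L])
  define H where "H = embeddings L K"
  have HG: "h \<in> carrier (Gal L \<rat>)" if "h \<in> H" for h
    using that embeddings_L_K_subset embeddings_L_eq unfolding H_def by blast
  have \<tau>G: "\<tau> \<in> carrier (Gal L \<rat>)" using \<tau> Rats_F by (auto simp: Gal_iff)
  define T where "T j = \<tau> [^]\<^bsub>Gal L \<rat>\<^esub> j" for j :: nat
  have TG: "T j \<in> carrier (Gal L \<rat>)" for j unfolding T_def using \<tau>G by simp
  have T_apply: "T j y = (\<tau> ^^ j) y" if "y \<in> L" for j y
    unfolding T_def by (rule Gal_pow_apply[OF Rats_L \<tau>G that])
  define c where "c = (\<lambda>(j, h). T j \<otimes>\<^bsub>Gal L \<rat>\<^esub> h)"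
  have hL: "h y \<in> L" if "h \<in> H" "y \<in> L" for h y using HG[OF that(1)] that(2) by (auto simp: Gal_iff)
  have c_apply: "c (j, h) y = (\<tau> ^^ j) (h y)" if "h \<in> H" "y \<in> L" for j h y
    unfolding c_def using that HG TG T_apply hL by (simp add: Gal_mult_apply)
  have h\<zeta>: "h \<zeta> = \<zeta>" if "h \<in> H" for h using that zeta_K by (auto simp: H_def embeddings_iff)
  have "bij_betw c ({0..p - 2} \<times> H) (embeddings L \<rat>)" unfolding bij_betw_def
  proof
    show "inj_on c ({0..p - 2} \<times> H)"
    proof (rule inj_onI)
      fix a b assume a: "a \<in> {0..p - 2} \<times> H" and b: "b \<in> {0..p - 2} \<times> H" and eq: "c a = c b"
      obtain i h where i: "a = (i, h)" "i \<in> {0..p - 2}" "h \<in> H" using a by blast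
      obtain j k where j: "b = (j, k)" "j \<in> {0..p - 2}" "k \<in> H" using b by blast
      have "(\<tau> ^^ i) \<zeta> = (\<tau> ^^ j) \<zeta>"
        using arg_cong[OF eq, of "\<lambda>f. f \<zeta>"] i j zeta_L by (simp add: c_apply h\<zeta>)
      then have "i = j" using funpow_zeta i(2) j(2) by (auto simp: bij_betw_def dest: inj_onD)
      then have "T i \<otimes>\<^bsub>Gal L \<rat>\<^esub> h = T i \<otimes>\<^bsub>Gal L \<rat>\<^esub> k" using eq i j by (simp add: c_def)
      then have "h = k" using TG HG i j by (simp add: G.l_cancel)
      with \<open>i = j\<close> show "a = b" using i j by simp
    qed
    show "c ` ({0..p - 2} \<times> H) = embeddings L \<rat>"
    proof
      show "c ` ({0..p - 2} \<times> H) \<subseteq> embeddings L \<rat>"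
        unfolding embeddings_L_eq c_def using TG HG by auto
      show "embeddings L \<rat> \<subseteq> c ` ({0..p - 2} \<times> H)"
      proof
        fix \<phi> assume "\<phi> \<in> embeddings L \<rat>"
        then have \<phi>: "\<phi> \<in> carrier (Gal L \<rat>)" by (simp add: embeddings_L_eq)
        then have "\<phi> \<zeta> \<in> B" using subfield_hom_zeta by (simp add: Gal_iff)
        then have "\<phi> \<zeta> \<in> (\<lambda>j. (\<tau> ^^ j) \<zeta>) ` {0..p - 2}" using funpow_zeta by (simp add: bij_betw_def)
        then obtain j where j: "j \<in> {0..p - 2}" "\<phi> \<zeta> = (\<tau> ^^ j) \<zeta>" by blast
        \<comment> \<open>What is left of \<open>\<phi>\<close> after removing the power of
          \<open>\<tau>\<close>; it fixes \<open>\<zeta>\<close>, hence all of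
          \<open>K\<close>.\<close>
        define h where "h = inv\<^bsub>Gal L \<rat>\<^esub> T j \<otimes>\<^bsub>Gal L \<rat>\<^esub> \<phi>"
        have hG: "h \<in> carrier (Gal L \<rat>)" unfolding h_def using TG \<phi> by simp
        have Th: "T j \<otimes>\<^bsub>Gal L \<rat>\<^esub> h = \<phi>" unfolding h_def using TG \<phi> by (simp flip: G.m_assoc)
        have hom: "subfield_hom L h" and hL: "h \<zeta> \<in> L" using hG zeta_L by (auto simp: Gal_iff)
        have "T j (h \<zeta>) = T j \<zeta>"
          using Gal_mult_apply[OF TG hG zeta_L, of j] Th j(2) T_apply[OF zeta_L] by simp
        then have "h \<zeta> = \<zeta>" using TG[of j] hL zeta_L by (auto simp: Gal_iff dest: inj_onD)
        moreover have "subfield_hom L (\<lambda>x. x)" by (simp add: subfield_hom_def)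
        ultimately have "K \<subseteq> {x \<in> L. h x = x}"
          using zeta_L hom by (intro K_least subfield_hom_equalizer[OF L]) auto
        then have "h \<in> H" using hG by (auto simp: H_def embeddings_iff Gal_iff)
        then show "\<phi> \<in> c ` ({0..p - 2} \<times> H)" using j(1) Th by (intro image_eqI[of _ _ "(j, h)"]) (auto simp: c_def)
      qed
    qed
  qed
  from prod.reindex_bij_betw[OF this, of "\<lambda>\<phi>. \<phi> x"]
  have "field_norm L \<rat> x = (\<Prod>a\<in>{0..p - 2} \<times> H. c a x)" by (simp add: field_norm_def)
  also have "\<dots> = (\<Prod>a\<in>{0..p - 2} \<times> H. (\<tau> ^^ fst a) (snd a x))"
    using x by (intro prod.cong) (auto simp: c_apply)
  also have "\<dots> = (\<Prod>j=0..p - 2. \<Prod>h\<in>H. (\<tau> ^^ j) (h x))"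
    by (simp add: prod.cartesian_product case_prod_unfold)
  also have "\<dots> = (\<Prod>j=0..p - 2. (\<tau> ^^ j) (field_norm L K x))"
    unfolding field_norm_def H_def[symmetric] using hL x
    by (intro prod.cong refl subfield_hom_prod[OF L funpow_hom, symmetric]) auto
  finally show ?thesis .
qed

end

text \<open>The value at \<open>Q\<close> of the norm of an element is the sum of its values at the
  primes \<open>P h\<close>. On \<open>J\<close> each summand is at least that of \<open>x\<close>,
  with equality throughout for a generic element, so the least value on the norms is that of the
  norm of \<open>x\<close>. The factor \<open>\<O> K\<close> in the ideal norm contributes
  0.\<close>

lemma I_part_ideal_val:
  assumes S: "unramified_prime L D q S" and Q: "Q \<in> S" and x: "x \<in> L" "x \<noteq> 0"
  shows "unramified_prime.ideal_val L q Q (unramified_prime.val L q Q (field_norm L K x)) (I_part L K q x)"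
proof -
  interpret S: unramified_prime L D q S by fact
  interpret K: number_field K D by (rule number_field_K)
  define H where "H = embeddings L K"
  have h: "subfield_hom L h" "h ` L = L" if "h \<in> H" for h
    using embeddings_L_K_D[of h] that by (auto simp: H_def)
  have "\<exists>P\<in>S. \<forall>a\<in>L. a \<noteq> 0 \<longrightarrow> S.val Q (h a) = S.val P a" if "h \<in> H" for h
    using S.val_automorphism[OF h[OF that] Q] by metis
  then obtain P where P: "\<And>h. h \<in> H \<Longrightarrow> P h \<in> S"
    and valP: "\<And>h a. h \<in> H \<Longrightarrow> a \<in> L \<Longrightarrow> a \<noteq> 0 \<Longrightarrow> S.val Q (h a) = S.val (P h) a" by metis
  have hL: "h a \<in> L \<and> h a \<noteq> 0" if "h \<in> H" "a \<in> L" "a \<noteq> 0" for h a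
    using h[OF that(1)] that subfield_hom_eq_0_iff[OF L h(1)[OF that(1)]] by blast
  have norm_val: "S.val Q (field_norm L K a) = (\<Sum>h\<in>H. S.val (P h) a)" if "a \<in> L" "a \<noteq> 0" for a
    unfolding field_norm_def H_def[symmetric]
    using S.val_prod[OF Q, of H "\<lambda>h. h a"] hL valP that by simp
  define J where "J = J_part L q x"
  have JL: "J \<subseteq> L" unfolding J_def using S.J_part_carrier by (rule frac_ideal_subset)
  have "S.ideal_val Q (S.val Q (field_norm L K x)) (field_norm L K ` J)"
    unfolding S.ideal_val_def[OF Q]
  proof (intro conjI ballI)
    show "field_norm L K ` J \<subseteq> L" using JL field_norm_L(1) by blast
    obtain a where a: "a \<in> J" "a \<noteq> 0" "\<And>Q. Q \<in> S \<Longrightarrow> S.val Q a = S.val Q x"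
      using S.J_part_generic_element[OF x] unfolding J_def by metis
    then have aL: "a \<in> L" using JL by blast
    have "S.val Q (field_norm L K a) = S.val Q (field_norm L K x)"
      unfolding norm_val[OF aL a(2)] norm_val[OF x] using a(3) P by (intro sum.cong) auto
    moreover have "field_norm L K a \<noteq> 0" using field_norm_L(2)[OF aL] a(2) by simp
    ultimately show "\<exists>b\<in>field_norm L K ` J. b \<noteq> 0 \<and> S.val Q b = S.val Q (field_norm L K x)"
      using a(1) by blast
    fix b assume "b \<in> field_norm L K ` J"
    then obtain a where a: "a \<in> J" "b = field_norm L K a" by blast
    then have aL: "a \<in> L" using JL by blast
    show "S.val_ge Q (S.val Q (field_norm L K x)) b"
    proof (cases "a = 0")
      case True
      then show ?thesis using field_norm_L(2)[OF aL] a(2) by (simp add: S.val_ge_def[OF Q])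
    next
      case False
      have "S.val (P h) x \<le> S.val (P h) a" if "h \<in> H" for h
        using S.J_part_ideal_val[OF P[OF that] x] a(1) False
        unfolding S.ideal_val_def[OF P[OF that]] S.val_ge_def[OF P[OF that]] J_def by blast
      then have "S.val Q (field_norm L K x) \<le> S.val Q b"
        unfolding a(2) norm_val[OF aL False] norm_val[OF x] by (intro sum_mono)
      then show ?thesis by (simp add: S.val_ge_def[OF Q])
    qed
  qed
  moreover have "S.ideal_val Q 0 (\<O> K)"
    using K_L K.int_ring_1 by (intro S.ideal_val_subring[OF Q]) (auto simp: int_ring_def)
  ultimately have "S.ideal_val Q (0 + S.val Q (field_norm L K x)) (ideal_prod CC (\<O> K) (field_norm L K ` J))"
    by (intro S.ideal_val_mult[OF Q])
  then show ?thesis by (simp add: I_part_def ideal_norm_def J_def)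
qed

end

section \<open>Values of the norm of \<open>x\<close> and of its image under
  \<open>\<Phi>\<close>\<close>

theorem corollary3p3:
  fixes p e n :: nat and \<zeta> x :: complex and F K L :: "complex set"
    and \<tau> :: "complex \<Rightarrow> complex" and q :: "nat \<Rightarrow> nat" and l :: "nat \<Rightarrow> int"
  assumes p: "Factorial_Ring.prime p" "odd p"
    and \<zeta>: "primitive_root_of_unity p \<zeta>"
    and F: "cyclic_extension F \<rat>" "ring.dimension CC p \<rat> F"
    and K: "K = generate_field CC {\<zeta>}"
    and L: "L = generate_field CC (F \<union> K)"
    and \<tau>: "\<tau> \<in> carrier (Gal L F)" "generate (Gal L F) {\<tau>} = carrier (Gal L F)"
    and e: "residue_primroot p e"
    and x: "x \<in> L" "x \<noteq> 0"
    and n: "n \<ge> 1"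
    and q: "\<forall>i\<in>{1..n}. Factorial_Ring.prime (q i)" "inj_on q {1..n}"
    and l: "\<forall>i\<in>{1..n}. l i \<noteq> 0"
    and norm: "field_norm L \<rat> x = (\<Prod>i=1..n. of_nat (q i) powi l i) \<or>
               field_norm L \<rat> x = - (\<Prod>i=1..n. of_nat (q i) powi l i)"
    and split: "\<exists>i\<in>{1..n}. splits_completely (q i) L \<and>
                  (\<exists>P. prime_ideal K P \<and> I_part L K (q i) x = P [^]\<^bsub>frac_ideals K\<^esub> l i) \<and>
                  \<not> int p dvd l i"
  shows "\<Phi> p e \<tau> (field_norm L K x) \<notin> pth_powers p L \<and>
         \<Phi> p e \<tau> (\<zeta> * field_norm L K x) \<notin> pth_powers p L"
proof -
  obtain i P where i: "i \<in> {1..n}" and split_i: "splits_completely (q i) L" and P: "prime_ideal K P"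
    and I_P: "I_part L K (q i) x = P [^]\<^bsub>frac_ideals K\<^esub> l i" and l_i: "\<not> int p dvd l i"
    using split by blast
  obtain S where S: "finite S" "\<And>Q. Q \<in> S \<Longrightarrow> prime_ideal L Q" "ring.dimension CC (card S) \<rat> L"
    "principal L (of_nat (q i)) = (\<Otimes>\<^bsub>frac_ideals L\<^esub>Q\<in>S. Q)"
    using split_i unfolding splits_completely_def by blast
  \<comment> \<open>By complete splitting the number of primes above \<open>q i\<close> is the
    degree of \<open>L\<close>.\<close>
  define D where "D = card S"
  have "galois_extension F \<rat>" using F(1) by (simp add: cyclic_extension_def)
  then interpret C: cyclotomic_extension p \<zeta> F K L D
    using p \<zeta> F(2) K L S(3) unfolding D_def by unfold_locales
  interpret K: number_field K D by (rule C.number_field_K)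
  have q_prime: "Factorial_Ring.prime (q k)" if "k \<in> {1..n}" for k using q(1) that by blast
  have V: "unramified_prime L D (q i) S"
    by (intro unramified_prime.intro C.number_field_axioms unramified_prime_axioms.intro) (fact q_prime[OF i] S)+
  then interpret V: unramified_prime L D "q i" S .
  define y where "y = field_norm L K x"
  have y: "y \<in> L" "y \<noteq> 0" using C.field_norm_L[OF x(1)] x(2) by (auto simp: y_def)
  have P_OL: "P \<subseteq> \<O> L" using K.prime_ideal_subset[OF P] C.K_L by (auto simp: int_ring_def)
  \<comment> \<open>\<open>P\<close> is an ideal of \<open>\<O> K\<close> only, but its elements are
    integers of \<open>L\<close>, so 1 serves as common denominator and the values are
    nonnegative.\<close>
  have ex_w: "\<exists>w. V.ideal_val Q w P \<and> w \<ge> 0" if Q: "Q \<in> S" for Q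
  proof -
    obtain a where a: "a \<in> P" "a \<noteq> 0" using P K.prime_ideal_0[OF P] unfolding K.prime_ideal_iff by blast
    obtain w where w: "V.ideal_val Q w P"
      using V.ideal_val_ex[OF Q, of P a 1] a P_OL C.int_ring_subset subfield_1[OF C.L] by auto
    then obtain b where "b \<in> P" "b \<noteq> 0" "V.val Q b = w" unfolding V.ideal_val_def[OF Q] by blast
    then have "w \<ge> 0" using V.val_nonneg[OF Q, of b] P_OL by blast
    with w show ?thesis by blast
  qed
  define w where "w Q = (SOME w. V.ideal_val Q w P \<and> w \<ge> 0)" for Q
  have w: "V.ideal_val Q (w Q) P" "w Q \<ge> 0" if "Q \<in> S" for Q
    using someI_ex[OF ex_w[OF that]] unfolding w_def by auto
  have val_y: "V.val Q y = l i * w Q" if Q: "Q \<in> S" for Q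
  proof (rule V.ideal_val_unique[OF Q])
    show "V.ideal_val Q (V.val Q y) (I_part L K (q i) x)"
      unfolding y_def by (rule C.I_part_ideal_val[OF V Q x])
    show "V.ideal_val Q (l i * w Q) (I_part L K (q i) x)"
      unfolding I_P by (rule V.ideal_val_int_pow[OF Q C.number_field_K C.K_L K.prime_ideal_invertible[OF P] w(1)[OF Q]])
  qed
  obtain Q where Q: "Q \<in> S" using V.S_nonempty by blast
  have hom: "subfield_hom L (\<tau> ^^ j)" "(\<tau> ^^ j) ` L = L" for j
    by (rule C.funpow_hom[OF \<tau>], rule C.funpow_image[OF \<tau>])
  \<comment> \<open>The preimage of \<open>Q\<close> under \<open>\<tau> ^^ j\<close> serves as
    \<open>R j\<close>. Values at the single prime \<open>Q\<close> of all conjugates of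
    \<open>y\<close> become values of \<open>y\<close> itself at varying primes.\<close>
  have "\<exists>R. R \<in> S \<and> (\<forall>a\<in>L. a \<noteq> 0 \<longrightarrow> V.val Q ((\<tau> ^^ j) a) = V.val R a)" for j
    using V.val_automorphism[OF hom Q, of j] by metis
  then obtain R where R: "\<And>j. R j \<in> S" and val_R: "\<And>j a. a \<in> L \<Longrightarrow> a \<noteq> 0 \<Longrightarrow> V.val Q ((\<tau> ^^ j) a) = V.val (R j) a"
    by metis
  have \<tau>L: "(\<tau> ^^ j) a \<in> L \<and> (\<tau> ^^ j) a \<noteq> 0" if "a \<in> L" "a \<noteq> 0" for j a
    using hom(2)[of j] subfield_hom_eq_0_iff[OF C.L hom(1) that(1), of j] that by blast
  define nu where "nu j = w (R j)" for j
  have nu: "nu j \<ge> 0" "V.val (R j) y = l i * nu j" for j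
    using w(2)[OF R] val_y[OF R] by (auto simp: nu_def)

  have val_q: "V.val Q (of_nat (q k)) = of_bool (k = i)" if k: "k \<in> {1..n}" for k
  proof (cases "k = i")
    case False
    \<comment> \<open>\<open>q i\<close> is the only prime number in \<open>Q\<close>, and the
      \<open>q k\<close> are distinct.\<close>
    have "of_int (int (q k)) \<notin> Q"
    proof
      assume "of_int (int (q k)) \<in> Q"
      then have "int (q i) dvd int (q k)"
        using C.prime_ideal_of_int_iff[OF V.prime_S[OF Q] q_prime[OF i] V.q_mem[OF Q]] by blast
      then have "q i = q k" using primes_dvd_imp_eq[OF q_prime[OF i] q_prime[OF k]] by simp
      then show False using False q(2) i k by (auto dest: inj_onD)
    qed
    then show ?thesis using False V.val_unit[OF Q, of "of_nat (q k)"] C.int_ring_of_nat by simp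
  qed (simp add: V.val_q[OF Q])
  define m where "m = (\<Prod>k=1..n. (of_nat (q k) :: complex) powi l k)"
  have qL: "(of_nat (q k) :: complex) \<in> L" "(of_nat (q k) :: complex) \<noteq> 0" if "k \<in> {1..n}" for k
    using subfield_of_nat[OF C.L] q_prime[OF that] by auto
  have powi_L: "a powi z \<in> L" if "a \<in> L" for a z
    using that by (auto simp: power_int_def intro: subfield_power[OF C.L] subfield_inverse[OF C.L])
  have m: "m \<in> L" "m \<noteq> 0" unfolding m_def using qL powi_L by (auto intro!: subfield_prod[OF C.L])
  have "V.val Q m = (\<Sum>k=1..n. l k * of_bool (k = i))" unfolding m_def using qL powi_L val_q
    by (subst V.val_prod[OF Q]) (auto intro!: sum.cong simp: V.val_powi[OF Q])
  also have "\<dots> = l i" using i by (simp add: of_bool_def if_distrib cong: if_cong)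
  finally have val_m: "V.val Q m = l i" .
  \<comment> \<open>\<open>a\<close> and \<open>- a\<close> have the same square; this takes care of
    the sign in the norm condition.\<close>
  have val_minus: "V.val Q (- a) = V.val Q a" if "a \<in> L" "a \<noteq> 0" for a
  proof -
    have "V.val Q (- a) + V.val Q (- a) = V.val Q a + V.val Q a"
      using that V.val_mult[OF Q, of "- a" "- a"] V.val_mult[OF Q, of a a] subfield_minus[OF C.L] by simp
    then show ?thesis by simp
  qed
  have "l i = V.val Q (field_norm L \<rat> x)"
    using norm val_m val_minus[OF m] unfolding m_def[symmetric] by auto
  also have "\<dots> = (\<Sum>j=0..p - 2. V.val Q ((\<tau> ^^ j) y))"
    unfolding C.field_norm_tower[OF \<tau> x(1)] y_def[symmetric] using \<tau>L y by (intro V.val_prod[OF Q]) auto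
  also have "\<dots> = l i * (\<Sum>j=0..p - 2. nu j)" unfolding val_R[OF y] nu(2) sum_distrib_left ..
  \<comment> \<open>Cancelling the nonzero \<open>l i\<close>, positive or negative, leaves a
    statement on nonnegative integers.\<close>
  finally have "(\<Sum>j=0..p - 2. nu j) = 1" using l i by auto
  moreover obtain j where j: "j \<in> {0..p - 2}" "nu j \<noteq> 0"
    using calculation by (metis sum.neutral zero_neq_one)
  moreover have "(\<Sum>j=0..p - 2. nu j) = nu j + (\<Sum>k\<in>{0..p - 2} - {j}. nu k)"
    using j(1) by (intro sum.remove) auto
  moreover have "(\<Sum>k\<in>{0..p - 2} - {j}. nu k) \<ge> 0" using nu(1) by (intro sum_nonneg)
  ultimately have nu_j: "nu j = 1" "(\<Sum>k\<in>{0..p - 2} - {j}. nu k) = 0" using nu(1)[of j] by linarith+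
  have nu_k: "nu k = 0" if "k \<in> {0..p - 2} - {j}" for k
    using nu_j(2) nu(1) that by (subst (asm) sum_nonneg_eq_0_iff) auto

  \<comment> \<open>Only the values of \<open>y\<close> at the primes of \<open>S\<close> enter, so
    the claim is made for every \<open>y'\<close> with the same values; it then applies to
    \<open>y\<close> and to \<open>\<zeta> * y\<close>.\<close>
  have not_power: "\<Phi> p e \<tau> y' \<notin> pth_powers p L"
    if y': "y' \<in> L" "y' \<noteq> 0" "\<And>R. R \<in> S \<Longrightarrow> V.val R y' = V.val R y" for y'
  proof
    assume "\<Phi> p e \<tau> y' \<in> pth_powers p L"
    then obtain z where z: "z \<in> L" "z \<noteq> 0" "\<Phi> p e \<tau> y' = z ^ p" unfolding pth_powers_def by blast
    have "int p * V.val Q z = V.val Q (\<Phi> p e \<tau> y')" unfolding z(3) using V.val_power[OF Q z(1,2)] by simp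
    also have "\<dots> = (\<Sum>k=0..p - 2. V.val Q (((\<tau> ^^ k) y') ^ (e ^ (p - 2 - k))))"
      unfolding Phi_def using \<tau>L[OF y'(1,2)] by (intro V.val_prod[OF Q]) (auto intro: subfield_power[OF C.L])
    also have "\<dots> = (\<Sum>k=0..p - 2. int (e ^ (p - 2 - k)) * (l i * nu k))"
      using \<tau>L[OF y'(1,2)] val_R[OF y'(1,2)] y'(3)[OF R] nu(2)
      by (intro sum.cong refl) (simp add: V.val_power[OF Q])
    also have "\<dots> = (\<Sum>k\<in>{j}. int (e ^ (p - 2 - k)) * (l i * nu k))"
      using j(1) nu_k by (intro sum.mono_neutral_right) auto
    also have "\<dots> = int e ^ (p - 2 - j) * l i" by (simp add: nu_j(1))
    finally have "int p dvd int e ^ (p - 2 - j) * l i" by (metis dvd_triv_left)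
    \<comment> \<open>A primitive root modulo \<open>p\<close> is coprime to
      \<open>p\<close>.\<close>
    moreover have "\<not> int p dvd int e ^ (p - 2 - j)"
    proof
      assume "int p dvd int e ^ (p - 2 - j)"
      then have "p dvd e" using p(1) by (metis of_nat_dvd_iff of_nat_power prime_dvd_power)
      moreover have "Rings.coprime p e" using e by (simp add: residue_primroot_def)
      ultimately show False using p(1) by (metis coprime_absorb_left not_prime_unit)
    qed
    ultimately show False using l_i p(1) by (simp add: prime_dvd_mult_iff)
  qed
  have zeta_unit: "V.val R \<zeta> = 0" if "R \<in> S" for R
  proof (rule V.val_unit[OF that], intro DiffI)
    show "\<zeta> \<in> \<O> L" using C.zeta_L C.algebraic_int_B[OF C.zeta_B] by (simp add: int_ring_def)
    \<comment> \<open>The inverse of \<open>\<zeta>\<close> is again an integer of \<open>L\<close>,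
      so no prime ideal contains \<open>\<zeta>\<close>.\<close>
    moreover have "\<zeta> ^ (p - 1) * \<zeta> = 1" using C.zeta_power_p p(1) by (metis power_minus_mult prime_gt_0_nat)
    ultimately show "\<zeta> \<notin> R"
      using C.prime_ideal_mult[OF V.prime_S[OF that], of "\<zeta> ^ (p - 1)" \<zeta>] C.prime_ideal_1[OF V.prime_S[OF that]]
        C.int_ring_power by auto
  qed
  have "\<Phi> p e \<tau> y \<notin> pth_powers p L" using not_power[OF y] by simp
  moreover have "\<Phi> p e \<tau> (\<zeta> * y) \<notin> pth_powers p L" using y C.zeta_L C.zeta_nonzero zeta_unit
    by (intro not_power) (auto simp: V.val_mult intro: subfield_mult[OF C.L])
  ultimately show ?thesis by (simp add: y_def)
qed

end
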